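(* Suppose that $\Phi(0)>0$ and that the function $f$ on $(0,\infty)$ can be represented as the Laplace transform of a nonnegative function $g$, i.e. $f(x)=\int_0^\infty e^{-xz}g(z)\,dz$ for $x>0$. Then the following four statements are all equivalent: (i) $\mathbb{P}_x(A_\infty(f)<\infty\mid \zeta=\infty)>0$ for all $x>0$; (ii) $\mathbb{P}_x(A_\infty(f)<\infty\mid \zeta=\infty)=1$ for all $x>0$; (iii) $\mathbb{E}_x[A_{\tau_y^-}(f)]<\infty$ for all $x>0$ and all $y\in(0,x)$; (iv) $\displaystyle\int_{0+}\frac{g(\lambda)}{\psi(\lambda)}\,d\lambda>-\infty$, where $\int_{0+}$ means that the integral converges near $0$, i.e. over $(0,\delta)$ for some $\delta\in(0,\Phi(0))$.
   Context: Let $b\in\mathbb{R}$, $c\ge 0$ be constants and $\pi$ a $\sigma$-finite measure on $(0,\infty)$ with $\int_{(0,\infty)}(1\wedge z^2)\,\pi(dz)<\infty$. $Z=(Z_t)_{t\ge 0}$ is a spectrally positive Lévy process (a one-dimensional Lévy process with no negative jumps), represented when started at $x$ as $$Z_t=x-bt+\sqrt{2c}\,B_t+\int_0^t\int_{(0,1]}z\,\tilde N(ds,dz)+\int_0^t\int_{(1,\infty)}z\,N(ds,dz),$$ with $B$ a Brownian motion, $N(ds,dz)$ an independent Poisson random measure on $(0,\infty)\times(0,\infty)$ with intensity $ds\,\pi(dz)$, and $\tilde N(ds,dz)=N(ds,dz)-ds\,\pi(dz)$. Standing assumption: $Z$ is not a subordinator. $\mathbb{P}_x$ is the law of $Z$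 with $Z_0=x$ and $\mathbb{E}_x$ the corresponding expectation. The Laplace exponent $\psi$ is given by $\mathbb{E}_x[e^{-\lambda Z_t}]=e^{-\lambda x+\psi(\lambda)t}$, i.e. $$\psi(\lambda)=b\lambda+c\lambda^2+\int_{(0,\infty)}\big(e^{-\lambda u}-1+\lambda u1_{(0,1]}(u)\big)\pi(du),\quad \lambda\ge 0,$$ and $\Phi(0):=\inf\{\lambda>0:\psi(\lambda)>0\}<\infty$. $\zeta:=\inf\{t>0: Z_t=0\}$ and, for $y\ge 0$, $\tau_y^-:=\inf\{t\ge 0: Z_t\le y\}$, with $\inf\emptyset=\infty$. One has $\mathbb{P}_x(\zeta=\infty)=1-e^{-\Phi(0)x}$, which is positive when $\Phi(0)>0$. The integral functional is $A_t(f):=\int_0^t f(Z_s)\,ds$ for $t\in[0,\infty]$, considered up to time $\zeta$ (so that on $\{\zeta=\infty\}$, $A_\infty(f)=A_\zeta(f)$). The functions $f$ and $g$ are measurable, and $f$ is finite-valued on $(0,\infty)$. *)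

theory Defs
  imports "HOL-Probability.Probability"
begin

section \<open>Spectrally positive Levy processes\<close>

definition cadlag :: "(real \<Rightarrow> real) \<Rightarrow> bool" where
  "cadlag z \<longleftrightarrow>
     (\<forall>t\<ge>0. continuous (at_right t) z) \<and>
     (\<forall>t>0. \<exists>l. (z \<longlongrightarrow> l) (at_left t))"

definition no_negative_jumps :: "(real \<Rightarrow> real) \<Rightarrow> bool" where
  "no_negative_jumps z \<longleftrightarrow> (\<forall>t>0. \<forall>l. (z \<longlongrightarrow> l) (at_left t) \<longrightarrow> l \<le> z t)"

text \<open>
  Time is \<open>[0, \<infinity>)\<close>: only the values \<open>X t\<close> with \<open>t \<ge> 0\<close> matter.
\<close>

locale levy_process = prob_space M for M :: "'a measure" +
  fixes X :: "real \<Rightarrow> 'a \<Rightarrow> real"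
  assumes random_variable_X: "\<And>t. t \<ge> 0 \<Longrightarrow> random_variable borel (X t)"
    and X_0: "AE \<omega> in M. X 0 \<omega> = 0"
    and cadlag_paths: "AE \<omega> in M. cadlag (\<lambda>t. X t \<omega>)"
    and independent_increments:
      "\<And>(n::nat) (t::nat \<Rightarrow> real). 0 \<le> t 0 \<Longrightarrow> (\<And>i. i < n \<Longrightarrow> t i \<le> t (Suc i)) \<Longrightarrow>
         indep_vars (\<lambda>_. borel) (\<lambda>i \<omega>. X (t (Suc i)) \<omega> - X (t i) \<omega>) {..<n}"
    and stationary_increments:
      "\<And>s t. s \<ge> 0 \<Longrightarrow> t \<ge> 0 \<Longrightarrow>
         distr M borel (\<lambda>\<omega>. X (s + t) \<omega> - X s \<omega>) = distr M borel (X t)"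

definition subordinator :: "'a measure \<Rightarrow> (real \<Rightarrow> 'a \<Rightarrow> real) \<Rightarrow> bool" where
  "subordinator M X \<longleftrightarrow> levy_process M X \<and> (AE \<omega> in M. mono_on {0..} (\<lambda>t. X t \<omega>))"

definition levy_measure :: "real measure \<Rightarrow> bool" where
  "levy_measure \<pi> \<longleftrightarrow>
     sets \<pi> = sets (restrict_space borel {0<..}) \<and>
     sigma_finite_measure \<pi> \<and>
     (\<integral>\<^sup>+ z. ennreal (min 1 (z\<^sup>2)) \<partial>\<pi>) < \<infinity>"

definition laplace_exponent :: "real \<Rightarrow> real \<Rightarrow> real measure \<Rightarrow> real \<Rightarrow> real" where
  "laplace_exponent b c \<pi> l =
     b * l + c * l\<^sup>2 + (\<integral>u. exp (- l * u) - 1 + l * u * indicator {0<..1} u \<partial>\<pi>)"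

text \<open>
  The characteristics \<open>(b, c, \<pi>)\<close> are attached to the process through its Laplace
  exponent. By the Levy-Ito decomposition this says that \<open>X\<close> has the law of
  \<open>- b t + sqrt (2 c) B\<^sub>t\<close> plus the compensated jumps of size at most 1 plus the jumps of
  size greater than 1, the jumps forming a Poisson random measure with intensity
  \<open>dt \<pi>(dz)\<close>. The process is normalised to start at 0; the law \<open>P\<^sub>x\<close> of the process
  started at \<open>x\<close> is the law of \<open>t \<mapsto> x + X\<^sub>t\<close>.
\<close>

locale spectrally_positive_levy_process = levy_process M X
  for M :: "'a measure" and X :: "real \<Rightarrow> 'a \<Rightarrow> real" +
  fixes b c :: real and \<pi> :: "real measure"
  assumes c_nonneg: "c \<ge> 0"
    and levy_measure: "levy_measure \<pi>"
    and no_negative_jumps: "AE \<omega> in M. no_negative_jumps (\<lambda>t. X t \<omega>)"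
    and laplace_transform:
      "\<And>l t. l \<ge> 0 \<Longrightarrow> t \<ge> 0 \<Longrightarrow>
         has_bochner_integral M (\<lambda>\<omega>. exp (- l * X t \<omega>)) (exp (laplace_exponent b c \<pi> l * t))"

text \<open>Extended reals are used so that the infimum of the empty set is \<open>\<infinity>\<close>.\<close>

definition Phi0 :: "real \<Rightarrow> real \<Rightarrow> real measure \<Rightarrow> ereal" where
  "Phi0 b c \<pi> = Inf (ereal ` {l. l > 0 \<and> laplace_exponent b c \<pi> l > 0})"


section \<open>Path functionals\<close>

definition zeta :: "(real \<Rightarrow> real) \<Rightarrow> ereal" where
  "zeta z = Inf (ereal ` {t. t > 0 \<and> z t = 0})"

definition tau_minus :: "real \<Rightarrow> (real \<Rightarrow> real) \<Rightarrow> ereal" where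
  "tau_minus y z = Inf (ereal ` {t. t \<ge> 0 \<and> z t \<le> y})"

text \<open>
  \<open>f\<close> is a nonnegative function on \<open>(0, \<infinity>)\<close>. The functional is meaningful for
  \<open>T \<le> zeta z\<close> and a path started above 0 without negative jumps, which takes only
  positive values before \<open>zeta z\<close>.
\<close>

definition additive_functional :: "(real \<Rightarrow> real) \<Rightarrow> (real \<Rightarrow> real) \<Rightarrow> ereal \<Rightarrow> ennreal" where
  "additive_functional f z T =
     (\<integral>\<^sup>+ s \<in> {s. 0 \<le> s \<and> ereal s \<le> T}. ennreal (f (z s)) \<partial>lborel)"

text \<open>
  Probabilities and expectations of these functionals are taken under the completion of
  \<open>M\<close>: \<open>zeta\<close> is an infimum over uncountably many times, so an event such as
  \<open>zeta = \<infinity>\<close> is in general measurable only up to a null set.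
\<close>

end

theory Submission
  imports Defs "HOL-Real_Asymp.Real_Asymp"
begin

text \<open>
  For \<open>0 < l < \<Phi>(0)\<close> one has \<open>E \<integral>\<^sub>0\<^sup>\<infinity> exp (- l X\<^sub>s) ds = 1 / \<bar>\<psi>(l)\<bar>\<close>, so Fubini turns the integral
  in (iv) into the expectation of \<open>\<integral>\<^sub>0\<^sup>\<infinity> f\<^sub>0(X\<^sub>s) ds\<close>, where \<open>f\<^sub>0\<close> is the part of the Laplace
  transform \<open>f\<close> carried by frequencies in \<open>(0, \<delta>)\<close>. Above a level \<open>y > 0\<close> the rest of \<open>f\<close> is
  dominated by a multiple of \<open>exp (- \<delta> z)\<close>; hence (iv) implies (iii) and (ii).

  Conversely, let the integral in (iv) diverge. The mixed moments of the functionals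
  \<open>\<integral>\<^sub>0\<^sup>\<infinity> exp (- l X\<^sub>s) ds\<close> are explicit, and convexity of \<open>\<psi>\<close> gives \<open>\<bar>\<psi>(l + m)\<bar> \<ge> \<bar>\<psi>(l)\<bar> / 2\<close> for small
  frequencies; so the second moment of each truncation of \<open>\<integral>\<^sub>0\<^sup>\<infinity> f\<^sub>0(X\<^sub>s) ds\<close> is at most four times
  its squared mean. By the second moment method the functional is infinite with probability
  at least 1/16, and by a zero-one law almost surely. This contradicts (i) and (iii).

  Finally \<open>{\<zeta> = \<infinity>}\<close> is, up to a null set, both the event that the infimum of the path is positive and
  the event that the path does not become nonpositive: the probability that \<open>x + X\<close> reaches
  \<open>(- \<infinity>, 0]\<close> is \<open>exp (- \<Phi>(0) x)\<close>, which is continuous in \<open>x\<close>.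
\<close>

section \<open>Paths and increments\<close>

text \<open>The functional in (i) and (ii) is considered up to \<open>\<zeta>\<close>, but the
  closed moment formulas belong to the path that is not stopped. The low-frequency part of
  \<open>f\<close> bridges this gap: it is the Laplace transform of a finite measure on a bounded
  set, hence finite on the whole line, and can be integrated along the unstopped path. Stopping
  returns only on paths that stay positive, where \<open>f\<close> dominates this part. Shifting its
  argument by \<open>h\<close> costs at most the factor \<open>exp (d * \<bar>h\<bar>)\<close>; this
  one estimate removes both the starting point and the value of \<open>X\<close> at time
  \<open>T\<close> in the zero-one law.

  First passage is treated on finite time grids, by iterating a one-step identity for
  \<open>exp (- l * X)\<close>. The price is the overshoot of a grid step; it is controlled by a
  second, much larger frequency, and the quadratic growth of \<open>psi\<close> decides how fast
  that frequency may increase with the refinement of the grid.\<close>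

lemma cadlag_hits_zero:
  assumes "cadlag z" "no_negative_jumps z" "z 0 > 0" "t \<ge> 0" "z t \<le> 0"
  shows "\<exists>s>0. s \<le> t \<and> z s = 0"
proof -
  define S where "S = {s. 0 \<le> s \<and> z s \<le> 0}"
  \<comment> \<open>The zero is the infimum of the times with nonpositive values: right continuity
    gives \<open>z u \<le> 0\<close>, the left limit at \<open>u\<close> is nonnegative, and no
    downward jump leads from it to a negative value.\<close>
  define u where "u = Inf S"
  have bdd: "bdd_below S" unfolding S_def by (auto intro!: bdd_belowI[of _ 0])
  have tS: "t \<in> S" using assms by (auto simp: S_def)
  have u0: "0 \<le> u" unfolding u_def using tS by (intro cInf_greatest) (auto simp: S_def)
  have ut: "u \<le> t" unfolding u_def by (rule cInf_lower[OF tS bdd])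
  have before: "z s > 0" if "0 \<le> s" "s < u" for s
  proof (rule ccontr)
    assume "\<not> z s > 0"
    then have "s \<in> S" using that by (auto simp: S_def)
    then show False using cInf_lower[OF _ bdd, of s] that(2) by (simp add: u_def)
  qed
  have zu: "z u \<le> 0"
  proof (rule ccontr)
    assume "\<not> z u \<le> 0"
    then have pos: "z u > 0" by simp
    have "(z \<longlongrightarrow> z u) (at_right u)"
      using assms(1) u0 by (simp add: cadlag_def continuous_within)
    from order_tendstoD(1)[OF this pos] obtain v where v: "u < v" "\<And>y. u < y \<Longrightarrow> y < v \<Longrightarrow> z y > 0"
      by (auto simp: eventually_at_right[of u "u+1"])
    have "v \<le> Inf S"
    proof (rule cInf_greatest)
      show "S \<noteq> {}" using tS by auto
      fix s assume s: "s \<in> S"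
      then have "u \<le> s" using cInf_lower[OF s bdd] by (simp add: u_def)
      then show "v \<le> s" using v pos s by (cases "s = u"; cases "v \<le> s") (force simp: S_def not_le)+
    qed
    then show False using v(1) by (simp add: u_def)
  qed
  then have upos: "u > 0" using assms(3) u0 by (cases "u = 0") auto
  then obtain l where l: "(z \<longlongrightarrow> l) (at_left u)" using assms(1) by (auto simp: cadlag_def)
  have "l \<ge> 0"
  proof (rule tendsto_lowerbound[OF l])
    show "\<forall>\<^sub>F x in at_left u. 0 \<le> z x"
      using upos before by (auto simp: eventually_at_left[of 0 u] intro!: exI[of _ 0] less_imp_le)
  qed simp
  moreover have "l \<le> z u" using assms(2) upos l by (auto simp: no_negative_jumps_def)
  ultimately show ?thesis using zu upos ut by (intro exI[of _ u]) auto
qed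

text \<open>The grid point lies strictly to the right of \<open>s\<close>, even when
  \<open>s\<close> is itself on the grid, so that \<open>dyad n s\<close> tends to \<open>s\<close>
  in the filter \<open>at_right s\<close>.\<close>

definition dyad :: "nat \<Rightarrow> real \<Rightarrow> real" where
  "dyad n s = real (Suc (nat \<lfloor>2 ^ n * s\<rfloor>)) / 2 ^ n"

lemma dyad_gt: "0 \<le> s \<Longrightarrow> s < dyad n s"
proof -
  assume "0 \<le> s"
  have "2 ^ n * s < real_of_int \<lfloor>2 ^ n * s\<rfloor> + 1" by linarith
  also have "\<dots> = real (Suc (nat \<lfloor>2 ^ n * s\<rfloor>))" using \<open>0 \<le> s\<close> by simp
  finally show ?thesis by (simp add: dyad_def field_simps)
qed

lemma dyad_le: "0 \<le> s \<Longrightarrow> dyad n s \<le> s + (1/2) ^ n"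
proof -
  assume "0 \<le> s"
  have "real (Suc (nat \<lfloor>2 ^ n * s\<rfloor>)) = real_of_int \<lfloor>2 ^ n * s\<rfloor> + 1" using \<open>0 \<le> s\<close> by simp
  also have "\<dots> \<le> 2 ^ n * s + 1" by linarith
  finally show ?thesis by (simp add: dyad_def field_simps power_divide)
qed

lemma filterlim_dyad: "0 \<le> s \<Longrightarrow> filterlim (\<lambda>n. dyad n s) (at_right s) sequentially"
proof -
  assume s: "0 \<le> s"
  have "(\<lambda>n. dyad n s) \<longlonglongrightarrow> s"
  proof (rule tendsto_sandwich)
    show "\<forall>\<^sub>F n in sequentially. s \<le> dyad n s" by (simp add: less_imp_le dyad_gt s)
    show "\<forall>\<^sub>F n in sequentially. dyad n s \<le> s + (1/2) ^ n" by (simp add: dyad_le s)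
    show "(\<lambda>n. s + (1/2) ^ n) \<longlonglongrightarrow> s"
      using tendsto_add[OF tendsto_const, OF LIMSEQ_power_zero[of "1/2::real"], of s] by simp
  qed simp
  then show ?thesis using dyad_gt[OF s] by (simp add: filterlim_at greaterThan_def less_imp_neq[symmetric] less_imp_neq[THEN not_sym])
qed

lemma right_continuous_dyad_limit:
  fixes z :: "real \<Rightarrow> real"
  assumes "continuous (at_right s) z" "0 \<le> s"
  shows "(\<lambda>n. z (dyad n s)) \<longlonglongrightarrow> z s"
  using filterlim_compose[OF _ filterlim_dyad[OF assms(2)], of z] assms(1)
  by (simp add: continuous_within)

text \<open>The value at \<open>s\<close> is the limit of values at grid points to its right, and
  for each mesh only countably many grid times occur. The space \<open>N\<close> is arbitrary
  because the lemma also serves the sigma-algebras of the past and of the future.\<close>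

lemma measurable_right_continuous_process:
  fixes Y :: "real \<Rightarrow> 'a \<Rightarrow> real"
  assumes rc: "\<And>s \<omega>. \<omega> \<in> space N \<Longrightarrow> 0 \<le> s \<Longrightarrow> continuous (at_right s) (\<lambda>s. Y s \<omega>)"
    and meas: "\<And>n k. Y (real k / 2 ^ n) \<in> borel_measurable N"
  shows "(\<lambda>(s, \<omega>). Y (max 0 s) \<omega>) \<in> borel_measurable (lborel \<Otimes>\<^sub>M N)"
proof (rule borel_measurable_LIMSEQ_real)
  fix p assume p: "p \<in> space ((lborel :: real measure) \<Otimes>\<^sub>M N)"
  show "(\<lambda>n. (\<lambda>(s, \<omega>). Y (dyad n (max 0 s)) \<omega>) p) \<longlonglongrightarrow> (\<lambda>(s, \<omega>). Y (max 0 s) \<omega>) p"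
    using p by (auto simp: space_pair_measure intro!: right_continuous_dyad_limit rc)
next
  fix n
  have [measurable]: "(\<lambda>p. Y (real (Suc i) / 2 ^ n) (snd p)) \<in> borel_measurable ((lborel::real measure) \<Otimes>\<^sub>M N)" for i
    by (rule measurable_compose[OF measurable_snd meas])
  have "(\<lambda>p. Y (real (Suc (nat \<lfloor>2 ^ n * max 0 (fst p)\<rfloor>)) / 2 ^ n) (snd p)) \<in> borel_measurable ((lborel::real measure) \<Otimes>\<^sub>M N)"
    by (rule measurable_compose_countable[where f="\<lambda>i p. Y (real (Suc i) / 2 ^ n) (snd p)" and g="\<lambda>p. nat \<lfloor>2 ^ n * max 0 (fst p)\<rfloor>"])
      measurable
  then show "(\<lambda>(s, \<omega>). Y (dyad n (max 0 s)) \<omega>) \<in> borel_measurable ((lborel::real measure) \<Otimes>\<^sub>M N)"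
    by (simp add: dyad_def case_prod_beta)
qed

text \<open>
  A version of the process all of whose paths are right continuous and start at 0. The
  quadratic bound on \<open>psi\<close> replaces the absence of negative jumps: it makes the overshoot
  below a level disappear when the time grid is refined.
\<close>

locale regular_levy = prob_space M for M :: "'a measure" +
  fixes X :: "real \<Rightarrow> 'a \<Rightarrow> real" and psi :: "real \<Rightarrow> real" and Phi C :: real
  assumes measurable_X: "\<And>t. 0 \<le> t \<Longrightarrow> X t \<in> borel_measurable M"
    and X_zero: "\<And>\<omega>. X 0 \<omega> = 0"
    and right_continuous: "\<And>t \<omega>. 0 \<le> t \<Longrightarrow> continuous (at_right t) (\<lambda>t. X t \<omega>)"
    and indep_increments:
      "\<And>(n::nat) (t::nat \<Rightarrow> real). 0 \<le> t 0 \<Longrightarrow> (\<And>i. i < n \<Longrightarrow> t i \<le> t (Suc i)) \<Longrightarrow>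
         indep_vars (\<lambda>_. borel) (\<lambda>i \<omega>. X (t (Suc i)) \<omega> - X (t i) \<omega>) {..<n}"
    and laplace_increment:
      "\<And>l s t. 0 \<le> l \<Longrightarrow> 0 \<le> s \<Longrightarrow> 0 \<le> t \<Longrightarrow>
         has_bochner_integral M (\<lambda>\<omega>. exp (- l * (X (s + t) \<omega> - X s \<omega>))) (exp (psi l * t))"
    and psi_quadratic: "\<And>l. 1 \<le> l \<Longrightarrow> psi l \<le> C * l\<^sup>2"
    and psi_measurable [measurable]: "psi \<in> borel_measurable borel"
    and Phi_pos: "0 < Phi"
    and psi_neg: "\<And>l. 0 < l \<Longrightarrow> l < Phi \<Longrightarrow> psi l < 0"
    and psi_pos_near: "\<And>e. 0 < e \<Longrightarrow> \<exists>l\<ge>Phi. l < Phi + e \<and> 0 < psi l"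
begin

text \<open>Increments over disjoint blocks are independent; partial sums turn the first block into
  positions (as \<open>t 0 = 0\<close> and \<open>X 0 = 0\<close>) and the second into displacements
  from time \<open>t m\<close>.\<close>

lemma indep_past_future:
  fixes t :: "nat \<Rightarrow> real"
  assumes t0: "t 0 = 0" and mono: "\<And>i. t i \<le> t (Suc i)"
  shows "indep_var (PiM {..m} (\<lambda>_. borel)) (\<lambda>\<omega>. \<lambda>k\<in>{..m}. X (t k) \<omega>)
     (PiM {..n} (\<lambda>_. borel)) (\<lambda>\<omega>. \<lambda>k\<in>{..n}. X (t (m + k)) \<omega> - X (t m) \<omega>)"
proof -
  define D where "D = (\<lambda>i \<omega>. X (t (Suc i)) \<omega> - X (t i) \<omega>)"
  have "indep_vars (\<lambda>_. borel) D {..<m+n}"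
    unfolding D_def using assms by (intro indep_increments) auto
  then have *: "indep_var (PiM {..<m} (\<lambda>_. borel)) (\<lambda>\<omega>. \<lambda>i\<in>{..<m}. D i \<omega>)
     (PiM {m..<m+n} (\<lambda>_. borel)) (\<lambda>\<omega>. \<lambda>i\<in>{m..<m+n}. D i \<omega>)"
    by (rule indep_var_restrict) auto
  define F where "F = (\<lambda>y::nat\<Rightarrow>real. \<lambda>k\<in>{..m}. \<Sum>j<k. y j)"
  define G where "G = (\<lambda>y::nat\<Rightarrow>real. \<lambda>k\<in>{..n}. \<Sum>j\<in>{m..<m+k}. y j)"
  have F: "F \<in> PiM {..<m} (\<lambda>_. borel) \<rightarrow>\<^sub>M PiM {..m} (\<lambda>_. borel)"
    unfolding F_def by (intro measurable_restrict borel_measurable_sum measurable_component_singleton) auto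
  have G: "G \<in> PiM {m..<m+n} (\<lambda>_. borel) \<rightarrow>\<^sub>M PiM {..n} (\<lambda>_. borel)"
    unfolding G_def by (intro measurable_restrict borel_measurable_sum measurable_component_singleton) auto
  have sumD: "\<forall>i k \<omega>. (\<Sum>j\<in>{i..<i+k}. D j \<omega>) = X (t (i + k)) \<omega> - X (t i) \<omega>"
  proof (intro allI)
    fix i k \<omega>
    show "(\<Sum>j\<in>{i..<i+k}. D j \<omega>) = X (t (i + k)) \<omega> - X (t i) \<omega>"
      by (induction k) (auto simp: D_def)
  qed
  have "F \<circ> (\<lambda>\<omega>. \<lambda>i\<in>{..<m}. D i \<omega>) = (\<lambda>\<omega>. \<lambda>k\<in>{..m}. X (t k) \<omega>)"
    using sumD[rule_format, where i=0] by (auto simp: F_def fun_eq_iff restrict_def t0 X_zero atLeast0LessThan intro!: sum.cong)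
  moreover have "G \<circ> (\<lambda>\<omega>. \<lambda>i\<in>{m..<m+n}. D i \<omega>) = (\<lambda>\<omega>. \<lambda>k\<in>{..n}. X (t (m + k)) \<omega> - X (t m) \<omega>)"
    using sumD[rule_format, where i=m] by (auto simp: G_def fun_eq_iff restrict_def intro!: sum.cong)
  ultimately show ?thesis using indep_var_compose[OF * F G] by simp
qed

lemma laplace_X: "0 \<le> l \<Longrightarrow> 0 \<le> t \<Longrightarrow> has_bochner_integral M (\<lambda>\<omega>. exp (- l * X t \<omega>)) (exp (psi l * t))"
  using laplace_increment[of l 0 t] by (simp add: X_zero)

lemma nn_laplace_X: "0 \<le> l \<Longrightarrow> 0 \<le> t \<Longrightarrow> (\<integral>\<^sup>+\<omega>. ennreal (exp (- l * X t \<omega>)) \<partial>M) = ennreal (exp (psi l * t))"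
  using laplace_X[of l t] by (subst nn_integral_eq_integral) (auto simp: has_bochner_integral_iff)

text \<open>\<open>l * X s + m * X r\<close> equals \<open>(l + m) * X s + m * (X r - X s)\<close>,
  a sum of two independent terms.\<close>

lemma laplace_two_times:
  assumes "0 \<le> l" "0 \<le> m" "0 \<le> s" "s \<le> r"
  shows "(\<integral>\<^sup>+\<omega>. ennreal (exp (- l * X s \<omega>)) * ennreal (exp (- m * X r \<omega>)) \<partial>M) =
    ennreal (exp (psi (l + m) * s)) * ennreal (exp (psi m * (r - s)))"
proof -
  define t where "t = (\<lambda>k::nat. if k = 0 then 0 else if k = 1 then s else r)"
  have "indep_var (PiM {..1} (\<lambda>_. borel)) (\<lambda>\<omega>. \<lambda>k\<in>{..1}. X (t k) \<omega>)
     (PiM {..1} (\<lambda>_. borel)) (\<lambda>\<omega>. \<lambda>k\<in>{..1}. X (t (1 + k)) \<omega> - X (t 1) \<omega>)"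
    using assms by (intro indep_past_future) (auto simp: t_def)
  from indep_var_compose[OF this, of "\<lambda>y. exp (- (l + m) * y 1)" borel "\<lambda>y. exp (- m * y 1)" borel]
  have ind: "indep_var borel (\<lambda>\<omega>. exp (- (l + m) * X s \<omega>)) borel (\<lambda>\<omega>. exp (- m * (X r \<omega> - X s \<omega>)))"
    by (simp add: comp_def t_def)
  have a: "has_bochner_integral M (\<lambda>\<omega>. exp (- (l + m) * X s \<omega>)) (exp (psi (l + m) * s))"
    using assms by (intro laplace_X) auto
  have b: "has_bochner_integral M (\<lambda>\<omega>. exp (- m * (X r \<omega> - X s \<omega>))) (exp (psi m * (r - s)))"
    using laplace_increment[of m s "r - s"] assms by simp
  have eq: "exp (- (l + m) * X s \<omega>) * exp (- m * (X r \<omega> - X s \<omega>)) = exp (- l * X s \<omega>) * exp (- m * X r \<omega>)" for \<omega>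
    by (simp add: exp_add[symmetric] algebra_simps)
  have i: "integrable M (\<lambda>\<omega>. exp (- l * X s \<omega>) * exp (- m * X r \<omega>))"
    using indep_var_integrable[OF ind] a b eq by (simp add: has_bochner_integral_iff)
  have "(\<integral>\<omega>. exp (- l * X s \<omega>) * exp (- m * X r \<omega>) \<partial>M) = exp (psi (l + m) * s) * exp (psi m * (r - s))"
    using indep_var_lebesgue_integral[OF ind] a b eq by (simp add: has_bochner_integral_iff)
  with i show ?thesis by (subst ennreal_mult[symmetric], simp, simp)+ (subst nn_integral_eq_integral, auto)
qed

end

section \<open>First passage below a level\<close>

lemma Suc_mult: "real K * h + h = real (Suc K) * h" for h :: real
  by (simp add: algebra_simps)

text \<open>If \<open>v\<close> stays above \<open>- x - e\<close>, the first term suffices.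
  Otherwise the step from \<open>u\<close> to \<open>v\<close> falls by more than \<open>e\<close>,
  and using frequency \<open>m\<close> instead of \<open>l\<close> for this step gains the factor
  \<open>exp (- (m - l) * e)\<close>.\<close>

lemma exp_overshoot_le:
  fixes l m x u v e :: real
  assumes "0 \<le> l" "l \<le> m" "- x < u" "0 < e"
  shows "exp (- l * v) \<le> exp (l * (x + e)) + exp (l * x - (m - l) * e) * exp (- m * (v - u))"
proof (cases "v \<ge> - x - e")
  case True
  then have "- l * v \<le> l * (x + e)" using assms(1) mult_left_mono[of "-v" "x+e" l] by simp
  then show ?thesis by (intro add_increasing2) auto
next
  case False
  then have d: "v - u \<le> - e" using assms(3) by simp
  have "- l * v = - l * u - l * (v - u)" by (simp add: algebra_simps)
  also have "\<dots> \<le> l * x - l * (v - u)" using assms mult_left_mono[of "-u" x l] by simp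
  also have "\<dots> \<le> l * x - (m - l) * e - m * (v - u)"
    using mult_left_mono[OF d, of "m - l"] assms(2) by (simp add: algebra_simps)
  finally have "exp (- l * v) \<le> exp (l * x - (m - l) * e) * exp (- m * (v - u))"
    by (simp add: exp_add[symmetric])
  then show ?thesis by (intro add_increasing) auto
qed

section \<open>Exponential martingales on a finite time grid\<close>

context regular_levy
begin

definition above :: "real \<Rightarrow> real \<Rightarrow> nat \<Rightarrow> 'a set" where
  "above h x K = {\<omega>\<in>space M. \<forall>k\<le>K. - x < X (real k * h) \<omega>}"

text \<open>Restricting to dyadic times makes this an event of \<open>M\<close>.
  \<open>AE_zeta_reach\<close> identifies its complement with \<open>\<zeta> = \<infinity>\<close>
  almost surely.\<close>

definition reach :: "real \<Rightarrow> 'a set" where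
  "reach x = {\<omega>\<in>space M. \<exists>n k. X (real k / 2 ^ n) \<omega> \<le> - x}"

lemma sets_above: "0 \<le> h \<Longrightarrow> above h x K \<in> events"
proof -
  assume "0 \<le> h"
  then have [measurable]: "X (real k * h) \<in> borel_measurable M" for k by (intro measurable_X) simp
  show ?thesis unfolding above_def by measurable
qed

lemma sets_reach: "reach x \<in> events"
proof -
  have [measurable]: "X (real k / 2 ^ n) \<in> borel_measurable M" for k n by (intro measurable_X) simp
  show ?thesis unfolding reach_def by measurable
qed

text \<open>Position and survival up to step \<open>K\<close> are functions of the past, and the
  next increment is independent of them with Laplace transform
  \<open>exp (psi l * h)\<close>.\<close>

lemma integral_above_step:
  assumes "0 \<le> h" "0 \<le> l"
  shows "integrable M (\<lambda>\<omega>. exp (- l * X (real (Suc K) * h) \<omega>) * indicator (above h x K) \<omega>)"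
    and "(\<integral>\<omega>. exp (- l * X (real (Suc K) * h) \<omega>) * indicator (above h x K) \<omega> \<partial>M) =
      exp (psi l * h) * (\<integral>\<omega>. exp (- l * X (real K * h) \<omega>) * indicator (above h x K) \<omega> \<partial>M)"
proof -
  define u where "u = (\<lambda>y::nat\<Rightarrow>real. exp (- l * y K) * indicator {y. \<forall>k\<le>K. - x < y k} y)"
  define v where "v = (\<lambda>y::nat\<Rightarrow>real. exp (- l * y 1))"
  have "indep_var (PiM {..K} (\<lambda>_. borel)) (\<lambda>\<omega>. \<lambda>k\<in>{..K}. X (real k * h) \<omega>)
     (PiM {..1} (\<lambda>_. borel)) (\<lambda>\<omega>. \<lambda>k\<in>{..1}. X (real (K + k) * h) \<omega> - X (real K * h) \<omega>)"
    using assms by (intro indep_past_future) (auto intro!: mult_right_mono)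
  moreover have "u \<in> borel_measurable (PiM {..K} (\<lambda>_. borel))"
    unfolding u_def indicator_def by measurable
  moreover have "v \<in> borel_measurable (PiM {..1} (\<lambda>_. borel))"
    unfolding v_def by measurable
  ultimately have "indep_var borel (u \<circ> (\<lambda>\<omega>. \<lambda>k\<in>{..K}. X (real k * h) \<omega>)) borel
      (v \<circ> (\<lambda>\<omega>. \<lambda>k\<in>{..1}. X (real (K + k) * h) \<omega> - X (real K * h) \<omega>))"
    by (rule indep_var_compose)
  moreover have "u \<circ> (\<lambda>\<omega>. \<lambda>k\<in>{..K}. X (real k * h) \<omega>) =
      (\<lambda>\<omega>. exp (- l * X (real K * h) \<omega>) * indicator {\<omega>. \<forall>k\<le>K. - x < X (real k * h) \<omega>} \<omega>)"
    by (auto simp: u_def fun_eq_iff indicator_def)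
  moreover have "v \<circ> (\<lambda>\<omega>. \<lambda>k\<in>{..1}. X (real (K + k) * h) \<omega> - X (real K * h) \<omega>) =
      (\<lambda>\<omega>. exp (- l * (X (real (Suc K) * h) \<omega> - X (real K * h) \<omega>)))"
    by (simp add: v_def fun_eq_iff add.commute)
  ultimately have ind: "indep_var borel (\<lambda>\<omega>. exp (- l * X (real K * h) \<omega>) * indicator {\<omega>. \<forall>k\<le>K. - x < X (real k * h) \<omega>} \<omega>)
     borel (\<lambda>\<omega>. exp (- l * (X (real (Suc K) * h) \<omega> - X (real K * h) \<omega>)))"
    by simp
  have b: "has_bochner_integral M (\<lambda>\<omega>. exp (- l * (X (real (Suc K) * h) \<omega> - X (real K * h) \<omega>))) (exp (psi l * h))"
    using laplace_increment[of l "real K * h" h] assms by (simp add: Suc_mult del: of_nat_Suc)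
  have ia: "integrable M (\<lambda>\<omega>. exp (- l * X (real K * h) \<omega>))"
    using laplace_X[of l "real K * h"] assms by (simp add: has_bochner_integral_iff)
  have ind_eq: "indicator {\<omega>. \<forall>k\<le>K. - x < X (real k * h) \<omega>} \<omega> = (indicator (above h x K) \<omega> :: real)"
    if "\<omega> \<in> space M" for \<omega>
    using that by (auto simp: above_def indicator_def)
  have a: "integrable M (\<lambda>\<omega>. exp (- l * X (real K * h) \<omega>) * indicator {\<omega>. \<forall>k\<le>K. - x < X (real k * h) \<omega>} \<omega>)"
    by (rule Bochner_Integration.integrable_cong[THEN iffD2, OF refl _ integrable_real_mult_indicator[OF sets_above[OF assms(1)] ia]])
      (simp add: ind_eq)
  have eq: "exp (- l * X (real K * h) \<omega>) * indicator {\<omega>. \<forall>k\<le>K. - x < X (real k * h) \<omega>} \<omega> *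
       exp (- l * (X (real (Suc K) * h) \<omega> - X (real K * h) \<omega>)) =
     exp (- l * X (real (Suc K) * h) \<omega>) * indicator {\<omega>. \<forall>k\<le>K. - x < X (real k * h) \<omega>} \<omega>" for \<omega>
    by (simp add: indicator_def exp_add[symmetric] algebra_simps del: of_nat_Suc)
  have "integrable M (\<lambda>\<omega>. exp (- l * X (real (Suc K) * h) \<omega>) * indicator {\<omega>. \<forall>k\<le>K. - x < X (real k * h) \<omega>} \<omega>)"
    using indep_var_integrable[OF ind a] b unfolding eq by (simp add: has_bochner_integral_iff)
  moreover have "(\<integral>\<omega>. exp (- l * X (real (Suc K) * h) \<omega>) * indicator {\<omega>. \<forall>k\<le>K. - x < X (real k * h) \<omega>} \<omega> \<partial>M) =
     (\<integral>\<omega>. exp (- l * X (real K * h) \<omega>) * indicator {\<omega>. \<forall>k\<le>K. - x < X (real k * h) \<omega>} \<omega> \<partial>M) * exp (psi l * h)"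
    using indep_var_lebesgue_integral[OF ind a] b unfolding eq by (simp add: has_bochner_integral_iff)
  moreover have "integrable M (\<lambda>\<omega>. exp (- l * X (real (Suc K) * h) \<omega>) * indicator {\<omega>. \<forall>k\<le>K. - x < X (real k * h) \<omega>} \<omega>)
    \<longleftrightarrow> integrable M (\<lambda>\<omega>. exp (- l * X (real (Suc K) * h) \<omega>) * indicator (above h x K) \<omega>)"
    by (intro Bochner_Integration.integrable_cong) (simp_all add: ind_eq)
  ultimately show "integrable M (\<lambda>\<omega>. exp (- l * X (real (Suc K) * h) \<omega>) * indicator (above h x K) \<omega>)"
    and "(\<integral>\<omega>. exp (- l * X (real (Suc K) * h) \<omega>) * indicator (above h x K) \<omega> \<partial>M) =
      exp (psi l * h) * (\<integral>\<omega>. exp (- l * X (real K * h) \<omega>) * indicator (above h x K) \<omega> \<partial>M)"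
    using ind_eq by (simp_all cong: Bochner_Integration.integral_cong add: mult.commute del: of_nat_Suc)
qed

lemma integrable_above:
  assumes "0 \<le> h" "0 \<le> l"
  shows "integrable M (\<lambda>\<omega>. exp (- l * X (real K * h) \<omega>) * indicator (above h x J) \<omega>)"
  using laplace_X[of l "real K * h"] sets_above[of h x J] assms
  by (auto intro!: integrable_real_mult_indicator simp: has_bochner_integral_iff)

lemma above_Suc_subset: "above h x (Suc K) \<subseteq> above h x K"
  by (auto simp: above_def)

lemma above_0: "0 < x \<Longrightarrow> above h x 0 = space M"
  by (auto simp: above_def X_zero)

text \<open>\<open>D K\<close> is the event that the first grid time at or below \<open>- x\<close>
  is step \<open>Suc K\<close>. The identity is one step of optional stopping for the martingale
  \<open>exp (- l * X t - psi l * t)\<close>.\<close>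

lemma integral_first_passage:
  fixes h l x :: real
  assumes "0 \<le> h" "0 \<le> l"
  defines "D \<equiv> \<lambda>K. above h x K - above h x (Suc K)"
  defines "a \<equiv> \<lambda>K. \<integral>\<omega>. exp (- l * X (real K * h) \<omega>) * indicator (above h x K) \<omega> \<partial>M"
  shows "integrable M (\<lambda>\<omega>. exp (- l * X (real (Suc K) * h) \<omega>) * indicator (D K) \<omega>)"
    and "a (Suc K) + (\<integral>\<omega>. exp (- l * X (real (Suc K) * h) \<omega>) * indicator (D K) \<omega> \<partial>M) = exp (psi l * h) * a K"
proof -
  have eq: "exp (- l * X (real (Suc K) * h) \<omega>) * indicator (D K) \<omega> =
      exp (- l * X (real (Suc K) * h) \<omega>) * indicator (above h x K) \<omega>
      - exp (- l * X (real (Suc K) * h) \<omega>) * indicator (above h x (Suc K)) \<omega>" for \<omega>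
    using above_Suc_subset[of h x K] by (auto simp: D_def indicator_def)
  show "integrable M (\<lambda>\<omega>. exp (- l * X (real (Suc K) * h) \<omega>) * indicator (D K) \<omega>)"
    unfolding eq by (intro Bochner_Integration.integrable_diff integrable_above assms)
  show "a (Suc K) + (\<integral>\<omega>. exp (- l * X (real (Suc K) * h) \<omega>) * indicator (D K) \<omega> \<partial>M) = exp (psi l * h) * a K"
    unfolding eq a_def
    by (subst Bochner_Integration.integral_diff)
      (use integrable_above[OF assms(1,2)] integral_above_step(2)[OF assms(1,2)] in \<open>simp_all del: of_nat_Suc\<close>)
qed

lemma prob_above_Suc:
  "0 \<le> h \<Longrightarrow> prob (above h x K - above h x (Suc K)) = prob (above h x K) - prob (above h x (Suc K))"
  by (intro finite_measure_Diff sets_above above_Suc_subset)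

text \<open>For \<open>psi l \<le> 0\<close> the process \<open>exp (- l * X)\<close> is a
  supermartingale starting at 1, and at the first grid passage its value is at least
  \<open>exp (l * x)\<close>.\<close>

lemma first_passage_upper:
  assumes "0 \<le> h" "0 \<le> l" "psi l \<le> 0" "0 < x"
  shows "(\<integral>\<omega>. exp (- l * X (real K * h) \<omega>) * indicator (above h x K) \<omega> \<partial>M)
    + exp (l * x) * (1 - prob (above h x K)) \<le> 1"
proof (induction K)
  case 0
  show ?case by (simp add: above_0[OF assms(4)] X_zero prob_space)
next
  case (Suc K)
  let ?D = "above h x K - above h x (Suc K)"
  let ?a = "\<lambda>K. \<integral>\<omega>. exp (- l * X (real K * h) \<omega>) * indicator (above h x K) \<omega> \<partial>M"
  have [measurable]: "?D \<in> events" using sets_above[OF assms(1)] by auto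
  have iD: "integrable M (indicator ?D :: 'a \<Rightarrow> real)"
    by (intro integrable_real_indicator) (auto simp: emeasure_eq_measure)
  have "(\<integral>\<omega>. exp (l * x) * indicator ?D \<omega> \<partial>M) \<le> (\<integral>\<omega>. exp (- l * X (real (Suc K) * h) \<omega>) * indicator ?D \<omega> \<partial>M)"
  proof (rule integral_mono)
    show "integrable M (\<lambda>\<omega>. exp (- l * X (real (Suc K) * h) \<omega>) * indicator ?D \<omega>)"
      by (rule integral_first_passage(1)[OF assms(1,2)])
    fix \<omega> assume \<omega>: "\<omega> \<in> space M"
    show "exp (l * x) * indicator ?D \<omega> \<le> exp (- l * X (real (Suc K) * h) \<omega>) * indicator ?D \<omega>"
    proof (cases "\<omega> \<in> ?D")
      case True
      then have "X (real (Suc K) * h) \<omega> \<le> - x"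
        by (auto simp: above_def le_Suc_eq not_less simp del: of_nat_Suc)
      then have "l * x \<le> - l * X (real (Suc K) * h) \<omega>" using mult_left_mono[of _ _ l] assms(2) by fastforce
      then show ?thesis using True by simp
    qed simp
  qed (use iD in simp)
  then have "exp (l * x) * (prob (above h x K) - prob (above h x (Suc K))) \<le> exp (psi l * h) * ?a K - ?a (Suc K)"
    using integral_first_passage(2)[OF assms(1,2), where x=x and K=K] prob_above_Suc[OF assms(1), where x=x and K=K] by simp
  moreover have "exp (psi l * h) * ?a K \<le> 1 * ?a K"
    using assms by (intro mult_right_mono Bochner_Integration.integral_nonneg) (auto simp: mult_nonpos_nonneg)
  ultimately show ?case using Suc by (simp add: algebra_simps del: of_nat_Suc)
qed

text \<open>
  The last term is the contribution of the grid steps that overshoot the level \<open>- x\<close> by more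
  than \<open>e\<close>. With \<open>h = 4 ^ - n\<close> and \<open>m = 2 ^ n\<close> the quantity \<open>psi m * h\<close> stays bounded, so that
  this term vanishes as \<open>n\<close> grows, although the number of steps is of order \<open>4 ^ n\<close>.
\<close>

lemma first_passage_lower:
  assumes "0 \<le> h" "0 \<le> l" "0 \<le> psi l" "0 < x" "l \<le> m" "0 < e"
  shows "1 \<le> exp (- psi l * h * real K) * (\<integral>\<omega>. exp (- l * X (real K * h) \<omega>) * indicator (above h x K) \<omega> \<partial>M)
    + exp (l * (x + e)) * (1 - prob (above h x K)) + real K * exp (l * x - (m - l) * e + psi m * h)"
proof (induction K)
  case 0
  show ?case by (simp add: above_0[OF assms(4)] X_zero prob_space)
next
  case (Suc K)
  let ?D = "above h x K - above h x (Suc K)"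
  let ?a = "\<lambda>K. \<integral>\<omega>. exp (- l * X (real K * h) \<omega>) * indicator (above h x K) \<omega> \<partial>M"
  let ?r = "exp (l * x - (m - l) * e)"
  let ?d = "\<integral>\<omega>. exp (- l * X (real (Suc K) * h) \<omega>) * indicator ?D \<omega> \<partial>M"
  let ?i = "\<lambda>\<omega>. exp (- m * (X (real (Suc K) * h) \<omega> - X (real K * h) \<omega>))"
  have [measurable]: "?D \<in> events" using sets_above[OF assms(1)] by auto
  have iD: "integrable M (indicator ?D :: 'a \<Rightarrow> real)"
    by (intro integrable_real_indicator) (auto simp: emeasure_eq_measure)
  have b: "has_bochner_integral M ?i (exp (psi m * h))"
    using laplace_increment[of m "real K * h" h] assms by (simp add: Suc_mult del: of_nat_Suc)
  have "?d \<le> (\<integral>\<omega>. exp (l * (x + e)) * indicator ?D \<omega> + ?r * ?i \<omega> \<partial>M)"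
  proof (rule integral_mono)
    show "integrable M (\<lambda>\<omega>. exp (- l * X (real (Suc K) * h) \<omega>) * indicator ?D \<omega>)"
      by (rule integral_first_passage(1)[OF assms(1,2)])
    show "integrable M (\<lambda>\<omega>. exp (l * (x + e)) * indicator ?D \<omega> + ?r * ?i \<omega>)"
      using b iD by (auto simp: has_bochner_integral_iff)
    fix \<omega> assume \<omega>: "\<omega> \<in> space M"
    show "exp (- l * X (real (Suc K) * h) \<omega>) * indicator ?D \<omega> \<le> exp (l * (x + e)) * indicator ?D \<omega> + ?r * ?i \<omega>"
    proof (cases "\<omega> \<in> ?D")
      case True
      then have "- x < X (real K * h) \<omega>" by (auto simp: above_def)
      from exp_overshoot_le[OF assms(2,5) this assms(6)] True show ?thesis by (simp del: of_nat_Suc)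
    qed simp
  qed
  also have "\<dots> = exp (l * (x + e)) * (prob (above h x K) - prob (above h x (Suc K))) + ?r * exp (psi m * h)"
    using b iD prob_above_Suc[OF assms(1), where x=x and K=K]
    by (subst Bochner_Integration.integral_add) (auto simp: has_bochner_integral_iff)
  finally have d: "?d \<le> exp (l * (x + e)) * (prob (above h x K) - prob (above h x (Suc K))) + exp (l * x - (m - l) * e + psi m * h)"
    by (simp add: exp_add)
  have "exp (- psi l * h * real (Suc K)) * (?a (Suc K) + ?d) = exp (- psi l * h * real K) * ?a K"
  proof -
    have "exp (- psi l * h * real (Suc K)) * exp (psi l * h) = exp (- psi l * h * real K)"
      by (simp add: exp_add[symmetric] algebra_simps)
    then show ?thesis
      unfolding integral_first_passage(2)[OF assms(1,2)] by (simp only: mult.assoc[symmetric])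
  qed
  \<comment> \<open>As \<open>psi l \<ge> 0\<close>, the discount factor is at most 1, so the
    passage term only grows when the factor is dropped.\<close>
  moreover have "exp (- psi l * h * real (Suc K)) * ?d \<le> 1 * ?d"
    using assms by (intro mult_right_mono Bochner_Integration.integral_nonneg) auto
  ultimately have "exp (- psi l * h * real K) * ?a K \<le> exp (- psi l * h * real (Suc K)) * ?a (Suc K) + ?d"
    by (simp add: distrib_left del: of_nat_Suc)
  then show ?case using Suc d by (simp add: algebra_simps)
qed

lemma prob_reach_le:
  assumes "0 < l" "l < Phi" "0 < x"
  shows "prob (reach x) \<le> exp (- l * x)"
proof -
  \<comment> \<open>The window \<open>[0, 2 ^ n]\<close> grows while the mesh \<open>2 ^ - n\<close>
    shrinks, so the events increase to \<open>reach x\<close>.\<close>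
  define F where "F n = space M - above (1 / 2 ^ n) x (4 ^ n)" for n
  have F: "F n = {\<omega>\<in>space M. \<exists>k\<le>4 ^ n. X (real k / 2 ^ n) \<omega> \<le> - x}" for n
    by (auto simp: F_def above_def not_less)
  have inc: "incseq F"
  proof (rule incseq_SucI, unfold F, safe)
    fix n \<omega> k assume "\<omega> \<in> space M" and k: "(k::nat) \<le> 4 ^ n" "X (real k / 2 ^ n) \<omega> \<le> - x"
    show "\<exists>k\<le>4 ^ Suc n. X (real k / 2 ^ Suc n) \<omega> \<le> - x"
      using k by (intro exI[of _ "2 * k"]) auto
  qed
  have "reach x = (\<Union>n. F n)"
  proof (unfold F reach_def, safe)
    fix \<omega> n k assume w: "\<omega> \<in> space M" and k: "X (real k / 2 ^ n) \<omega> \<le> - x"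
    \<comment> \<open>Refining the grid by \<open>k\<close> further levels multiplies the index by
      \<open>2 ^ k\<close>, and the refined index still fits under the bound
      \<open>4 ^ (n + k)\<close>.\<close>
    have "k * 2 ^ k \<le> 2 ^ k * (2 ^ k :: nat)" by (intro mult_right_mono) auto
    also have "\<dots> = 4 ^ k" by (simp add: power_mult_distrib[symmetric])
    also have "\<dots> \<le> 4 ^ (n + k)" by (intro power_increasing) auto
    finally have le: "k * 2 ^ k \<le> 4 ^ (n + k)" .
    have "real (k * 2 ^ k) / 2 ^ (n + k) = real k / 2 ^ n" by (simp add: power_add)
    with le k w show "\<omega> \<in> (\<Union>n. {\<omega>\<in>space M. \<exists>k\<le>4 ^ n. X (real k / 2 ^ n) \<omega> \<le> - x})"
      by (intro UN_I[of "n + k"]) (auto intro!: exI[of _ "k * 2 ^ k"])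
  qed auto
  moreover have "(\<lambda>n. prob (F n)) \<longlonglongrightarrow> prob (\<Union>n. F n)"
    by (rule finite_Lim_measure_incseq[OF _ inc]) (auto simp: F_def sets_above)
  moreover have "prob (F n) \<le> exp (- l * x)" for n
  proof -
    have "psi l \<le> 0" using psi_neg[of l] assms by simp
    then have u: "(\<integral>\<omega>. exp (- l * X (real (4^n) * (1 / 2 ^ n)) \<omega>) * indicator (above (1 / 2 ^ n) x (4^n)) \<omega> \<partial>M)
      + exp (l * x) * (1 - prob (above (1 / 2 ^ n) x (4^n))) \<le> 1" using assms by (intro first_passage_upper) auto
    have v: "0 \<le> (\<integral>\<omega>. exp (- l * X (real (4^n) * (1 / 2 ^ n)) \<omega>) * indicator (above (1 / 2 ^ n) x (4^n)) \<omega> \<partial>M)"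
      by (intro Bochner_Integration.integral_nonneg) auto
    have w: "prob (F n) = 1 - prob (above (1 / 2 ^ n) x (4^n))" by (simp add: F_def prob_compl sets_above)
    have "exp (l * x) * prob (F n) \<le> 1" unfolding w using u v by linarith
    then show ?thesis by (simp add: exp_minus field_simps)
  qed
  ultimately show ?thesis by (auto intro: LIMSEQ_le_const2)
qed

text \<open>Three limits in turn: refining the grid removes the large overshoots, a horizon
  \<open>T\<close> tending to infinity removes the surviving mass through the discount
  \<open>exp (- psi l * T)\<close>, and \<open>e\<close> tending to 0 removes the small
  overshoots.\<close>

lemma prob_reach_ge:
  assumes "0 < l" "0 < psi l" "0 < x"
  shows "exp (- l * x) \<le> prob (reach x)"
proof -
  have main: "1 \<le> exp (- psi l * real T) * exp (l * x) + exp (l * (x + e)) * prob (reach x)"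
    if e: "0 < e" for T :: nat and e :: real
  proof (rule LIMSEQ_le_const)
    have "(\<lambda>m. 4 ^ m * exp (- (2 ^ m * e))) \<longlonglongrightarrow> 0" using e by real_asymp
    from tendsto_mult[OF tendsto_const this, of "real T * exp (l * x + l * e + C)"]
    have "(\<lambda>m. real (T * 4 ^ m) * exp (l * x - (2 ^ m - l) * e + C)) \<longlonglongrightarrow> 0"
      by (simp add: exp_add exp_diff exp_minus field_simps)
    then show "(\<lambda>m. exp (- psi l * real T) * exp (l * x) + exp (l * (x + e)) * prob (reach x) +
        real (T * 4 ^ m) * exp (l * x - (2 ^ m - l) * e + C))
        \<longlonglongrightarrow> exp (- psi l * real T) * exp (l * x) + exp (l * (x + e)) * prob (reach x)"
      using tendsto_add[OF tendsto_const] by fastforce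
    have "\<forall>\<^sub>F m in sequentially. l \<le> 2 ^ m" by real_asymp
    then obtain m0 where m0: "\<And>m. m \<ge> m0 \<Longrightarrow> l \<le> 2 ^ m" by (auto simp: eventually_sequentially)
    show "\<exists>N. \<forall>m\<ge>N. 1 \<le> exp (- psi l * real T) * exp (l * x) + exp (l * (x + e)) * prob (reach x) +
        real (T * 4 ^ m) * exp (l * x - (2 ^ m - l) * e + C)"
    proof (intro exI allI impI)
      fix m assume "m \<ge> m0"
      \<comment> \<open>\<open>T * 4 ^ m\<close> steps of length \<open>4 ^ - m\<close> reach the
        horizon \<open>T\<close>; with \<open>2 ^ m\<close> as the large frequency,
        \<open>psi (2 ^ m) * ?h\<close> is at most \<open>C\<close>.\<close>
      let ?h = "1 / 4 ^ m :: real" and ?K = "T * 4 ^ m"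
      have "1 \<le> exp (- psi l * ?h * real ?K) * (\<integral>\<omega>. exp (- l * X (real ?K * ?h) \<omega>) * indicator (above ?h x ?K) \<omega> \<partial>M)
         + exp (l * (x + e)) * (1 - prob (above ?h x ?K)) + real ?K * exp (l * x - (2 ^ m - l) * e + psi (2 ^ m) * ?h)"
        using assms e m0[OF \<open>m \<ge> m0\<close>] by (intro first_passage_lower) auto
      also have "\<dots> \<le> exp (- psi l * real T) * exp (l * x) + exp (l * (x + e)) * prob (reach x) +
        real ?K * exp (l * x - (2 ^ m - l) * e + C)"
      proof (intro add_mono mult_mono order_refl)
        have "(\<integral>\<omega>. exp (- l * X (real ?K * ?h) \<omega>) * indicator (above ?h x ?K) \<omega> \<partial>M) \<le> (\<integral>\<omega>. exp (l * x) \<partial>M)"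
        proof (rule integral_mono[OF integrable_above])
          fix \<omega> assume "\<omega> \<in> space M"
          show "exp (- l * X (real ?K * ?h) \<omega>) * indicator (above ?h x ?K) \<omega> \<le> exp (l * x)"
          proof (cases "\<omega> \<in> above ?h x ?K")
            case True
            then have "- x < X (real ?K * ?h) \<omega>" by (auto simp: above_def)
            then have "- l * X (real ?K * ?h) \<omega> \<le> l * x"
              using assms(1) mult_left_mono[of "- X (real ?K * ?h) \<omega>" x l] by simp
            with True show ?thesis by simp
          qed simp
        qed (use assms in auto)
        then show "(\<integral>\<omega>. exp (- l * X (real ?K * ?h) \<omega>) * indicator (above ?h x ?K) \<omega> \<partial>M) \<le> exp (l * x)"
          by (simp add: prob_space)
        have "1 - prob (above ?h x ?K) = prob (space M - above ?h x ?K)" by (simp add: prob_compl sets_above)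
        also have "\<dots> \<le> prob (reach x)"
        proof (rule finite_measure_mono[OF _ sets_reach], safe)
          fix \<omega> assume "\<omega> \<in> space M" "\<omega> \<notin> above ?h x ?K"
          then obtain k where "X (real k * ?h) \<omega> \<le> - x" by (auto simp: above_def not_less)
          then have "X (real k / 2 ^ (2 * m)) \<omega> \<le> - x" by (simp add: power_mult)
          then show "\<omega> \<in> reach x" using \<open>\<omega> \<in> space M\<close> unfolding reach_def by blast
        qed
        finally show "1 - prob (above ?h x ?K) \<le> prob (reach x)" .
        have "psi (2 ^ m) \<le> C * (2 ^ m)\<^sup>2" by (rule psi_quadratic) simp
        also have "(2 ^ m)\<^sup>2 = (4 ^ m :: real)" by (simp add: power2_eq_square power_mult_distrib[symmetric])
        finally show "exp (l * x - (2 ^ m - l) * e + psi (2 ^ m) * ?h) \<le> exp (l * x - (2 ^ m - l) * e + C)"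
          by (simp add: field_simps)
      qed (auto intro!: Bochner_Integration.integral_nonneg)
      finally show "1 \<le> exp (- psi l * real T) * exp (l * x) + exp (l * (x + e)) * prob (reach x) +
        real ?K * exp (l * x - (2 ^ m - l) * e + C)" .
    qed
  qed
  have main2: "1 \<le> exp (l * (x + e)) * prob (reach x)" if e: "0 < e" for e
  proof (rule LIMSEQ_le_const)
    have "(\<lambda>T. exp (- psi l * real T)) \<longlonglongrightarrow> 0" using assms(2) by real_asymp
    then have "(\<lambda>T. exp (- psi l * real T) * exp (l * x) + exp (l * (x + e)) * prob (reach x)) \<longlonglongrightarrow> 0 * exp (l * x) + exp (l * (x + e)) * prob (reach x)"
      by (intro tendsto_add tendsto_mult tendsto_const)
    then show "(\<lambda>T. exp (- psi l * real T) * exp (l * x) + exp (l * (x + e)) * prob (reach x)) \<longlonglongrightarrow> exp (l * (x + e)) * prob (reach x)"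
      by simp
  qed (use main[OF e] in auto)
  have "1 \<le> exp (l * x) * prob (reach x)"
  proof (rule LIMSEQ_le_const)
    have "(\<lambda>n. exp (l * (x + 1 / real (Suc n)))) \<longlonglongrightarrow> exp (l * (x + 0))"
      by (intro tendsto_intros LIMSEQ_inverse_real_of_nat[unfolded inverse_eq_divide])
    from tendsto_mult_right[OF this, of "prob (reach x)"]
    show "(\<lambda>n. exp (l * (x + 1 / real (Suc n))) * prob (reach x)) \<longlonglongrightarrow> exp (l * x) * prob (reach x)"
      by simp
  qed (use main2 in auto)
  then show ?thesis by (simp add: exp_minus field_simps)
qed

text \<open>The upper bound is taken along \<open>l\<close> increasing to \<open>Phi\<close>, where
  \<open>psi < 0\<close>; the lower one along points with \<open>psi > 0\<close> that come
  arbitrarily close to \<open>Phi\<close> from above.\<close>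

lemma prob_reach:
  assumes "0 < x"
  shows "prob (reach x) = exp (- Phi * x)"
proof (rule antisym)
  show "prob (reach x) \<le> exp (- Phi * x)"
  proof (rule tendsto_lowerbound)
    have "((\<lambda>l. exp (- l * x)) \<longlongrightarrow> exp (- Phi * x)) (at Phi)" by (intro tendsto_intros)
    then show "((\<lambda>l. exp (- l * x)) \<longlongrightarrow> exp (- Phi * x)) (at_left Phi)" by (rule tendsto_within_subset) simp
    show "\<forall>\<^sub>F l in at_left Phi. prob (reach x) \<le> exp (- l * x)"
      using prob_reach_le Phi_pos assms by (auto simp: eventually_at_left[OF Phi_pos])
  qed simp
  show "exp (- Phi * x) \<le> prob (reach x)"
  proof (rule LIMSEQ_le_const2)
    show "(\<lambda>n. exp (- (Phi + 1 / real (Suc n)) * x)) \<longlonglongrightarrow> exp (- Phi * x)"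
      by (rule tendsto_eq_intros LIMSEQ_inverse_real_of_nat[unfolded inverse_eq_divide] refl)+ simp
    show "\<exists>N. \<forall>n\<ge>N. exp (- (Phi + 1 / real (Suc n)) * x) \<le> prob (reach x)"
    proof (intro exI allI impI)
      fix n
      obtain l where l: "Phi \<le> l" "l < Phi + 1 / real (Suc n)" "0 < psi l"
        using psi_pos_near[of "1 / real (Suc n)"] by auto
      have "- (Phi + 1 / real (Suc n)) * x \<le> - l * x"
        using l(2) assms by (intro mult_right_mono) auto
      then have "exp (- (Phi + 1 / real (Suc n)) * x) \<le> exp (- l * x)" by simp
      also have "\<dots> \<le> prob (reach x)" using l Phi_pos assms by (intro prob_reach_ge) auto
      finally show "exp (- (Phi + 1 / real (Suc n)) * x) \<le> prob (reach x)" .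
    qed
  qed
qed

lemma reach_antimono: "x \<le> y \<Longrightarrow> reach y \<subseteq> reach x"
  unfolding reach_def by (intro Collect_mono) (meson neg_le_iff_le order.trans)

text \<open>\<open>exp (- Phi * y)\<close> is continuous in \<open>y\<close>, so reaching every
  level above \<open>- x\<close> has the same probability as reaching \<open>- x\<close>. Almost
  surely, then, a path that avoids \<open>- x\<close> also avoids some higher level
  \<open>- y\<close>; this gap survives limits along dyadic times.\<close>

lemma AE_reach:
  assumes "0 < x"
  shows "AE \<omega> in M. (\<forall>y<x. \<omega> \<in> reach y) \<longrightarrow> \<omega> \<in> reach x"
proof -
  \<comment> \<open>The offset 2 keeps all levels positive, as \<open>prob_reach\<close>
    requires.\<close>
  define N where "N = (\<Inter>n. reach (x - x / real (n + 2)))"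
  have pos: "0 < x - x / real (n + 2)" for n using assms divide_strict_left_mono[of 1 "real (n + 2)" x] by simp
  have ev: "N \<in> events" unfolding N_def by (intro sets.countable_INT) (auto simp: sets_reach)
  have lim0: "(\<lambda>n. x / real (n + 2)) \<longlonglongrightarrow> 0" by real_asymp
  have sub: "reach x \<subseteq> N" unfolding N_def using assms by (intro INT_greatest reach_antimono) simp
  have "prob N \<le> exp (- Phi * x)"
  proof (rule LIMSEQ_le_const)
    have "(\<lambda>n. exp (- Phi * (x - x / real (n + 2)))) \<longlonglongrightarrow> exp (- Phi * (x - 0))"
      by (intro tendsto_intros lim0)
    then show "(\<lambda>n. exp (- Phi * (x - x / real (n + 2)))) \<longlonglongrightarrow> exp (- Phi * x)" by simp
    show "\<exists>N'. \<forall>n\<ge>N'. prob N \<le> exp (- Phi * (x - x / real (n + 2)))"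
      by (intro exI allI impI, subst prob_reach[OF pos, symmetric], intro finite_measure_mono sets_reach)
        (auto simp: N_def)
  qed
  then have "prob (N - reach x) \<le> 0"
    using finite_measure_Diff[OF ev sets_reach sub] prob_reach[OF assms] by simp
  then have "prob (N - reach x) = 0" by (simp add: measure_le_0_iff)
  then have "N - reach x \<in> null_sets M"
    using ev sets_reach by (auto simp: null_sets_def emeasure_eq_measure)
  then show ?thesis
    by (rule AE_I') (use assms in \<open>auto simp: N_def\<close>)
qed

end

section \<open>Moments of additive functionals\<close>

lemma measurable_indicator_atLeast [measurable (raw)]:
  fixes f g :: "'b \<Rightarrow> real"
  assumes "f \<in> borel_measurable N" "g \<in> borel_measurable N"
  shows "(\<lambda>x. indicator {f x..} (g x) :: ennreal) \<in> borel_measurable N"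
  using assms unfolding indicator_def atLeast_iff by measurable

text \<open>Normalised Hoelder inequality: \<open>exp (- x * Y - k x)\<close> has expectation 1,
  convexity of \<open>exp\<close> bounds the exponential of the mixture pointwise, and integration
  gives \<open>exp (k ?z - ?c) \<le> 1\<close>.\<close>

lemma (in prob_space) log_laplace_convex:
  fixes k :: "real \<Rightarrow> real"
  assumes "\<And>l. 0 \<le> l \<Longrightarrow> has_bochner_integral M (\<lambda>\<omega>. exp (- l * Y \<omega>)) (exp (k l))"
  shows "convex_on {0..} k"
proof (rule convex_onI)
  fix t x y :: real assume t: "0 < t" "t < 1" and x: "x \<in> {0..}" and y: "y \<in> {0..}"
  let ?z = "(1 - t) *\<^sub>R x + t *\<^sub>R y" and ?c = "(1 - t) * k x + t * k y"
  have z: "0 \<le> ?z" using t x y by simp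
  have x': "has_bochner_integral M (\<lambda>\<omega>. (1 - t) * exp (- k x) * exp (- x * Y \<omega>)) ((1 - t) * exp (- k x) * exp (k x))"
    using assms[of x] x by (intro has_bochner_integral_mult_right) auto
  have y': "has_bochner_integral M (\<lambda>\<omega>. t * exp (- k y) * exp (- y * Y \<omega>)) (t * exp (- k y) * exp (k y))"
    using assms[of y] y by (intro has_bochner_integral_mult_right) auto
  have z': "has_bochner_integral M (\<lambda>\<omega>. exp (- ?c) * exp (- ?z * Y \<omega>)) (exp (- ?c) * exp (k ?z))"
    by (intro has_bochner_integral_mult_right assms z)
  have "exp (- ?c) * exp (k ?z) \<le> (1 - t) * exp (- k x) * exp (k x) + t * exp (- k y) * exp (k y)"
    unfolding has_bochner_integral_integral_eq[OF z', symmetric]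
      has_bochner_integral_integral_eq[OF has_bochner_integral_add[OF x' y'], symmetric]
  proof (rule integral_mono)
    show "integrable M (\<lambda>\<omega>. exp (- ?c) * exp (- ?z * Y \<omega>))"
      using z' by (rule integrable.intros)
    show "integrable M (\<lambda>\<omega>. (1 - t) * exp (- k x) * exp (- x * Y \<omega>) + t * exp (- k y) * exp (- y * Y \<omega>))"
      using has_bochner_integral_add[OF x' y'] by (rule integrable.intros)
    fix \<omega>
    have "exp ((1 - t) *\<^sub>R (- k x - x * Y \<omega>) + t *\<^sub>R (- k y - y * Y \<omega>))
        \<le> (1 - t) * exp (- k x - x * Y \<omega>) + t * exp (- k y - y * Y \<omega>)"
      using t by (intro convex_onD[OF exp_convex]) auto
    then show "exp (- ?c) * exp (- ?z * Y \<omega>) \<le> (1 - t) * exp (- k x) * exp (- x * Y \<omega>) + t * exp (- k y) * exp (- y * Y \<omega>)"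
      by (simp add: exp_add[symmetric] exp_diff exp_minus field_simps)
  qed
  moreover have "(1 - t) * exp (- k x) * exp (k x) + t * exp (- k y) * exp (k y) = 1"
    by (simp add: mult.assoc exp_add[symmetric])
  ultimately have "exp (- ?c + k ?z) \<le> exp 0" by (simp only: exp_add exp_zero)
  then show "k ?z \<le> (1 - t) * k x + t * k y" by simp
qed simp

lemma nn_integral_exp_atLeast:
  fixes a s :: real
  assumes "0 < a"
  shows "(\<integral>\<^sup>+r. ennreal (exp (- a * (r - s))) * indicator {s..} r \<partial>lborel) = ennreal (1 / a)"
proof -
  have "((\<lambda>r. - exp (- a * (r - s)) / a) \<longlongrightarrow> 0) at_top" using assms by real_asymp
  moreover have "((\<lambda>r. - exp (- a * (r - s)) / a) has_real_derivative exp (- a * (r - s))) (at r)" for r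
    using assms by (auto intro!: derivative_eq_intros)
  ultimately show ?thesis
    by (subst nn_integral_FTC_atLeast[of _ _ "\<lambda>r. - exp (- a * (r - s)) / a" 0]) auto
qed

text \<open>The plane is covered by \<open>s \<le> r\<close> and \<open>r \<le> s\<close>; the
  diagonal is counted twice, which the inequality allows. In each half the later value can be
  expressed through an increment.\<close>

lemma nn_integral_mult_le_ordered:
  fixes f g :: "real \<Rightarrow> ennreal"
  assumes [measurable]: "f \<in> borel_measurable lborel" "g \<in> borel_measurable lborel"
  shows "(\<integral>\<^sup>+s. f s \<partial>lborel) * (\<integral>\<^sup>+r. g r \<partial>lborel) \<le>
    (\<integral>\<^sup>+s. \<integral>\<^sup>+r. f s * g r * indicator {s..} r \<partial>lborel \<partial>lborel) +
    (\<integral>\<^sup>+s. \<integral>\<^sup>+r. g s * f r * indicator {s..} r \<partial>lborel \<partial>lborel)"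
proof -
  have "(\<integral>\<^sup>+s. f s \<partial>lborel) * (\<integral>\<^sup>+r. g r \<partial>lborel) = (\<integral>\<^sup>+s. \<integral>\<^sup>+r. f s * g r \<partial>lborel \<partial>lborel)"
    by (simp add: nn_integral_cmult nn_integral_multc)
  also have "\<dots> \<le> (\<integral>\<^sup>+s. \<integral>\<^sup>+r. f s * g r * indicator {s..} r + g r * f s * indicator {r..} s \<partial>lborel \<partial>lborel)"
    by (intro nn_integral_mono) (auto simp: indicator_def mult.commute)
  also have "\<dots> = (\<integral>\<^sup>+s. \<integral>\<^sup>+r. f s * g r * indicator {s..} r \<partial>lborel \<partial>lborel) +
      (\<integral>\<^sup>+s. \<integral>\<^sup>+r. g r * f s * indicator {r..} s \<partial>lborel \<partial>lborel)"
    by (subst nn_integral_add[symmetric]) (measurable, intro nn_integral_cong nn_integral_add, measurable)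
  also have "(\<integral>\<^sup>+s. \<integral>\<^sup>+r. g r * f s * indicator {r..} s \<partial>lborel \<partial>lborel) =
      (\<integral>\<^sup>+r. \<integral>\<^sup>+s. g r * f s * indicator {r..} s \<partial>lborel \<partial>lborel)"
    by (rule lborel_pair.Fubini') measurable
  finally show ?thesis .
qed

text \<open>Paley-Zygmund, from the pointwise inequality \<open>A \<le> v / 2 + A\<^sup>2 / (16 v) + 4 v 1{A > v / 2}\<close>.\<close>

lemma (in prob_space) second_moment_bound:
  fixes A :: "'a \<Rightarrow> ennreal" and v :: real
  assumes [measurable]: "A \<in> borel_measurable M"
    and v: "0 < v" and first: "(\<integral>\<^sup>+\<omega>. A \<omega> \<partial>M) = ennreal v"
    and second: "(\<integral>\<^sup>+\<omega>. A \<omega> * A \<omega> \<partial>M) \<le> ennreal (4 * v\<^sup>2)"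
  shows "1 / 16 \<le> prob {\<omega>\<in>space M. ennreal (v / 2) < A \<omega>}"
proof -
  let ?S = "{\<omega>\<in>space M. ennreal (v / 2) < A \<omega>}"
  have pt: "A \<omega> \<le> ennreal (v / 2) + ennreal (1 / (16 * v)) * (A \<omega> * A \<omega>) + ennreal (4 * v) * indicator ?S \<omega>"
    if "\<omega> \<in> space M" for \<omega>
  proof (cases "A \<omega>")
    case top
    then show ?thesis using v by (simp add: ennreal_mult_top)
  next
    case (real r)
    show ?thesis
    proof (cases "\<omega> \<in> ?S")
      case True
      \<comment> \<open>Division by \<open>16 * v\<close> gives
        \<open>r \<le> r\<^sup>2 / (16 * v) + 4 * v\<close>. With second moment at most
        \<open>4 * v\<^sup>2\<close> the quadratic term contributes at most \<open>v / 4\<close>, so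
        that \<open>v / 4\<close> is left for the event \<open>?S\<close>, whence 1/16.\<close>
      have "0 \<le> (r - 8 * v)\<^sup>2" by simp
      then have "r \<le> 1 / (16 * v) * (r * r) + 4 * v"
        using v by (simp add: field_simps power2_eq_square)
      then have "ennreal r \<le> ennreal (v / 2 + 1 / (16 * v) * (r * r) + 4 * v)"
        using v by (intro ennreal_leI) simp
      also have "\<dots> = ennreal (v / 2 + 1 / (16 * v) * (r * r)) + ennreal (4 * v)"
        using v real by (intro ennreal_plus) auto
      also have "ennreal (v / 2 + 1 / (16 * v) * (r * r)) = ennreal (v / 2) + ennreal (1 / (16 * v) * (r * r))"
        using v real by (intro ennreal_plus) auto
      also have "ennreal (1 / (16 * v) * (r * r)) = ennreal (1 / (16 * v)) * ennreal (r * r)"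
        using v real by (intro ennreal_mult) auto
      also have "ennreal (r * r) = ennreal r * ennreal r"
        using real by (intro ennreal_mult) auto
      finally show ?thesis using True real by simp
    next
      case False
      then have "A \<omega> \<le> ennreal (v / 2)" using that by auto
      then show ?thesis by (simp add: add_increasing2)
    qed
  qed
  have "ennreal v \<le> (\<integral>\<^sup>+\<omega>. ennreal (v / 2) + ennreal (1 / (16 * v)) * (A \<omega> * A \<omega>) + ennreal (4 * v) * indicator ?S \<omega> \<partial>M)"
    unfolding first[symmetric] by (intro nn_integral_mono pt)
  also have "\<dots> = ennreal (v / 2) + ennreal (1 / (16 * v)) * (\<integral>\<^sup>+\<omega>. A \<omega> * A \<omega> \<partial>M) + ennreal (4 * v) * emeasure M ?S"
    by (simp add: nn_integral_add nn_integral_cmult emeasure_space_1)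
  also have "\<dots> \<le> ennreal (v / 2) + ennreal (1 / (16 * v)) * ennreal (4 * v\<^sup>2) + ennreal (4 * v) * ennreal (prob ?S)"
    by (intro add_mono mult_left_mono second) (auto simp: emeasure_eq_measure)
  also have "ennreal (1 / (16 * v)) * ennreal (4 * v\<^sup>2) = ennreal (v / 4)"
    using v by (subst ennreal_mult[symmetric]) (auto simp: power2_eq_square)
  also have "ennreal (v / 2) + ennreal (v / 4) + ennreal (4 * v) * ennreal (prob ?S) = ennreal (v / 2 + v / 4 + 4 * v * prob ?S)"
    using v by (subst ennreal_mult[symmetric], simp, simp, subst ennreal_plus[symmetric], simp, simp,
        subst ennreal_plus[symmetric]) auto
  finally have "v \<le> v / 2 + v / 4 + 4 * v * prob ?S"
    using v by (subst (asm) ennreal_le_iff) auto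
  then have "v * (1 / 16) \<le> v * prob ?S" using v by (simp add: power2_eq_square field_simps)
  then show ?thesis using v by (simp only: mult_le_cancel_left_pos)
qed

text \<open>For the finite measures on \<open>(0, d)\<close> used later the value is finite for
  negative \<open>z\<close> too, which lets the functional run along the whole path.\<close>

definition lap :: "real measure \<Rightarrow> real \<Rightarrow> ennreal" where
  "lap \<nu> z = (\<integral>\<^sup>+l. ennreal (exp (- l * z)) \<partial>\<nu>)"

section \<open>Mixed moments of exponential functionals\<close>

context regular_levy
begin

lemma psi_convex: "convex_on {0..} psi"
  using log_laplace_convex[of "X 1" psi] laplace_X[of _ 1] by simp

text \<open>\<open>l + m\<close> is the midpoint of \<open>l\<close> and \<open>l + 2 * m\<close>,
  and the latter is still below \<open>Phi\<close>, where \<open>psi\<close> is negative. This is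
  the origin of the bound \<open>Phi / 3\<close>.\<close>

lemma psi_add_le:
  assumes "0 < l" "0 < m" "l < Phi / 3" "m < Phi / 3"
  shows "psi (l + m) \<le> psi l / 2"
proof -
  have "psi ((1 - 1/2) *\<^sub>R l + (1/2) *\<^sub>R (l + 2 * m)) \<le> (1 - 1/2) * psi l + (1/2) * psi (l + 2 * m)"
    using assms by (intro convex_onD[OF psi_convex]) auto
  moreover have "psi (l + 2 * m) < 0" using assms by (intro psi_neg) auto
  moreover have "(1 - 1/2) *\<^sub>R l + (1/2) *\<^sub>R (l + 2 * m) = l + m" by (simp add: field_simps)
  ultimately show ?thesis by simp
qed

lemma measurable_X_comp [measurable (raw)]:
  assumes f: "f \<in> borel_measurable N" and g: "g \<in> N \<rightarrow>\<^sub>M M"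
  shows "(\<lambda>x. X (max 0 (f x)) (g x)) \<in> borel_measurable N"
proof -
  have "(\<lambda>(s, \<omega>). X (max 0 s) \<omega>) \<in> borel_measurable (lborel \<Otimes>\<^sub>M M)"
    by (intro measurable_right_continuous_process right_continuous measurable_X) auto
  moreover have "(\<lambda>x. (f x, g x)) \<in> N \<rightarrow>\<^sub>M lborel \<Otimes>\<^sub>M M"
    using f g by (intro measurable_Pair) auto
  ultimately show ?thesis using measurable_compose by fastforce
qed

text \<open>Nothing is known about \<open>X s\<close> for negative \<open>s\<close>, not even measurability, hence \<open>max 0 s\<close>.\<close>

definition pot :: "(real \<Rightarrow> ennreal) \<Rightarrow> 'a \<Rightarrow> ennreal" where
  "pot \<phi> \<omega> = (\<integral>\<^sup>+s. \<phi> (X (max 0 s) \<omega>) * indicator {0..} s \<partial>lborel)"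

lemma measurable_pot [measurable]:
  assumes [measurable]: "\<phi> \<in> borel_measurable borel"
  shows "pot \<phi> \<in> borel_measurable M"
  unfolding pot_def by measurable

lemma expectation_pot_exp:
  assumes "0 < l" "l < Phi"
  shows "(\<integral>\<^sup>+\<omega>. pot (\<lambda>z. ennreal (exp (- l * z))) \<omega> \<partial>M) = ennreal (1 / - psi l)"
proof -
  interpret P: pair_sigma_finite lborel M ..
  have "(\<integral>\<^sup>+\<omega>. pot (\<lambda>z. ennreal (exp (- l * z))) \<omega> \<partial>M) =
      (\<integral>\<^sup>+s. \<integral>\<^sup>+\<omega>. ennreal (exp (- l * X (max 0 s) \<omega>)) * indicator {0..} s \<partial>M \<partial>lborel)"
    unfolding pot_def by (rule P.Fubini') measurable
  also have "\<dots> = (\<integral>\<^sup>+s. ennreal (exp (- (- psi l) * (s - 0))) * indicator {0..} s \<partial>lborel)"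
  proof (rule nn_integral_cong)
    fix s :: real
    show "(\<integral>\<^sup>+\<omega>. ennreal (exp (- l * X (max 0 s) \<omega>)) * indicator {0..} s \<partial>M) =
        ennreal (exp (- (- psi l) * (s - 0))) * indicator {0..} s"
      using nn_laplace_X[of l s] assms by (auto simp: indicator_def max_def)
  qed
  also have "\<dots> = ennreal (1 / - psi l)"
    using psi_neg[OF assms] by (intro nn_integral_exp_atLeast) simp
  finally show ?thesis .
qed

text \<open>The earlier time carries frequency \<open>l + m\<close> and the lag \<open>r - s\<close>
  carries \<open>m\<close> alone, so the integrals over the earlier time and over the lag
  separate.\<close>

lemma expectation_ordered_pot:
  assumes "0 < l" "0 < m" "l + m < Phi"
  shows "(\<integral>\<^sup>+\<omega>. \<integral>\<^sup>+s. \<integral>\<^sup>+r. ennreal (exp (- l * X (max 0 s) \<omega>)) * indicator {0..} s *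
      (ennreal (exp (- m * X (max 0 r) \<omega>)) * indicator {0..} r) * indicator {s..} r \<partial>lborel \<partial>lborel \<partial>M)
    = ennreal (1 / - psi (l + m)) * ennreal (1 / - psi m)"
proof -
  interpret P: pair_sigma_finite lborel M ..
  let ?F = "\<lambda>s r \<omega>. ennreal (exp (- l * X (max 0 s) \<omega>)) * indicator {0..} s *
      (ennreal (exp (- m * X (max 0 r) \<omega>)) * indicator {0..} r) * indicator {s..} r"
  have neg: "psi (l + m) < 0" "psi m < 0" using psi_neg assms by auto
  have "(\<integral>\<^sup>+\<omega>. \<integral>\<^sup>+s. \<integral>\<^sup>+r. ?F s r \<omega> \<partial>lborel \<partial>lborel \<partial>M) = (\<integral>\<^sup>+s. \<integral>\<^sup>+\<omega>. \<integral>\<^sup>+r. ?F s r \<omega> \<partial>lborel \<partial>M \<partial>lborel)"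
    by (rule P.Fubini') measurable
  also have "\<dots> = (\<integral>\<^sup>+s. \<integral>\<^sup>+r. \<integral>\<^sup>+\<omega>. ?F s r \<omega> \<partial>M \<partial>lborel \<partial>lborel)"
    by (intro nn_integral_cong P.Fubini') measurable
  also have "\<dots> = (\<integral>\<^sup>+s. \<integral>\<^sup>+r. (ennreal (exp (psi (l + m) * s)) * indicator {0..} s) *
      (ennreal (exp (- (- psi m) * (r - s))) * indicator {s..} r) \<partial>lborel \<partial>lborel)"
  proof (intro nn_integral_cong)
    fix s r :: real
    show "(\<integral>\<^sup>+\<omega>. ?F s r \<omega> \<partial>M) = (ennreal (exp (psi (l + m) * s)) * indicator {0..} s) *
      (ennreal (exp (- (- psi m) * (r - s))) * indicator {s..} r)"
    proof (cases "0 \<le> s \<and> s \<le> r")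
      case True
      then show ?thesis using laplace_two_times[of l m s r] assms by (simp add: max_def)
    next
      case False
      then show ?thesis by (auto simp: indicator_def)
    qed
  qed
  also have "\<dots> = (\<integral>\<^sup>+s. ennreal (exp (- (- psi (l + m)) * (s - 0))) * indicator {0..} s * ennreal (1 / - psi m) \<partial>lborel)"
    using neg by (intro nn_integral_cong, subst nn_integral_cmult, simp, subst nn_integral_exp_atLeast) auto
  also have "\<dots> = ennreal (1 / - psi (l + m)) * ennreal (1 / - psi m)"
    using neg by (subst nn_integral_multc, simp, subst nn_integral_exp_atLeast) auto
  finally show ?thesis .
qed

text \<open>Each ordering of the two times contributes a product with one factor
  \<open>1 / - psi (l + m)\<close>; \<open>psi_add_le\<close> trades it for
  \<open>2 / - psi l\<close> or \<open>2 / - psi m\<close>, and the two orderings add up to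
  4.\<close>

lemma expectation_pot_exp_mult_le:
  assumes "0 < l" "0 < m" "l < Phi / 3" "m < Phi / 3"
  shows "(\<integral>\<^sup>+\<omega>. pot (\<lambda>z. ennreal (exp (- l * z))) \<omega> * pot (\<lambda>z. ennreal (exp (- m * z))) \<omega> \<partial>M)
    \<le> 4 * (ennreal (1 / - psi l) * ennreal (1 / - psi m))"
proof -
  let ?F = "\<lambda>l m \<omega> s r. ennreal (exp (- l * X (max 0 s) \<omega>)) * indicator {0..} s *
      (ennreal (exp (- m * X (max 0 r) \<omega>)) * indicator {0..} r) * indicator {s..} r"
  have neg: "psi l < 0" "psi m < 0" "psi (l + m) < 0" using psi_neg assms by auto
  have b: "1 / - psi (l + m) \<le> 2 / - psi l" "1 / - psi (l + m) \<le> 2 / - psi m"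
    using psi_add_le[of l m] psi_add_le[of m l] assms neg by (auto simp: field_simps add.commute)
  have "(\<integral>\<^sup>+\<omega>. pot (\<lambda>z. ennreal (exp (- l * z))) \<omega> * pot (\<lambda>z. ennreal (exp (- m * z))) \<omega> \<partial>M)
    \<le> (\<integral>\<^sup>+\<omega>. (\<integral>\<^sup>+s. \<integral>\<^sup>+r. ?F l m \<omega> s r \<partial>lborel \<partial>lborel) + (\<integral>\<^sup>+s. \<integral>\<^sup>+r. ?F m l \<omega> s r \<partial>lborel \<partial>lborel) \<partial>M)"
    unfolding pot_def by (intro nn_integral_mono nn_integral_mult_le_ordered) measurable
  also have "\<dots> = (\<integral>\<^sup>+\<omega>. \<integral>\<^sup>+s. \<integral>\<^sup>+r. ?F l m \<omega> s r \<partial>lborel \<partial>lborel \<partial>M) + (\<integral>\<^sup>+\<omega>. \<integral>\<^sup>+s. \<integral>\<^sup>+r. ?F m l \<omega> s r \<partial>lborel \<partial>lborel \<partial>M)"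
    by (rule nn_integral_add) measurable
  also have "\<dots> = ennreal (1 / - psi (l + m)) * ennreal (1 / - psi m) + ennreal (1 / - psi (m + l)) * ennreal (1 / - psi l)"
    using assms by (intro arg_cong2[where f="(+)"] expectation_ordered_pot) auto
  also have "\<dots> \<le> ennreal (2 / - psi l) * ennreal (1 / - psi m) + ennreal (2 / - psi m) * ennreal (1 / - psi l)"
    using b by (intro add_mono mult_right_mono ennreal_leI) (auto simp: add.commute)
  also have "\<dots> = 2 * (ennreal (1 / - psi l) * ennreal (1 / - psi m)) + 2 * (ennreal (1 / - psi l) * ennreal (1 / - psi m))"
  proof -
    have "ennreal (2 / - psi k) = 2 * ennreal (1 / - psi k)" if "psi k < 0" for k
      using ennreal_mult[of 2 "1 / - psi k"] that by (simp add: divide_nonneg_neg)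
    with neg show ?thesis by (simp add: mult_ac)
  qed
  also have "\<dots> = 4 * (ennreal (1 / - psi l) * ennreal (1 / - psi m))"
    by (simp add: distrib_right[symmetric])
  finally show ?thesis .
qed

end

text \<open>Abstract in \<open>\<nu>\<close> because both the low-frequency part of \<open>g\<close>
  and its truncations are instances.\<close>

locale exponent_measure = regular_levy M X psi Phi C + nu: finite_measure \<nu>
  for M :: "'a measure" and X psi Phi C and \<nu> :: "real measure" +
  assumes sets_nu [measurable_cong]: "sets \<nu> = sets borel"
begin

lemma measurable_lap [measurable]: "lap \<nu> \<in> borel_measurable borel"
  unfolding lap_def by measurable

lemma pot_lap: "\<omega> \<in> space M \<Longrightarrow> pot (lap \<nu>) \<omega> = (\<integral>\<^sup>+l. pot (\<lambda>z. ennreal (exp (- l * z))) \<omega> \<partial>\<nu>)"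
proof -
  interpret P: pair_sigma_finite \<nu> "lborel :: real measure" ..
  assume [measurable]: "\<omega> \<in> space M"
  have "pot (lap \<nu>) \<omega> = (\<integral>\<^sup>+s. \<integral>\<^sup>+l. ennreal (exp (- l * X (max 0 s) \<omega>)) * indicator {0..} s \<partial>\<nu> \<partial>lborel)"
    unfolding pot_def lap_def by (intro nn_integral_cong nn_integral_multc[symmetric]) measurable
  also have "\<dots> = (\<integral>\<^sup>+l. pot (\<lambda>z. ennreal (exp (- l * z))) \<omega> \<partial>\<nu>)"
    unfolding pot_def by (rule P.Fubini') measurable
  finally show ?thesis .
qed

lemma measurable_pot_exp [measurable]:
  "(\<lambda>(l, \<omega>). pot (\<lambda>z. ennreal (exp (- l * z))) \<omega>) \<in> borel_measurable (\<nu> \<Otimes>\<^sub>M M)"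
  unfolding pot_def by measurable

lemma expectation_pot_lap:
  assumes "AE l in \<nu>. 0 < l \<and> l < Phi"
  shows "(\<integral>\<^sup>+\<omega>. pot (lap \<nu>) \<omega> \<partial>M) = (\<integral>\<^sup>+l. ennreal (1 / - psi l) \<partial>\<nu>)"
proof -
  interpret P: pair_sigma_finite \<nu> M ..
  have "(\<integral>\<^sup>+\<omega>. pot (lap \<nu>) \<omega> \<partial>M) = (\<integral>\<^sup>+\<omega>. \<integral>\<^sup>+l. pot (\<lambda>z. ennreal (exp (- l * z))) \<omega> \<partial>\<nu> \<partial>M)"
    by (intro nn_integral_cong pot_lap)
  also have "\<dots> = (\<integral>\<^sup>+l. \<integral>\<^sup>+\<omega>. pot (\<lambda>z. ennreal (exp (- l * z))) \<omega> \<partial>M \<partial>\<nu>)"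
    by (rule P.Fubini') measurable
  also have "\<dots> = (\<integral>\<^sup>+l. ennreal (1 / - psi l) \<partial>\<nu>)"
    using assms by (intro nn_integral_cong_AE, elim AE_mp, intro AE_I2 impI)
      (blast intro: expectation_pot_exp)
  finally show ?thesis .
qed

text \<open>The bound on the mixed moments is a product in \<open>l\<close> and \<open>m\<close>, so
  integrating it twice against \<open>\<nu>\<close> gives a square.\<close>

lemma second_moment_pot_lap:
  assumes "AE l in \<nu>. 0 < l \<and> l < Phi / 3"
  shows "(\<integral>\<^sup>+\<omega>. pot (lap \<nu>) \<omega> * pot (lap \<nu>) \<omega> \<partial>M) \<le> 4 * ((\<integral>\<^sup>+l. ennreal (1 / - psi l) \<partial>\<nu>) * (\<integral>\<^sup>+l. ennreal (1 / - psi l) \<partial>\<nu>))"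
proof -
  interpret P: pair_sigma_finite \<nu> M ..
  let ?e = "\<lambda>l \<omega>. pot (\<lambda>z. ennreal (exp (- l * z))) \<omega>"
  have "(\<integral>\<^sup>+\<omega>. pot (lap \<nu>) \<omega> * pot (lap \<nu>) \<omega> \<partial>M) = (\<integral>\<^sup>+\<omega>. \<integral>\<^sup>+l. \<integral>\<^sup>+m. ?e l \<omega> * ?e m \<omega> \<partial>\<nu> \<partial>\<nu> \<partial>M)"
  proof (intro nn_integral_cong)
    fix \<omega> assume [measurable]: "\<omega> \<in> space M"
    have [measurable]: "(\<lambda>l. ?e l \<omega>) \<in> borel_measurable \<nu>" by measurable
    have "(\<integral>\<^sup>+l. \<integral>\<^sup>+m. ?e l \<omega> * ?e m \<omega> \<partial>\<nu> \<partial>\<nu>) = (\<integral>\<^sup>+l. ?e l \<omega> * pot (lap \<nu>) \<omega> \<partial>\<nu>)"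
      unfolding pot_lap[OF \<open>\<omega> \<in> space M\<close>] by (intro nn_integral_cong nn_integral_cmult) measurable
    also have "\<dots> = pot (lap \<nu>) \<omega> * pot (lap \<nu>) \<omega>"
      by (subst nn_integral_multc) (measurable, simp only: pot_lap[OF \<open>\<omega> \<in> space M\<close>])
    finally show "pot (lap \<nu>) \<omega> * pot (lap \<nu>) \<omega> = (\<integral>\<^sup>+l. \<integral>\<^sup>+m. ?e l \<omega> * ?e m \<omega> \<partial>\<nu> \<partial>\<nu>)" ..
  qed
  also have "\<dots> = (\<integral>\<^sup>+l. \<integral>\<^sup>+\<omega>. \<integral>\<^sup>+m. ?e l \<omega> * ?e m \<omega> \<partial>\<nu> \<partial>M \<partial>\<nu>)"
    by (rule P.Fubini') measurable
  also have "\<dots> = (\<integral>\<^sup>+l. \<integral>\<^sup>+m. \<integral>\<^sup>+\<omega>. ?e l \<omega> * ?e m \<omega> \<partial>M \<partial>\<nu> \<partial>\<nu>)"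
    by (intro nn_integral_cong P.Fubini') measurable
  also have "\<dots> \<le> (\<integral>\<^sup>+l. \<integral>\<^sup>+m. 4 * (ennreal (1 / - psi l) * ennreal (1 / - psi m)) \<partial>\<nu> \<partial>\<nu>)"
  proof -
    have "(\<integral>\<^sup>+m. \<integral>\<^sup>+\<omega>. ?e l \<omega> * ?e m \<omega> \<partial>M \<partial>\<nu>) \<le> (\<integral>\<^sup>+m. 4 * (ennreal (1 / - psi l) * ennreal (1 / - psi m)) \<partial>\<nu>)"
      if "0 < l \<and> l < Phi / 3" for l
      using assms by (intro nn_integral_mono_AE, elim AE_mp, intro AE_I2 impI)
        (use that expectation_pot_exp_mult_le in blast)
    then show ?thesis
      using assms by (intro nn_integral_mono_AE, elim AE_mp, intro AE_I2 impI) blast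
  qed
  also have "\<dots> = 4 * ((\<integral>\<^sup>+l. ennreal (1 / - psi l) \<partial>\<nu>) * (\<integral>\<^sup>+l. ennreal (1 / - psi l) \<partial>\<nu>))"
    by (simp add: nn_integral_cmult nn_integral_multc)
  finally show ?thesis .
qed

lemma prob_pot_gt:
  assumes "AE l in \<nu>. 0 < l \<and> l < Phi / 3" "(\<integral>\<^sup>+l. ennreal (1 / - psi l) \<partial>\<nu>) = ennreal v" "0 < v"
  shows "1 / 16 \<le> prob {\<omega>\<in>space M. ennreal (v / 2) < pot (lap \<nu>) \<omega>}"
proof (rule second_moment_bound)
  have "AE l in \<nu>. 0 < l \<and> l < Phi" using assms(1) Phi_pos by (auto elim!: AE_mp)
  then show "(\<integral>\<^sup>+\<omega>. pot (lap \<nu>) \<omega> \<partial>M) = ennreal v"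
    using expectation_pot_lap assms(2) by simp
  have "4 * (ennreal v * ennreal v) = ennreal (4 * v\<^sup>2)"
    using assms(3) by (simp add: ennreal_mult power2_eq_square)
  then show "(\<integral>\<^sup>+\<omega>. pot (lap \<nu>) \<omega> * pot (lap \<nu>) \<omega> \<partial>M) \<le> ennreal (4 * v\<^sup>2)"
    using second_moment_pot_lap[OF assms(1)] assms(2) by simp
qed (use assms in auto)

end

section \<open>Divergence with probability one\<close>

lemma Int_stable_UN_mono:
  assumes "\<And>n m. n \<le> m \<Longrightarrow> sets (F n) \<subseteq> sets (F m)"
  shows "Int_stable (\<Union>n::nat. sets (F n))"
proof (rule Int_stableI)
  fix a b assume "a \<in> (\<Union>n. sets (F n))" "b \<in> (\<Union>n. sets (F n))"
  then obtain n m where "a \<in> sets (F n)" "b \<in> sets (F m)" by auto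
  then have "a \<in> sets (F (max n m))" "b \<in> sets (F (max n m))"
    using assms[of n "max n m"] assms[of m "max n m"] by auto
  then show "a \<inter> b \<in> (\<Union>n. sets (F n))" by auto
qed

context exponent_measure
begin

text \<open>The second moment method requires a finite mean. Cutting \<open>\<nu>\<close> down to
  frequencies with \<open>- psi l\<close> bounded away from 0 makes the mean finite, the means of
  the cuts increase to infinity, and the bound 1/16 does not depend on the cut.\<close>

lemma prob_pot_lap_top:
  assumes ae: "AE l in \<nu>. 0 < l \<and> l < Phi / 3" and inf: "(\<integral>\<^sup>+l. ennreal (1 / - psi l) \<partial>\<nu>) = \<infinity>"
  shows "1 / 16 \<le> prob {\<omega>\<in>space M. pot (lap \<nu>) \<omega> = \<infinity>}"
proof -
  define B where "B n = {l. 1 / real (Suc n) \<le> - psi l}" for n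
  have [measurable]: "B n \<in> sets borel" for n unfolding B_def by measurable
  have nu: "AE l in \<nu>. - psi l > 0"
    using ae by (rule AE_mp) (use psi_neg Phi_pos in \<open>auto intro!: AE_I2\<close>)
  define \<nu>' where "\<nu>' n = density \<nu> (indicator (B n))" for n
  have fin: "(\<integral>\<^sup>+l. indicator (B n) l * ennreal (1 / - psi l) \<partial>\<nu>) < \<infinity>" for n
  proof -
    have "(\<integral>\<^sup>+l. indicator (B n) l * ennreal (1 / - psi l) \<partial>\<nu>) \<le> (\<integral>\<^sup>+l. ennreal (real (Suc n)) \<partial>\<nu>)"
    proof (rule nn_integral_mono)
      fix l show "indicator (B n) l * ennreal (1 / - psi l) \<le> ennreal (real (Suc n))"
      proof (cases "l \<in> B n")
        case True
        then have le: "1 / real (Suc n) \<le> - psi l" by (simp add: B_def)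
        moreover have "0 < 1 / real (Suc n)" by simp
        ultimately have "1 / - psi l \<le> 1 / (1 / real (Suc n))" by (intro divide_left_mono mult_pos_pos) linarith+
        then show ?thesis using True by (simp del: of_nat_Suc add: ennreal_leI)
      qed simp
    qed
    also have "\<dots> < \<infinity>" by (simp add: ennreal_mult_less_top nu.emeasure_eq_measure)
    finally show ?thesis .
  qed
  have V: "(\<integral>\<^sup>+l. ennreal (1 / - psi l) \<partial>\<nu>' n) = (\<integral>\<^sup>+l. indicator (B n) l * ennreal (1 / - psi l) \<partial>\<nu>)" for n
    unfolding \<nu>'_def by (rule nn_integral_density) measurable
  have incB: "incseq B"
    unfolding incseq_Suc_iff B_def by (auto intro: order_trans[rotated] simp: frac_le)
  have sup: "(SUP n. \<integral>\<^sup>+l. indicator (B n) l * ennreal (1 / - psi l) \<partial>\<nu>) = \<infinity>"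
  proof -
    have "(SUP n. \<integral>\<^sup>+l. indicator (B n) l * ennreal (1 / - psi l) \<partial>\<nu>) = (\<integral>\<^sup>+l. (SUP n. indicator (B n) l * ennreal (1 / - psi l)) \<partial>\<nu>)"
      using incB by (intro nn_integral_monotone_convergence_SUP[symmetric])
        (auto simp: incseq_def le_fun_def indicator_def)
    also have "\<dots> = (\<integral>\<^sup>+l. ennreal (1 / - psi l) \<partial>\<nu>)"
      using nu
    proof (intro nn_integral_cong_AE, elim AE_mp, intro AE_I2 impI)
      fix l assume "- psi l > 0"
      then obtain n where "1 / real (Suc n) < - psi l" using reals_Archimedean[of "- psi l"] by (auto simp: inverse_eq_divide)
      then have "ennreal (1 / - psi l) \<le> indicator (B n) l * ennreal (1 / - psi l)" by (simp add: B_def)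
      then show "(SUP n. indicator (B n) l * ennreal (1 / - psi l)) = ennreal (1 / - psi l)"
        by (intro antisym SUP_least) (auto intro: SUP_upper2 simp: indicator_def)
    qed
    finally show ?thesis using inf by simp
  qed
  have big: "1 / 16 \<le> prob {\<omega>\<in>space M. of_nat K < pot (lap \<nu>) \<omega>}" for K :: nat
  proof -
    \<comment> \<open>With a mean \<open>v\<close> above \<open>2 * K + 1\<close>, half of it
      exceeds \<open>K\<close>; the extra 1 keeps \<open>v\<close> positive for
      \<open>K = 0\<close>.\<close>
    have "of_nat (2 * K + 1) < (SUP n. \<integral>\<^sup>+l. indicator (B n) l * ennreal (1 / - psi l) \<partial>\<nu>)"
      unfolding sup infinity_ennreal_def by (rule of_nat_less_top)
    then obtain n where n: "of_nat (2 * K + 1) < (\<integral>\<^sup>+l. indicator (B n) l * ennreal (1 / - psi l) \<partial>\<nu>)"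
      by (auto simp: less_SUP_iff)
    obtain v where v: "0 \<le> v" "(\<integral>\<^sup>+l. ennreal (1 / - psi l) \<partial>\<nu>' n) = ennreal v"
      using fin[of n] V[of n] by (cases "\<integral>\<^sup>+l. ennreal (1 / - psi l) \<partial>\<nu>' n") auto
    have v2: "2 * real K + 1 < v"
    proof -
      have "ennreal (real (2 * K + 1)) < ennreal v" using n v V[of n] by (simp only: ennreal_of_nat_eq_real_of_nat)
      then show ?thesis by (subst (asm) ennreal_less_iff) auto
    qed
    have "finite_measure (\<nu>' n)"
      unfolding \<nu>'_def by (intro nu.finite_measure_restricted) (simp add: sets_nu)
    then interpret R: exponent_measure M X psi Phi C "\<nu>' n"
      by (intro exponent_measure.intro regular_levy_axioms exponent_measure_axioms.intro) (simp_all add: \<nu>'_def sets_nu)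
    have ae': "AE l in \<nu>' n. 0 < l \<and> l < Phi / 3"
      unfolding \<nu>'_def using ae by (subst AE_density, measurable, elim AE_mp, intro AE_I2 impI)
    have "lap (\<nu>' n) z \<le> lap \<nu> z" for z
      unfolding lap_def \<nu>'_def
      by (subst nn_integral_density) (auto intro!: nn_integral_mono simp: indicator_def)
    then have le: "pot (lap (\<nu>' n)) \<omega> \<le> pot (lap \<nu>) \<omega>" for \<omega>
      unfolding pot_def by (intro nn_integral_mono mult_right_mono) auto
    have "1 / 16 \<le> prob {\<omega>\<in>space M. ennreal (v / 2) < pot (lap (\<nu>' n)) \<omega>}"
      using v v2 by (intro R.prob_pot_gt[OF ae']) auto
    also have "\<dots> \<le> prob {\<omega>\<in>space M. of_nat K < pot (lap \<nu>) \<omega>}"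
    proof (rule finite_measure_mono, safe)
      fix \<omega> assume "ennreal (v / 2) < pot (lap (\<nu>' n)) \<omega>"
      have "of_nat K \<le> ennreal (v / 2)"
        using v2 by (simp add: ennreal_of_nat_eq_real_of_nat ennreal_leI del: ennreal_half)
      also have "\<dots> < pot (lap (\<nu>' n)) \<omega>" by fact
      also have "\<dots> \<le> pot (lap \<nu>) \<omega>" by (rule le)
      finally show "of_nat K < pot (lap \<nu>) \<omega>" .
    qed auto
    finally show ?thesis .
  qed
  have "(\<lambda>K. prob {\<omega>\<in>space M. of_nat K < pot (lap \<nu>) \<omega>}) \<longlonglongrightarrow> prob (\<Inter>K. {\<omega>\<in>space M. of_nat K < pot (lap \<nu>) \<omega>})"
  proof (rule finite_Lim_measure_decseq)
    show "range (\<lambda>K. {\<omega>\<in>space M. of_nat K < pot (lap \<nu>) \<omega>}) \<subseteq> events" by auto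
    show "decseq (\<lambda>K. {\<omega>\<in>space M. of_nat K < pot (lap \<nu>) \<omega>})"
      by (auto simp: decseq_def intro: le_less_trans[OF of_nat_mono])
  qed
  also have "(\<Inter>K. {\<omega>\<in>space M. of_nat K < pot (lap \<nu>) \<omega>}) = {\<omega>\<in>space M. pot (lap \<nu>) \<omega> = \<infinity>}"
  proof safe
    fix \<omega> assume "\<omega> \<in> (\<Inter>K. {\<omega>\<in>space M. of_nat K < pot (lap \<nu>) \<omega>})"
    then have "\<And>K. of_nat K < pot (lap \<nu>) \<omega>" by auto
    then show "pot (lap \<nu>) \<omega> = \<infinity>"
      using ennreal_Ex_less_of_nat[of "pot (lap \<nu>) \<omega>"] by (auto simp: less_top[symmetric] dest: less_asym)
  qed (auto simp: of_nat_less_top)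
  finally show ?thesis by (rule LIMSEQ_le_const) (use big in auto)
qed

end

section \<open>Past, future and the zero-one law\<close>

context regular_levy
begin

definition past :: "nat \<Rightarrow> nat \<Rightarrow> 'a \<Rightarrow> nat \<Rightarrow> real" where
  "past T n = (\<lambda>\<omega>. \<lambda>k\<in>{..T * 2 ^ n}. X (real k / 2 ^ n) \<omega>)"

text \<open>\<open>4 ^ n\<close> steps of length \<open>2 ^ - n\<close> cover a window of length
  \<open>2 ^ n\<close>, so every dyadic time is captured eventually while each stage has finitely
  many coordinates.\<close>

definition future :: "nat \<Rightarrow> nat \<Rightarrow> 'a \<Rightarrow> nat \<Rightarrow> real" where
  "future T n = (\<lambda>\<omega>. \<lambda>k\<in>{..4 ^ n}. X (real T + real k / 2 ^ n) \<omega> - X (real T) \<omega>)"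

definition past_algebra :: "nat \<Rightarrow> nat \<Rightarrow> 'a measure" where
  "past_algebra T n = vimage_algebra (space M) (past T n) (PiM {..T * 2 ^ n} (\<lambda>_. borel))"

definition future_algebra :: "nat \<Rightarrow> nat \<Rightarrow> 'a measure" where
  "future_algebra T n = vimage_algebra (space M) (future T n) (PiM {..4 ^ n} (\<lambda>_. borel))"

lemma indep_past_future_algebra:
  "indep_set (sets (past_algebra T n)) (sets (future_algebra T n))"
proof -
  define t where "t k = real k / 2 ^ n" for k :: nat
  have "indep_var (PiM {..T * 2 ^ n} (\<lambda>_. borel)) (\<lambda>\<omega>. \<lambda>k\<in>{..T * 2 ^ n}. X (t k) \<omega>)
     (PiM {..4 ^ n} (\<lambda>_. borel)) (\<lambda>\<omega>. \<lambda>k\<in>{..4 ^ n}. X (t (T * 2 ^ n + k)) \<omega> - X (t (T * 2 ^ n)) \<omega>)"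
    by (rule indep_past_future) (auto simp: t_def divide_right_mono)
  then show ?thesis
    by (simp add: indep_var_eq past_algebra_def future_algebra_def sets_vimage_algebra past_def future_def
        t_def add_divide_distrib)
qed

lemma measurable_past_algebra:
  assumes "k \<le> T * 2 ^ n"
  shows "X (real k / 2 ^ n) \<in> borel_measurable (past_algebra T n)"
proof -
  have "past T n \<in> past_algebra T n \<rightarrow>\<^sub>M PiM {..T * 2 ^ n} (\<lambda>_. borel)"
    unfolding past_algebra_def by (rule measurable_vimage_algebra1) (auto simp: past_def space_PiM)
  moreover have "(\<lambda>y. y k) \<in> PiM {..T * 2 ^ n} (\<lambda>_. borel :: real measure) \<rightarrow>\<^sub>M borel"
    using assms by (intro measurable_component_singleton) simp
  ultimately have "(\<lambda>\<omega>. past T n \<omega> k) \<in> borel_measurable (past_algebra T n)"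
    by (rule measurable_compose)
  then show ?thesis using assms by (simp add: past_def)
qed

lemma measurable_future_algebra:
  assumes "k \<le> 4 ^ n"
  shows "(\<lambda>\<omega>. X (real T + real k / 2 ^ n) \<omega> - X (real T) \<omega>) \<in> borel_measurable (future_algebra T n)"
proof -
  have "future T n \<in> future_algebra T n \<rightarrow>\<^sub>M PiM {..4 ^ n} (\<lambda>_. borel)"
    unfolding future_algebra_def by (rule measurable_vimage_algebra1) (auto simp: future_def space_PiM)
  moreover have "(\<lambda>y. y k) \<in> PiM {..4 ^ n} (\<lambda>_. borel :: real measure) \<rightarrow>\<^sub>M borel"
    using assms by (intro measurable_component_singleton) simp
  ultimately have "(\<lambda>\<omega>. future T n \<omega> k) \<in> borel_measurable (future_algebra T n)"
    by (rule measurable_compose)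
  then show ?thesis using assms by (simp add: future_def)
qed

lemma past_algebra_mono: "n \<le> m \<Longrightarrow> sets (past_algebra T n) \<subseteq> sets (past_algebra T m)"
proof (rule lift_Suc_mono_le[of "\<lambda>n. sets (past_algebra T n)"])
  fix n
  show "sets (past_algebra T n) \<subseteq> sets (past_algebra T (Suc n))"
    unfolding past_algebra_def[of T n]
  proof (rule sets_image_in_sets)
    show "past T n \<in> past_algebra T (Suc n) \<rightarrow>\<^sub>M PiM {..T * 2 ^ n} (\<lambda>_. borel)"
      unfolding past_def
    proof (rule measurable_restrict)
      fix k assume "k \<in> {..T * 2 ^ n}"
      then show "X (real k / 2 ^ n) \<in> borel_measurable (past_algebra T (Suc n))"
        using measurable_past_algebra[of "2 * k" T "Suc n"] by simp
    qed
  qed (simp add: past_algebra_def)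
qed

lemma future_algebra_mono: "n \<le> m \<Longrightarrow> sets (future_algebra T n) \<subseteq> sets (future_algebra T m)"
proof (rule lift_Suc_mono_le[of "\<lambda>n. sets (future_algebra T n)"])
  fix n
  show "sets (future_algebra T n) \<subseteq> sets (future_algebra T (Suc n))"
    unfolding future_algebra_def[of T n]
  proof (rule sets_image_in_sets)
    show "future T n \<in> future_algebra T (Suc n) \<rightarrow>\<^sub>M PiM {..4 ^ n} (\<lambda>_. borel)"
      unfolding future_def
    proof (rule measurable_restrict)
      fix k :: nat assume "k \<in> {..4 ^ n}"
      then show "(\<lambda>\<omega>. X (real T + real k / 2 ^ n) \<omega> - X (real T) \<omega>) \<in> borel_measurable (future_algebra T (Suc n))"
        using measurable_future_algebra[of "2 * k" "Suc n" T] by simp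
    qed
  qed (simp add: future_algebra_def)
qed

definition past_all :: "nat \<Rightarrow> 'a measure" where
  "past_all T = sigma (space M) (\<Union>n. sets (past_algebra T n))"

definition future_all :: "nat \<Rightarrow> 'a measure" where
  "future_all T = sigma (space M) (\<Union>n. sets (future_algebra T n))"

lemma past_all_Pow: "(\<Union>n. sets (past_algebra T n)) \<subseteq> Pow (space M)"
  using sets.sets_into_space[of _ "past_algebra T _"] by (force simp: past_algebra_def)

lemma future_all_Pow: "(\<Union>n. sets (future_algebra T n)) \<subseteq> Pow (space M)"
  using sets.sets_into_space[of _ "future_algebra T _"] by (force simp: future_algebra_def)

lemma space_past_all [simp]: "space (past_all T) = space M"
  and space_future_all [simp]: "space (future_all T) = space M"
  by (simp_all add: past_all_def future_all_def space_measure_of past_all_Pow future_all_Pow)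

text \<open>Refining the grid enlarges both algebras, so any two generators lie in a common stage,
  where independence is known. The unions are also intersection stable, so independence extends to
  the generated sigma-algebras.\<close>

lemma indep_past_future_all: "indep_set (sets (past_all T)) (sets (future_all T))"
proof -
  have ind: "prob (a \<inter> b) = prob a * prob b" "a \<in> events" "b \<in> events"
    if "a \<in> sets (past_algebra T n)" "b \<in> sets (future_algebra T n)" for a b n
    using indep_past_future_algebra[of T n] that by (auto simp: indep_sets2_eq)
  have "indep_set (\<Union>n. sets (past_algebra T n)) (\<Union>n. sets (future_algebra T n))"
    unfolding indep_sets2_eq
  proof (intro conjI ballI subsetI)
    fix a assume "a \<in> (\<Union>n. sets (past_algebra T n))"
    then show "a \<in> events" using ind(2)[OF _ sets.empty_sets] by auto
  next
    fix b assume "b \<in> (\<Union>n. sets (future_algebra T n))"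
    then show "b \<in> events" using ind(3)[OF sets.empty_sets] by auto
  next
    fix a b assume "a \<in> (\<Union>n. sets (past_algebra T n))" "b \<in> (\<Union>n. sets (future_algebra T n))"
    then obtain n m where "a \<in> sets (past_algebra T n)" "b \<in> sets (future_algebra T m)" by auto
    then show "prob (a \<inter> b) = prob a * prob b"
      using past_algebra_mono[of n "max n m" T] future_algebra_mono[of m "max n m" T]
      by (intro ind(1)[of _ "max n m"]) auto
  qed
  then have "indep_set (sigma_sets (space M) (\<Union>n. sets (past_algebra T n))) (sigma_sets (space M) (\<Union>n. sets (future_algebra T n)))"
    by (rule indep_set_sigma_sets) (intro Int_stable_UN_mono past_algebra_mono future_algebra_mono; assumption)+
  then show ?thesis
    unfolding past_all_def future_all_def by (simp add: sets_measure_of past_all_Pow future_all_Pow)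
qed

lemma measurable_X_past:
  assumes "real k / 2 ^ n \<le> real T"
  shows "X (real k / 2 ^ n) \<in> borel_measurable (past_all T)"
proof -
  have "real k \<le> real (T * 2 ^ n)" using assms by (simp add: field_simps)
  then have "k \<le> T * 2 ^ n" by (simp only: of_nat_le_iff)
  moreover have "sets (past_algebra T n) \<subseteq> sets (past_all T)"
    unfolding past_all_def by (auto simp: sets_measure_of past_all_Pow)
  ultimately show ?thesis
    using measurable_mono[of borel borel "past_algebra T n" "past_all T"] measurable_past_algebra[of k T n]
    by (auto simp: past_algebra_def)
qed

lemma measurable_X_future:
  "(\<lambda>\<omega>. X (real T + real k / 2 ^ n) \<omega> - X (real T) \<omega>) \<in> borel_measurable (future_all T)"
proof -
  define m where "m = n + k"
  have "k * 2 ^ k \<le> 2 ^ k * (2 ^ k :: nat)" by (intro mult_right_mono) auto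
  also have "\<dots> = 4 ^ k" by (simp add: power_mult_distrib[symmetric])
  also have "\<dots> \<le> 4 ^ m" unfolding m_def by (intro power_increasing) auto
  finally have le: "k * 2 ^ k \<le> 4 ^ m" .
  have eq: "real (k * 2 ^ k) / 2 ^ m = real k / 2 ^ n" by (simp add: m_def power_add)
  have "sets (future_algebra T m) \<subseteq> sets (future_all T)"
    unfolding future_all_def by (auto simp: sets_measure_of future_all_Pow)
  then show ?thesis
    using measurable_mono[of borel borel "future_algebra T m" "future_all T"] measurable_future_algebra[OF le, of T]
    unfolding eq by (auto simp: future_algebra_def)
qed

text \<open>The approximation from the right looks beyond \<open>s\<close>, possibly beyond
  \<open>T\<close>. Stopping the path at time \<open>T\<close> keeps every sample measurable with
  respect to the past, preserves right continuity and leaves the integral over \<open>[0, T)\<close>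
  unchanged.\<close>

lemma measurable_functional_past:
  assumes [measurable]: "\<phi> \<in> borel_measurable borel"
  shows "(\<lambda>\<omega>. \<integral>\<^sup>+s. \<phi> (X (max 0 s) \<omega>) * indicator {0..<real T} s \<partial>lborel) \<in> borel_measurable (past_all T)"
proof -
  have [measurable]: "(\<lambda>(s, \<omega>). X (min (max 0 s) (real T)) \<omega>) \<in> borel_measurable (lborel \<Otimes>\<^sub>M past_all T)"
  proof (rule measurable_right_continuous_process)
    fix s \<omega> assume s: "0 \<le> (s::real)"
    show "continuous (at_right s) (\<lambda>s. X (min s (real T)) \<omega>)"
    proof (cases "s < real T")
      case True
      have "((\<lambda>s. X s \<omega>) \<longlongrightarrow> X s \<omega>) (at_right s)" using right_continuous[OF s] by (simp add: continuous_within)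
      moreover have "\<forall>\<^sub>F u in at_right s. X u \<omega> = X (min u (real T)) \<omega>"
        using eventually_at_right_real[OF True] by (rule eventually_mono) (auto simp: min_def)
      ultimately show ?thesis using True by (auto simp: continuous_within min_def elim: Lim_transform_eventually)
    next
      case False
      have "\<forall>\<^sub>F u in at_right s. X (real T) \<omega> = X (min u (real T)) \<omega>"
        using eventually_at_right_less[of s] by (rule eventually_mono) (use False in \<open>auto simp: min_def\<close>)
      then show ?thesis using False by (auto simp: continuous_within min_def intro: Lim_transform_eventually[OF tendsto_const])
    qed
  next
    fix n k
    show "X (min (real k / 2 ^ n) (real T)) \<in> borel_measurable (past_all T)"
      using measurable_X_past[of k n T] measurable_X_past[of T 0 T] by (auto simp: min_def)
  qed
  have [measurable]: "(\<lambda>p. X (min (max 0 (snd p)) (real T)) (fst p)) \<in> borel_measurable (past_all T \<Otimes>\<^sub>M lborel)"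
    using measurable_compose[OF measurable_pair_swap' \<open>(\<lambda>(s, \<omega>). X (min (max 0 s) (real T)) \<omega>) \<in> borel_measurable (lborel \<Otimes>\<^sub>M past_all T)\<close>]
    by (simp add: case_prod_beta)
  have "(\<lambda>\<omega>. \<integral>\<^sup>+s. \<phi> (X (min (max 0 s) (real T)) \<omega>) * indicator {0..<real T} s \<partial>lborel) \<in> borel_measurable (past_all T)"
    by measurable
  also have "(\<lambda>\<omega>. \<integral>\<^sup>+s. \<phi> (X (min (max 0 s) (real T)) \<omega>) * indicator {0..<real T} s \<partial>lborel) =
      (\<lambda>\<omega>. \<integral>\<^sup>+s. \<phi> (X (max 0 s) \<omega>) * indicator {0..<real T} s \<partial>lborel)"
    by (intro ext nn_integral_cong) (auto simp: indicator_def min_def)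
  finally show ?thesis .
qed

lemma measurable_functional_future:
  assumes [measurable]: "\<phi> \<in> borel_measurable borel"
  shows "(\<lambda>\<omega>. \<integral>\<^sup>+s. \<phi> (X (real T + max 0 s) \<omega> - X (real T) \<omega>) * indicator {0..} s \<partial>lborel) \<in> borel_measurable (future_all T)"
proof -
  have *: "(\<lambda>(s, \<omega>). X (real T + max 0 s) \<omega> - X (real T) \<omega>) \<in> borel_measurable (lborel \<Otimes>\<^sub>M future_all T)"
  proof (rule measurable_right_continuous_process)
    fix s \<omega> assume s: "0 \<le> (s::real)"
    have "((\<lambda>s. X s \<omega>) \<longlongrightarrow> X (real T + s) \<omega>) (at_right (real T + s))"
      using right_continuous[of "real T + s"] s by (simp add: continuous_within)
    moreover have "filterlim (\<lambda>u. real T + u) (at_right (real T + s)) (at_right s)"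
      by (auto simp: filterlim_at eventually_at_filter intro!: tendsto_intros)
    ultimately have "((\<lambda>u. X (real T + u) \<omega>) \<longlongrightarrow> X (real T + s) \<omega>) (at_right s)"
      by (rule filterlim_compose)
    then show "continuous (at_right s) (\<lambda>s. X (real T + s) \<omega> - X (real T) \<omega>)"
      by (simp add: continuous_within tendsto_diff)
  qed (rule measurable_X_future)
  have [measurable]: "(\<lambda>p. X (real T + max 0 (snd p)) (fst p) - X (real T) (fst p)) \<in> borel_measurable (future_all T \<Otimes>\<^sub>M lborel)"
    using measurable_compose[OF measurable_pair_swap' *] by (simp add: case_prod_beta)
  show ?thesis by measurable
qed

lemma pot_split:
  assumes [measurable]: "\<phi> \<in> borel_measurable borel" and \<omega>: "\<omega> \<in> space M"
  shows "pot \<phi> \<omega> = (\<integral>\<^sup>+s. \<phi> (X (max 0 s) \<omega>) * indicator {0..<real T} s \<partial>lborel) +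
    (\<integral>\<^sup>+s. \<phi> (X (real T + max 0 s) \<omega>) * indicator {0..} s \<partial>lborel)"
proof -
  note \<omega>[measurable]
  have "pot \<phi> \<omega> = (\<integral>\<^sup>+s. \<phi> (X (max 0 s) \<omega>) * indicator {0..<real T} s + \<phi> (X (max 0 s) \<omega>) * indicator {real T..} s \<partial>lborel)"
    unfolding pot_def by (intro nn_integral_cong) (auto simp: indicator_def)
  also have "\<dots> = (\<integral>\<^sup>+s. \<phi> (X (max 0 s) \<omega>) * indicator {0..<real T} s \<partial>lborel) + (\<integral>\<^sup>+s. \<phi> (X (max 0 s) \<omega>) * indicator {real T..} s \<partial>lborel)"
    by (rule nn_integral_add) measurable
  also have "(\<integral>\<^sup>+s. \<phi> (X (max 0 s) \<omega>) * indicator {real T..} s \<partial>lborel) =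
      (\<integral>\<^sup>+s. \<phi> (X (max 0 (real T + 1 * s)) \<omega>) * indicator {real T..} (real T + 1 * s) \<partial>lborel)"
    by (subst nn_integral_real_affine[of _ 1 "real T"]) (auto, measurable)
  also have "\<dots> = (\<integral>\<^sup>+s. \<phi> (X (real T + max 0 s) \<omega>) * indicator {0..} s \<partial>lborel)"
    by (intro nn_integral_cong) (auto simp: indicator_def max_def)
  finally show ?thesis .
qed

text \<open>
  Kolmogorov's argument: up to null sets, finiteness of the functional only depends on the
  increments after \<open>T\<close>, so it is independent of the functional up to \<open>T\<close>, for every \<open>T\<close>, and
  hence of itself.
\<close>

lemma pot_zero_one:
  assumes [measurable]: "\<phi> \<in> borel_measurable borel"
    and shift: "\<And>z h. \<phi> (z + h) \<le> ennreal (exp (d * \<bar>h\<bar>)) * \<phi> z"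
    and loc: "\<And>T::nat. AE \<omega> in M. (\<integral>\<^sup>+s. \<phi> (X (max 0 s) \<omega>) * indicator {0..<real T} s \<partial>lborel) < \<infinity>"
  shows "prob {\<omega>\<in>space M. pot \<phi> \<omega> < \<infinity>} \<in> {0, 1}"
proof -
  define p where "p = prob {\<omega>\<in>space M. pot \<phi> \<omega> < \<infinity>}"
  define U where "U T \<omega> = (\<integral>\<^sup>+s. \<phi> (X (max 0 s) \<omega>) * indicator {0..<real T} s \<partial>lborel)" for T \<omega>
  define V where "V T \<omega> = (\<integral>\<^sup>+s. \<phi> (X (real T + max 0 s) \<omega> - X (real T) \<omega>) * indicator {0..} s \<partial>lborel)" for T \<omega>
  define R where "R T \<omega> = (\<integral>\<^sup>+s. \<phi> (X (real T + max 0 s) \<omega>) * indicator {0..} s \<partial>lborel)" for T \<omega>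
  \<comment> \<open>Levels \<open>K\<close> are used because
    \<open>U T \<omega> < \<infinity>\<close> holds almost surely and so carries no information; for
    fixed \<open>K\<close> the events decrease, as \<open>T\<close> grows, to
    \<open>pot \<phi> \<omega> \<le> of_nat K\<close>.\<close>
  have mU: "{\<omega>\<in>space M. U T \<omega> \<le> of_nat K} \<in> sets (past_all T)" for T K
  proof -
    have [measurable]: "U T \<in> borel_measurable (past_all T)"
      unfolding U_def by (rule measurable_functional_past) fact
    have "{\<omega>\<in>space (past_all T). U T \<omega> \<le> of_nat K} \<in> sets (past_all T)" by measurable
    then show ?thesis by simp
  qed
  have mV: "{\<omega>\<in>space M. V T \<omega> < \<infinity>} \<in> sets (future_all T)" for T
  proof -
    have [measurable]: "V T \<in> borel_measurable (future_all T)"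
      unfolding V_def by (rule measurable_functional_future) fact
    have "{\<omega>\<in>space (future_all T). V T \<omega> < \<infinity>} \<in> sets (future_all T)" by measurable
    then show ?thesis by simp
  qed
  have events: "{\<omega>\<in>space M. U T \<omega> \<le> of_nat K} \<in> events" "{\<omega>\<in>space M. V T \<omega> < \<infinity>} \<in> events" for T K
    using indep_past_future_all[of T] mU[of T K] mV[of T] by (auto simp: indep_sets2_eq)
  have pm: "{\<omega>\<in>space M. pot \<phi> \<omega> < \<infinity>} \<in> events" by measurable
  \<comment> \<open>Subtracting the value at time \<open>T\<close> changes the integrand by a factor
    that is bounded along each path, so the functionals of increments and of positions are finite
    together.\<close>
  have VR: "V T \<omega> < \<infinity> \<longleftrightarrow> R T \<omega> < \<infinity>" if \<omega>: "\<omega> \<in> space M" for T \<omega>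
  proof -
    have [measurable]: "(\<lambda>s. X (real T + max 0 s) \<omega>) \<in> borel_measurable lborel"
    proof -
      have "(\<lambda>s. X (max 0 (real T + max 0 s)) \<omega>) \<in> borel_measurable lborel" using \<omega> by measurable
      then show ?thesis by (simp add: max_def)
    qed
    have "V T \<omega> \<le> ennreal (exp (d * \<bar>- X (real T) \<omega>\<bar>)) * R T \<omega>"
      unfolding V_def R_def
      by (subst nn_integral_cmult[symmetric], measurable, intro nn_integral_mono)
        (use shift[of _ "- X (real T) \<omega>"] in \<open>auto simp: indicator_def\<close>)
    moreover have "R T \<omega> \<le> ennreal (exp (d * \<bar>X (real T) \<omega>\<bar>)) * V T \<omega>"
      unfolding V_def R_def
      by (subst nn_integral_cmult[symmetric], measurable, intro nn_integral_mono)
        (use shift[of "_ - X (real T) \<omega>" "X (real T) \<omega>"] in \<open>auto simp: indicator_def\<close>)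
    ultimately show ?thesis
      by (metis ennreal_less_top ennreal_mult_less_top infinity_ennreal_def le_less_trans)
  qed
  have AE_V: "AE \<omega> in M. V T \<omega> < \<infinity> \<longleftrightarrow> pot \<phi> \<omega> < \<infinity>" for T
    using loc[of T]
  proof (rule AE_mp, intro AE_I2 impI)
    fix \<omega> assume "\<omega> \<in> space M" "(\<integral>\<^sup>+s. \<phi> (X (max 0 s) \<omega>) * indicator {0..<real T} s \<partial>lborel) < \<infinity>"
    then show "V T \<omega> < \<infinity> \<longleftrightarrow> pot \<phi> \<omega> < \<infinity>"
      using pot_split[OF assms(1), of \<omega> T] VR[of \<omega> T] by (simp add: R_def)
  qed
  have prod: "prob {\<omega>\<in>space M. U T \<omega> \<le> of_nat K \<and> pot \<phi> \<omega> < \<infinity>} = prob {\<omega>\<in>space M. U T \<omega> \<le> of_nat K} * p" for T K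
  proof -
    have "prob ({\<omega>\<in>space M. U T \<omega> \<le> of_nat K} \<inter> {\<omega>\<in>space M. V T \<omega> < \<infinity>}) =
        prob {\<omega>\<in>space M. U T \<omega> \<le> of_nat K} * prob {\<omega>\<in>space M. V T \<omega> < \<infinity>}"
      using indep_past_future_all[of T] mU[of T K] mV[of T] by (auto simp: indep_sets2_eq)
    moreover have "prob {\<omega>\<in>space M. V T \<omega> < \<infinity>} = p"
      unfolding p_def using AE_V[of T] events(2)[of T] pm by (intro prob_eq_AE) auto
    moreover have "prob ({\<omega>\<in>space M. U T \<omega> \<le> of_nat K} \<inter> {\<omega>\<in>space M. V T \<omega> < \<infinity>}) =
        prob {\<omega>\<in>space M. U T \<omega> \<le> of_nat K \<and> pot \<phi> \<omega> < \<infinity>}"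
    proof (rule finite_measure_eq_AE)
      show "AE \<omega> in M. \<omega> \<in> {\<omega>\<in>space M. U T \<omega> \<le> of_nat K} \<inter> {\<omega>\<in>space M. V T \<omega> < \<infinity>} \<longleftrightarrow>
          \<omega> \<in> {\<omega>\<in>space M. U T \<omega> \<le> of_nat K \<and> pot \<phi> \<omega> < \<infinity>}"
        using AE_V[of T] by (rule AE_mp) auto
      have "{\<omega>\<in>space M. U T \<omega> \<le> of_nat K \<and> pot \<phi> \<omega> < \<infinity>} = {\<omega>\<in>space M. U T \<omega> \<le> of_nat K} \<inter> {\<omega>\<in>space M. pot \<phi> \<omega> < \<infinity>}" by auto
      then show "{\<omega>\<in>space M. U T \<omega> \<le> of_nat K \<and> pot \<phi> \<omega> < \<infinity>} \<in> events"
        using events(1)[of T K] pm by auto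
    qed (use events in auto)
    ultimately show ?thesis by simp
  qed
  have Umono: "U T \<omega> \<le> U (Suc T) \<omega>" for T \<omega>
    unfolding U_def by (intro nn_integral_mono) (auto simp: indicator_def)
  have U_le: "(\<forall>T. U T \<omega> \<le> of_nat K) \<longleftrightarrow> pot \<phi> \<omega> \<le> of_nat K" if "\<omega> \<in> space M" for K \<omega>
  proof -
    note that[measurable]
    have "(SUP T. U T \<omega>) = (\<integral>\<^sup>+s. (SUP T. \<phi> (X (max 0 s) \<omega>) * indicator {0..<real T} s) \<partial>lborel)"
      unfolding U_def
      by (intro nn_integral_monotone_convergence_SUP[symmetric])
        (auto simp: incseq_def le_fun_def indicator_def)
    also have "\<dots> = pot \<phi> \<omega>"
      unfolding pot_def
    proof (rule nn_integral_cong)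
      fix s :: real
      obtain T :: nat where "s < real T" using reals_Archimedean2 by blast
      then show "(SUP T. \<phi> (X (max 0 s) \<omega>) * indicator {0..<real T} s) = \<phi> (X (max 0 s) \<omega>) * indicator {0..} s"
        by (intro antisym SUP_least) (auto intro!: SUP_upper2[of T] simp: indicator_def)
    qed
    finally show ?thesis using SUP_le_iff[of "\<lambda>T. U T \<omega>" UNIV "of_nat K"] by simp
  qed
  \<comment> \<open>As \<open>T\<close> grows, the past event becomes
    \<open>pot \<phi> \<omega> \<le> of_nat K\<close>. It is thus independent of
    \<open>pot \<phi> \<omega> < \<infinity>\<close>, an event that contains it.\<close>
  have fin: "prob {\<omega>\<in>space M. pot \<phi> \<omega> \<le> of_nat K} = prob {\<omega>\<in>space M. pot \<phi> \<omega> \<le> of_nat K} * p" for K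
  proof (rule LIMSEQ_unique)
    have lim: "(\<lambda>T. prob (A T)) \<longlonglongrightarrow> prob {\<omega>\<in>space M. pot \<phi> \<omega> \<le> of_nat K}"
      if "range A \<subseteq> events" "decseq A" "(\<Inter>T. A T) = {\<omega>\<in>space M. pot \<phi> \<omega> \<le> of_nat K}" for A :: "nat \<Rightarrow> 'a set"
      using finite_Lim_measure_decseq[OF that(1,2)] that(3) by simp
    have "(\<lambda>T. prob {\<omega>\<in>space M. U T \<omega> \<le> of_nat K}) \<longlonglongrightarrow> prob {\<omega>\<in>space M. pot \<phi> \<omega> \<le> of_nat K}"
    proof (rule lim)
      show "range (\<lambda>T. {\<omega>\<in>space M. U T \<omega> \<le> of_nat K}) \<subseteq> events" using events by auto
      show "decseq (\<lambda>T. {\<omega>\<in>space M. U T \<omega> \<le> of_nat K})"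
        by (auto simp: decseq_Suc_iff intro: order_trans[OF Umono])
      show "(\<Inter>T. {\<omega>\<in>space M. U T \<omega> \<le> of_nat K}) = {\<omega>\<in>space M. pot \<phi> \<omega> \<le> of_nat K}"
        using U_le by blast
    qed
    then show "(\<lambda>T. prob {\<omega>\<in>space M. U T \<omega> \<le> of_nat K} * p) \<longlonglongrightarrow> prob {\<omega>\<in>space M. pot \<phi> \<omega> \<le> of_nat K} * p"
      by (intro tendsto_mult_right)
    have e: "{\<omega>\<in>space M. U T \<omega> \<le> of_nat K \<and> pot \<phi> \<omega> < \<infinity>} = {\<omega>\<in>space M. U T \<omega> \<le> of_nat K} \<inter> {\<omega>\<in>space M. pot \<phi> \<omega> < \<infinity>}" for T by auto
    have "(\<lambda>T. prob {\<omega>\<in>space M. U T \<omega> \<le> of_nat K \<and> pot \<phi> \<omega> < \<infinity>}) \<longlonglongrightarrow> prob {\<omega>\<in>space M. pot \<phi> \<omega> \<le> of_nat K}"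
    proof (rule lim)
      show "range (\<lambda>T. {\<omega>\<in>space M. U T \<omega> \<le> of_nat K \<and> pot \<phi> \<omega> < \<infinity>}) \<subseteq> events"
        unfolding e using events pm by auto
      show "decseq (\<lambda>T. {\<omega>\<in>space M. U T \<omega> \<le> of_nat K \<and> pot \<phi> \<omega> < \<infinity>})"
        by (auto simp: decseq_Suc_iff intro: order_trans[OF Umono])
      show "(\<Inter>T. {\<omega>\<in>space M. U T \<omega> \<le> of_nat K \<and> pot \<phi> \<omega> < \<infinity>}) = {\<omega>\<in>space M. pot \<phi> \<omega> \<le> of_nat K}"
      proof -
        have "pot \<phi> \<omega> < \<infinity>" if "pot \<phi> \<omega> \<le> of_nat K" for \<omega>
          using le_less_trans[OF that of_nat_less_top] by simp
        then show ?thesis using U_le by blast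
      qed
    qed
    then show "(\<lambda>T. prob {\<omega>\<in>space M. U T \<omega> \<le> of_nat K} * p) \<longlonglongrightarrow> prob {\<omega>\<in>space M. pot \<phi> \<omega> \<le> of_nat K}"
      unfolding prod .
  qed
  have "(\<lambda>K. prob {\<omega>\<in>space M. pot \<phi> \<omega> \<le> of_nat K}) \<longlonglongrightarrow> prob (\<Union>K. {\<omega>\<in>space M. pot \<phi> \<omega> \<le> of_nat K})"
  proof (rule finite_Lim_measure_incseq)
    show "incseq (\<lambda>K. {\<omega>\<in>space M. pot \<phi> \<omega> \<le> of_nat K})"
      by (auto simp: incseq_def intro: order_trans[OF _ of_nat_mono])
  qed auto
  also have "(\<Union>K. {\<omega>\<in>space M. pot \<phi> \<omega> \<le> of_nat K}) = {\<omega>\<in>space M. pot \<phi> \<omega> < \<infinity>}"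
  proof safe
    fix K \<omega> assume "pot \<phi> \<omega> \<le> of_nat K"
    then show "pot \<phi> \<omega> < \<infinity>" using le_less_trans[OF _ of_nat_less_top] by simp
  next
    fix \<omega> assume "\<omega> \<in> space M" "pot \<phi> \<omega> < \<infinity>"
    then show "\<omega> \<in> (\<Union>K. {\<omega>\<in>space M. pot \<phi> \<omega> \<le> of_nat K})"
      using ennreal_Ex_less_of_nat[of "pot \<phi> \<omega>"] by (auto intro: less_imp_le)
  qed
  finally have lim: "(\<lambda>K. prob {\<omega>\<in>space M. pot \<phi> \<omega> \<le> of_nat K}) \<longlonglongrightarrow> p" by (simp add: p_def)
  from tendsto_mult_right[OF this, of p] have "(\<lambda>K. prob {\<omega>\<in>space M. pot \<phi> \<omega> \<le> of_nat K}) \<longlonglongrightarrow> p * p"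
    unfolding fin[symmetric] .
  with lim have "p = p * p" by (rule LIMSEQ_unique)
  then show ?thesis unfolding p_def[symmetric] by auto
qed

end

section \<open>Regular versions\<close>

context exponent_measure
begin

text \<open>Frequencies below \<open>d\<close> change each exponential by at most the factor
  \<open>exp (d * \<bar>h\<bar>)\<close>. Used for the zero-one law and for moving the starting
  point.\<close>

lemma lap_shift:
  assumes "AE l in \<nu>. 0 < l \<and> l < d"
  shows "lap \<nu> (z + h) \<le> ennreal (exp (d * \<bar>h\<bar>)) * lap \<nu> z"
proof -
  have "lap \<nu> (z + h) \<le> (\<integral>\<^sup>+l. ennreal (exp (d * \<bar>h\<bar>)) * ennreal (exp (- l * z)) \<partial>\<nu>)"
    unfolding lap_def
  proof (rule nn_integral_mono_AE, use assms in \<open>rule AE_mp\<close>, intro AE_I2 impI)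
    fix l assume l: "0 < l \<and> l < d"
    have "- l * h \<le> l * \<bar>h\<bar>" using l by (simp add: abs_if mult_nonneg_nonneg)
    also have "\<dots> \<le> d * \<bar>h\<bar>" using l by (intro mult_right_mono) auto
    finally have "exp (- l * (z + h)) \<le> exp (d * \<bar>h\<bar>) * exp (- l * z)"
      by (simp add: exp_add[symmetric] algebra_simps)
    then show "ennreal (exp (- l * (z + h))) \<le> ennreal (exp (d * \<bar>h\<bar>)) * ennreal (exp (- l * z))"
      by (simp add: ennreal_mult[symmetric])
  qed
  then show ?thesis by (simp add: lap_def nn_integral_cmult)
qed

text \<open>\<open>psi\<close> is negative on \<open>(0, Phi)\<close>, so
  \<open>exp (- l * X s)\<close> has expectation at most 1 and the functional has expectation at
  most \<open>T\<close> times the mass of \<open>\<nu>\<close>.\<close>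

lemma AE_functional_lap_finite:
  assumes "AE l in \<nu>. 0 < l \<and> l < Phi"
  shows "AE \<omega> in M. (\<integral>\<^sup>+s. lap \<nu> (X (max 0 s) \<omega>) * indicator {0..<real T} s \<partial>lborel) < \<infinity>"
proof -
  interpret P: pair_sigma_finite lborel M ..
  interpret Q: pair_sigma_finite \<nu> M ..
  have E: "(\<integral>\<^sup>+\<omega>. lap \<nu> (X (max 0 s) \<omega>) \<partial>M) \<le> emeasure \<nu> (space \<nu>)" for s
  proof -
    have "(\<integral>\<^sup>+\<omega>. lap \<nu> (X (max 0 s) \<omega>) \<partial>M) = (\<integral>\<^sup>+l. \<integral>\<^sup>+\<omega>. ennreal (exp (- l * X (max 0 s) \<omega>)) \<partial>M \<partial>\<nu>)"
      unfolding lap_def by (rule Q.Fubini') measurable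
    also have "\<dots> \<le> (\<integral>\<^sup>+l. 1 \<partial>\<nu>)"
    proof (rule nn_integral_mono_AE, use assms in \<open>rule AE_mp\<close>, intro AE_I2 impI)
      fix l assume l: "0 < l \<and> l < Phi"
      then have "psi l * max 0 s \<le> 0" using psi_neg[of l] by (intro mult_nonpos_nonneg) auto
      then show "(\<integral>\<^sup>+\<omega>. ennreal (exp (- l * X (max 0 s) \<omega>)) \<partial>M) \<le> 1"
        using nn_laplace_X[of l "max 0 s"] l by simp
    qed
    finally show ?thesis by simp
  qed
  have "(\<integral>\<^sup>+\<omega>. \<integral>\<^sup>+s. lap \<nu> (X (max 0 s) \<omega>) * indicator {0..<real T} s \<partial>lborel \<partial>M) =
      (\<integral>\<^sup>+s. \<integral>\<^sup>+\<omega>. lap \<nu> (X (max 0 s) \<omega>) * indicator {0..<real T} s \<partial>M \<partial>lborel)"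
    by (rule P.Fubini') measurable
  also have "\<dots> \<le> (\<integral>\<^sup>+s. emeasure \<nu> (space \<nu>) * indicator {0..<real T} s \<partial>lborel)"
    by (intro nn_integral_mono, subst nn_integral_multc, measurable) (intro mult_right_mono E, simp)
  also have "\<dots> < \<infinity>"
    by (simp add: nn_integral_cmult_indicator ennreal_mult_less_top nu.emeasure_eq_measure)
  finally have fin: "(\<integral>\<^sup>+\<omega>. \<integral>\<^sup>+s. lap \<nu> (X (max 0 s) \<omega>) * indicator {0..<real T} s \<partial>lborel \<partial>M) < \<infinity>" .
  have "AE \<omega> in M. (\<integral>\<^sup>+s. lap \<nu> (X (max 0 s) \<omega>) * indicator {0..<real T} s \<partial>lborel) \<noteq> \<infinity>"
    by (rule nn_integral_noteq_infinite[OF _ less_imp_neq[OF fin]]) measurable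
  then show ?thesis by (auto simp: less_top)
qed

lemma AE_pot_lap_top:
  assumes ae: "AE l in \<nu>. 0 < l \<and> l < Phi / 3" and inf: "(\<integral>\<^sup>+l. ennreal (1 / - psi l) \<partial>\<nu>) = \<infinity>"
  shows "AE \<omega> in M. pot (lap \<nu>) \<omega> = \<infinity>"
proof -
  have ae': "AE l in \<nu>. 0 < l \<and> l < Phi"
    using ae by (rule AE_mp) (use Phi_pos in \<open>auto intro!: AE_I2\<close>)
  have zo: "prob {\<omega>\<in>space M. pot (lap \<nu>) \<omega> < \<infinity>} \<in> {0, 1}"
    by (intro pot_zero_one[where d=Phi] measurable_lap lap_shift ae' AE_functional_lap_finite)
  have "{\<omega>\<in>space M. pot (lap \<nu>) \<omega> < \<infinity>} = space M - {\<omega>\<in>space M. pot (lap \<nu>) \<omega> = \<infinity>}"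
    by (auto simp: less_top)
  then have "prob {\<omega>\<in>space M. pot (lap \<nu>) \<omega> < \<infinity>} = 1 - prob {\<omega>\<in>space M. pot (lap \<nu>) \<omega> = \<infinity>}"
    by (simp add: prob_compl)
  with zo prob_pot_lap_top[OF assms] have "prob {\<omega>\<in>space M. pot (lap \<nu>) \<omega> = \<infinity>} = 1" by auto
  then show ?thesis by (subst (asm) prob_Collect_eq_1) auto
qed

end

section \<open>Null-set modifications and growth of the Laplace exponent\<close>

lemma (in prob_space) indep_vars_cong_AE:
  assumes indep: "indep_vars M' X I" and ae: "\<And>i. i \<in> I \<Longrightarrow> AE \<omega> in M. X i \<omega> = Y i \<omega>"
    and Y: "\<And>i. i \<in> I \<Longrightarrow> random_variable (M' i) (Y i)"
  shows "indep_vars M' Y I"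
  unfolding indep_vars_def2
proof (intro conjI ballI Y indep_setsI)
  have X: "random_variable (M' i) (X i)" if "i \<in> I" for i
    using indep that by (auto simp: indep_vars_def2)
  fix i assume "i \<in> I"
  then show "{Y i -` A \<inter> space M |A. A \<in> sets (M' i)} \<subseteq> events"
    using Y by (auto intro: measurable_sets)
next
  have X: "random_variable (M' i) (X i)" if "i \<in> I" for i
    using indep that by (auto simp: indep_vars_def2)
  fix A J assume J: "J \<noteq> {}" "J \<subseteq> I" "finite J" and A: "\<forall>j\<in>J. A j \<in> {Y j -` A \<inter> space M |A. A \<in> sets (M' j)}"
  from A obtain B where B: "\<And>j. j \<in> J \<Longrightarrow> B j \<in> sets (M' j)" "\<And>j. j \<in> J \<Longrightarrow> A j = Y j -` B j \<inter> space M"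
    by (auto simp: bchoice_iff dest!: bchoice)
  have mX: "X j -` B j \<inter> space M \<in> events" if "j \<in> J" for j using X B that J by (auto intro: measurable_sets)
  have mY: "Y j -` B j \<inter> space M \<in> events" if "j \<in> J" for j using Y B that J by (auto intro: measurable_sets)
  have one: "prob (Y j -` B j \<inter> space M) = prob (X j -` B j \<inter> space M)" if "j \<in> J" for j
  proof (intro finite_measure_eq_AE mX mY that)
    have "AE \<omega> in M. X j \<omega> = Y j \<omega>" using ae that J(2) by blast
    then show "AE \<omega> in M. \<omega> \<in> Y j -` B j \<inter> space M \<longleftrightarrow> \<omega> \<in> X j -` B j \<inter> space M"
      by eventually_elim auto
  qed
  have aeJ: "AE \<omega> in M. \<forall>j\<in>J. X j \<omega> = Y j \<omega>"
    using J ae by (intro AE_finite_allI) auto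
  have "prob (\<Inter>j\<in>J. A j) = prob (\<Inter>j\<in>J. Y j -` B j \<inter> space M)" using B by (auto intro!: arg_cong[where f=prob])
  also have "\<dots> = prob (\<Inter>j\<in>J. X j -` B j \<inter> space M)"
  proof (intro finite_measure_eq_AE sets.finite_INT mX mY J)
    show "AE \<omega> in M. \<omega> \<in> (\<Inter>j\<in>J. Y j -` B j \<inter> space M) \<longleftrightarrow> \<omega> \<in> (\<Inter>j\<in>J. X j -` B j \<inter> space M)"
      using aeJ by eventually_elim auto
  qed
  also have "\<dots> = (\<Prod>j\<in>J. prob (X j -` B j \<inter> space M))"
    using J B by (intro indep_varsD[OF indep]) auto
  also have "\<dots> = (\<Prod>j\<in>J. prob (A j))" using B one by (intro prod.cong) auto
  finally show "prob (\<Inter>j\<in>J. A j) = (\<Prod>j\<in>J. prob (A j))" .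
qed

lemma exp_minus_quadratic_bound:
  fixes x :: real
  assumes "0 \<le> x"
  shows "exp (- x) - 1 + x \<le> x\<^sup>2"
proof -
  have "exp (- x) \<le> 1 / (1 + x)"
    using exp_ge_add_one_self[of x] assms by (simp add: exp_minus inverse_eq_divide frac_le)
  moreover have "1 / (1 + x) - 1 + x = x\<^sup>2 / (1 + x)" using assms by (simp add: field_simps power2_eq_square)
  moreover have "x\<^sup>2 / (1 + x) \<le> x\<^sup>2 / 1" using assms by (intro divide_left_mono) auto
  ultimately show ?thesis by simp
qed

text \<open>For \<open>u \<le> 1\<close> the integrand is at most \<open>(l * u)\<^sup>2\<close>;
  for larger \<open>u\<close> it is at most 0. The condition \<open>1 \<le> l\<close> lets the
  square absorb the linear term.\<close>

lemma laplace_exponent_quadratic_bound: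
  assumes "0 \<le> c" "levy_measure \<pi>"
  obtains C where "\<And>l. 1 \<le> l \<Longrightarrow> laplace_exponent b c \<pi> l \<le> C * l\<^sup>2"
proof -
  have sets: "sets \<pi> = sets (restrict_space borel {0<..})" and fin: "(\<integral>\<^sup>+z. ennreal (min 1 (z\<^sup>2)) \<partial>\<pi>) < \<infinity>"
    using assms(2) by (auto simp: levy_measure_def)
  have space: "space \<pi> = {0<..}" using sets_eq_imp_space_eq[OF sets] by (simp add: space_restrict_space)
  have "(\<lambda>z::real. min 1 (z\<^sup>2)) \<in> borel_measurable \<pi>"
    unfolding measurable_cong_sets[OF sets refl] by (intro measurable_restrict_space1) measurable
  then have int: "integrable \<pi> (\<lambda>z. min 1 (z\<^sup>2))"
    using fin by (intro integrableI_nonneg) auto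
  define K where "K = (\<integral>z. min 1 (z\<^sup>2) \<partial>\<pi>)"
  have K: "0 \<le> K" unfolding K_def by (intro Bochner_Integration.integral_nonneg) auto
  have "laplace_exponent b c \<pi> l \<le> (\<bar>b\<bar> + c + K) * l\<^sup>2" if l: "1 \<le> l" for l
  proof -
    let ?f = "\<lambda>u. exp (- l * u) - 1 + l * u * indicator {0<..1} u"
    have "(\<integral>u. ?f u \<partial>\<pi>) \<le> l\<^sup>2 * K"
    proof (cases "integrable \<pi> ?f")
      case True
      have "(\<integral>u. ?f u \<partial>\<pi>) \<le> (\<integral>u. l\<^sup>2 * min 1 (u\<^sup>2) \<partial>\<pi>)"
      proof (rule integral_mono[OF True])
        show "integrable \<pi> (\<lambda>u. l\<^sup>2 * min 1 (u\<^sup>2))" using int by simp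
        fix u assume "u \<in> space \<pi>"
        then have u: "0 < u" by (simp add: space)
        show "?f u \<le> l\<^sup>2 * min 1 (u\<^sup>2)"
        proof (cases "u \<le> 1")
          case True
          then have "u\<^sup>2 \<le> 1" using u by (simp add: power_le_one)
          then show ?thesis
            using exp_minus_quadratic_bound[of "l * u"] True u l by (simp add: min_def power_mult_distrib)
        next
          case False
          then have "?f u \<le> 0" using l u by (simp add: mult_nonneg_nonneg)
          also have "0 \<le> l\<^sup>2 * min 1 (u\<^sup>2)" by simp
          finally show ?thesis .
        qed
      qed
      then show ?thesis by (simp add: K_def)
    next
      \<comment> \<open>A function that is not integrable has Bochner integral 0, which lies below
        \<open>l\<^sup>2 * K\<close>.\<close>
      case False
      then show ?thesis using K by (simp add: not_integrable_integral_eq)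
    qed
    moreover have "b * l \<le> \<bar>b\<bar> * l\<^sup>2"
    proof -
      have "b * l \<le> \<bar>b\<bar> * l" using l by (intro mult_right_mono) auto
      also have "\<dots> \<le> \<bar>b\<bar> * l\<^sup>2" using l by (intro mult_left_mono) (auto simp: power2_eq_square)
      finally show ?thesis .
    qed
    ultimately show ?thesis by (simp add: laplace_exponent_def algebra_simps)
  qed
  then show ?thesis by (rule that)
qed

text \<open>Stationarity transfers the sign of \<open>X t\<close> to every increment; the countably
  many dyadic increments are nonnegative off one null set, and right continuity extends monotonicity
  to all times.\<close>

lemma (in levy_process) subordinator_if_nonneg:
  assumes "\<And>t. 0 \<le> t \<Longrightarrow> AE \<omega> in M. 0 \<le> X t \<omega>"
  shows "subordinator M X"
proof -
  have inc: "AE \<omega> in M. X s \<omega> \<le> X (s + t) \<omega>" if st: "0 \<le> s" "0 \<le> t" for s t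
  proof -
    have [measurable]: "X t \<in> borel_measurable M" "X s \<in> borel_measurable M" "X (s + t) \<in> borel_measurable M"
      using st by (auto intro: random_variable_X)
    have "AE x in distr M borel (X t). 0 \<le> x" using assms[OF st(2)] by (subst AE_distr_iff) auto
    then have "AE x in distr M borel (\<lambda>\<omega>. X (s + t) \<omega> - X s \<omega>). 0 \<le> x"
      unfolding stationary_increments[OF st] .
    then show ?thesis by (subst (asm) AE_distr_iff) auto
  qed
  have "AE \<omega> in M. \<forall>n j k. X (real j / 2 ^ n) \<omega> \<le> X (real j / 2 ^ n + real k / 2 ^ n) \<omega>"
    unfolding AE_all_countable by (intro allI inc) auto
  with cadlag_paths have "AE \<omega> in M. mono_on {0..} (\<lambda>t. X t \<omega>)"
  proof (eventually_elim, intro mono_onI)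
    fix \<omega> and r s :: real assume \<omega>: "cadlag (\<lambda>t. X t \<omega>)" "\<forall>n j k. X (real j / 2 ^ n) \<omega> \<le> X (real j / 2 ^ n + real k / 2 ^ n) \<omega>"
      and rs: "r \<in> {0..}" "s \<in> {0..}" "r \<le> s"
    have lim: "(\<lambda>n. X (dyad n u) \<omega>) \<longlonglongrightarrow> X u \<omega>" if "0 \<le> u" for u
      using right_continuous_dyad_limit[of u "\<lambda>t. X t \<omega>"] \<omega>(1) that by (auto simp: cadlag_def)
    show "X r \<omega> \<le> X s \<omega>"
    proof (rule LIMSEQ_le[OF lim lim])
      have "X (dyad n r) \<omega> \<le> X (dyad n s) \<omega>" for n
      proof -
        define i j where "i = Suc (nat \<lfloor>2 ^ n * r\<rfloor>)" and "j = Suc (nat \<lfloor>2 ^ n * s\<rfloor>)"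
        have "i \<le> j" unfolding i_def j_def using rs by (auto intro!: nat_mono floor_mono mult_left_mono)
        then have "real i / 2 ^ n + real (j - i) / 2 ^ n = real j / 2 ^ n" by (simp add: add_divide_distrib[symmetric])
        then show ?thesis using \<omega>(2)[rule_format, of i n "j - i"] by (simp add: dyad_def i_def j_def)
      qed
      then show "\<exists>N. \<forall>n\<ge>N. X (dyad n r) \<omega> \<le> X (dyad n s) \<omega>" by auto
    qed (use rs in auto)
  qed
  then show ?thesis unfolding subordinator_def using levy_process_axioms by auto
qed

section \<open>Sign and zeros of the Laplace exponent\<close>

context spectrally_positive_levy_process
begin

abbreviation "Psi \<equiv> laplace_exponent b c \<pi>"

lemma Psi_0: "Psi 0 = 0" by (simp add: laplace_exponent_def)

lemma Psi_convex: "convex_on {0..} Psi"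
  using log_laplace_convex[of "X 1" Psi] laplace_transform[of _ 1] by simp

text \<open>Chernoff bound: the probability of \<open>X t < - e\<close> is at most
  \<open>exp (- n * e)\<close> for every positive \<open>n\<close>, because \<open>Psi\<close> stays
  nonpositive. This makes \<open>Phi0\<close> finite for a process that is not a
  subordinator.\<close>

lemma subordinator_if_Psi_nonpos:
  assumes "\<And>l. 0 < l \<Longrightarrow> Psi l \<le> 0"
  shows "subordinator M X"
proof (rule subordinator_if_nonneg)
  fix t :: real assume t: "0 \<le> t"
  have [measurable]: "X t \<in> borel_measurable M" using t by (rule random_variable_X)
  have zero: "prob {\<omega>\<in>space M. X t \<omega> < - e} = 0" if e: "0 < e" for e
  proof -
    have "prob {\<omega>\<in>space M. X t \<omega> < - e} \<le> exp (- real n * e)" if n: "0 < n" for n :: nat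
    proof -
      have hb: "has_bochner_integral M (\<lambda>\<omega>. exp (- real n * X t \<omega>)) (exp (Psi (real n) * t))"
        using t by (intro laplace_transform) auto
      have i: "integrable M (indicator {\<omega>\<in>space M. X t \<omega> < - e} :: 'a \<Rightarrow> real)"
        by (intro integrable_real_indicator) (auto simp: emeasure_eq_measure)
      have "(\<integral>\<omega>. exp (real n * e) * indicator {\<omega>\<in>space M. X t \<omega> < - e} \<omega> \<partial>M) \<le> (\<integral>\<omega>. exp (- real n * X t \<omega>) \<partial>M)"
      proof (rule integral_mono)
        fix \<omega> assume "\<omega> \<in> space M"
        show "exp (real n * e) * indicator {\<omega>\<in>space M. X t \<omega> < - e} \<omega> \<le> exp (- real n * X t \<omega>)"
        proof (cases "X t \<omega> < - e")
          case True
          then have "real n * e \<le> real n * (- X t \<omega>)" by (intro mult_left_mono) auto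
          then show ?thesis using True by (simp add: indicator_def)
        qed (simp add: indicator_def)
      qed (use hb i in \<open>auto simp: has_bochner_integral_iff\<close>)
      also have "\<dots> = exp (Psi (real n) * t)" using hb by (simp add: has_bochner_integral_iff)
      also have "\<dots> \<le> 1" using assms[of "real n"] n t by (simp add: mult_nonpos_nonneg)
      finally have "exp (real n * e) * prob {\<omega>\<in>space M. X t \<omega> < - e} \<le> 1" by simp
      then show ?thesis by (simp add: exp_minus field_simps)
    qed
    moreover have "(\<lambda>n. exp (- real n * e)) \<longlonglongrightarrow> 0" using e by real_asymp
    ultimately have "prob {\<omega>\<in>space M. X t \<omega> < - e} \<le> 0"
      by (intro LIMSEQ_le_const[of "\<lambda>n. exp (- real n * e)"]) (auto intro!: exI[of _ 1])
    then show ?thesis by (simp add: measure_le_0_iff)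
  qed
  have "AE \<omega> in M. \<forall>n. \<not> X t \<omega> < - (1 / real (Suc n))"
    unfolding AE_all_countable
  proof
    fix n
    have "prob {\<omega>\<in>space M. X t \<omega> < - (1 / real (Suc n))} = 0" by (rule zero) simp
    then show "AE \<omega> in M. \<not> X t \<omega> < - (1 / real (Suc n))"
      by (subst (asm) prob_Collect_eq_0) auto
  qed
  then show "AE \<omega> in M. 0 \<le> X t \<omega>"
  proof eventually_elim
    fix \<omega> assume *: "\<forall>n. \<not> X t \<omega> < - (1 / real (Suc n))"
    show "0 \<le> X t \<omega>"
    proof (rule ccontr)
      assume "\<not> 0 \<le> X t \<omega>"
      then obtain n where "inverse (real (Suc n)) < - X t \<omega>" using reals_Archimedean[of "- X t \<omega>"] by auto
      with * show False by (auto simp: inverse_eq_divide not_less dest: spec[of _ n])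
    qed
  qed
qed

text \<open>\<open>exp (- l * X t)\<close> has first and second moment 1, hence variance 0, so
  \<open>X t = 0\<close> almost surely.\<close>

lemma subordinator_if_Psi_zero:
  assumes "0 < l" "Psi (2 * l) = 0" "Psi l = 0"
  shows "subordinator M X"
proof (rule subordinator_if_nonneg)
  fix t :: real assume t: "0 \<le> t"
  have [measurable]: "X t \<in> borel_measurable M" using t by (rule random_variable_X)
  have 1: "has_bochner_integral M (\<lambda>\<omega>. exp (- (2 * l) * X t \<omega>)) 1"
    using laplace_transform[of "2 * l" t] assms t by simp
  have 2: "has_bochner_integral M (\<lambda>\<omega>. exp (- l * X t \<omega>)) 1"
    using laplace_transform[of l t] assms t by simp
  have 3: "has_bochner_integral M (\<lambda>\<omega>. 1 :: real) 1"
    by (simp add: has_bochner_integral_iff prob_space)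
  have "has_bochner_integral M (\<lambda>\<omega>. exp (- (2 * l) * X t \<omega>) - 2 * exp (- l * X t \<omega>) + 1) (1 - 2 * 1 + 1)"
    by (intro has_bochner_integral_add has_bochner_integral_diff has_bochner_integral_mult_right 1 2 3)
  moreover have "exp (- (2 * l) * X t \<omega>) - 2 * exp (- l * X t \<omega>) + 1 = (exp (- l * X t \<omega>) - 1)\<^sup>2" for \<omega>
    by (simp add: power2_eq_square exp_add[symmetric] algebra_simps)
  ultimately have "has_bochner_integral M (\<lambda>\<omega>. (exp (- l * X t \<omega>) - 1)\<^sup>2) 0" by simp
  then have "AE \<omega> in M. (exp (- l * X t \<omega>) - 1)\<^sup>2 = 0"
    by (subst integral_nonneg_eq_0_iff_AE[symmetric]) (auto simp: has_bochner_integral_iff)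
  then show "AE \<omega> in M. 0 \<le> X t \<omega>"
    by eventually_elim (use assms in auto)
qed

lemma Psi_measurable: "(\<lambda>l. if 0 < l then Psi l else 0) \<in> borel_measurable borel"
proof -
  have "convex_on {0<..} Psi" using Psi_convex by (rule convex_on_subset) auto
  then have "continuous_on {0<..} Psi" by (intro convex_on_continuous) auto
  then have "Psi \<in> borel_measurable (restrict_space borel {0<..})"
    by (rule borel_measurable_continuous_on_restrict)
  then have "(\<lambda>l. indicator {0<..} l *\<^sub>R Psi l) \<in> borel_measurable borel"
    by (subst (asm) borel_measurable_restrict_space_iff) auto
  moreover have "(\<lambda>l. indicator {0<..} l *\<^sub>R Psi l) = (\<lambda>l. if 0 < l then Psi l else 0)" by auto
  ultimately show ?thesis by simp
qed

text \<open>Below the infimum \<open>Psi \<le> 0\<close> is immediate. For strictness, a zero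
  \<open>l\<close> lies between \<open>l / 2\<close> and some \<open>m < Phi\<close>, where
  \<open>Psi\<close> is nonpositive, so convexity forces \<open>Psi (l / 2) = 0\<close>; two zeros
  in ratio 2 make the process degenerate.\<close>

lemma Phi0_real:
  assumes "\<not> subordinator M X" "0 < Phi0 b c \<pi>"
  obtains Phi where "Phi0 b c \<pi> = ereal Phi" "0 < Phi" "\<And>l. 0 < l \<Longrightarrow> l < Phi \<Longrightarrow> Psi l < 0"
    "\<And>e. 0 < e \<Longrightarrow> \<exists>l\<ge>Phi. l < Phi + e \<and> 0 < Psi l"
proof -
  let ?S = "{l. 0 < l \<and> 0 < Psi l}"
  have "\<exists>l>0. \<not> Psi l \<le> 0" using subordinator_if_Psi_nonpos assms(1) by blast
  then obtain l0 where l0: "l0 \<in> ?S" by (auto simp: not_le)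
  then have "Phi0 b c \<pi> \<le> ereal l0" unfolding Phi0_def by (intro Inf_lower) auto
  with assms(2) obtain Phi where Phi: "Phi0 b c \<pi> = ereal Phi" "0 < Phi"
    by (cases "Phi0 b c \<pi>") auto
  have low: "Phi \<le> l" if "l \<in> ?S" for l
  proof -
    have "Phi0 b c \<pi> \<le> ereal l" unfolding Phi0_def using that by (intro Inf_lower) auto
    then show ?thesis using Phi by simp
  qed
  have nonpos: "Psi l \<le> 0" if "0 < l" "l < Phi" for l using low[of l] that by (auto simp: not_le[symmetric])
  have "Psi l < 0" if l: "0 < l" "l < Phi" for l
  proof (rule ccontr)
    assume "\<not> Psi l < 0"
    with nonpos[OF l] have z: "Psi l = 0" by simp
    obtain m where m: "l < m" "m < Phi" using dense[OF l(2)] by blast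
    \<comment> \<open>The weight that writes \<open>l\<close> as a convex combination of
      \<open>m\<close> and \<open>l / 2\<close>.\<close>
    define t where "t = (m - l) / (m - l / 2)"
    have t: "0 < t" "t < 1" using m l by (auto simp: t_def field_simps)
    have "t * (m - l / 2) = m - l" using m l by (simp add: t_def)
    then have eq: "(1 - t) *\<^sub>R m + t *\<^sub>R (l / 2) = l" by (simp add: algebra_simps)
    have "Psi ((1 - t) *\<^sub>R m + t *\<^sub>R (l / 2)) \<le> (1 - t) * Psi m + t * Psi (l / 2)"
      using t m l by (intro convex_onD[OF Psi_convex]) auto
    then have "0 \<le> (1 - t) * Psi m + t * Psi (l / 2)" using eq z by simp
    moreover have "(1 - t) * Psi m \<le> 0" using nonpos[of m] m l t by (intro mult_nonneg_nonpos) auto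
    ultimately have "0 \<le> t * Psi (l / 2)" by simp
    then have "0 \<le> Psi (l / 2)" using t by (simp add: zero_le_mult_iff)
    with nonpos[of "l / 2"] l have "Psi (l / 2) = 0" by simp
    then have "subordinator M X" using subordinator_if_Psi_zero[of "l / 2"] z l by simp
    with assms(1) show False by simp
  qed
  moreover have "\<exists>l\<ge>Phi. l < Phi + e \<and> 0 < Psi l" if "0 < e" for e
  proof -
    have "Phi0 b c \<pi> < ereal (Phi + e)" using Phi that by simp
    then obtain l where "l \<in> ?S" "l < Phi + e" unfolding Phi0_def by (auto simp: Inf_less_iff)
    with low[of l] show ?thesis by auto
  qed
  ultimately show ?thesis using Phi that by blast
qed

text \<open>
  For \<open>l < 0\<close> the integral defining \<open>Psi l\<close> need not exist, so \<open>Psi\<close> is replaced by 0 there in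
  order to have a Borel function.
\<close>

lemma regular_version:
  assumes "\<not> subordinator M X" "0 < Phi0 b c \<pi>"
  obtains Y Phi C where "regular_levy M Y (\<lambda>l. if 0 < l then Psi l else 0) Phi C"
    "Phi0 b c \<pi> = ereal Phi" "AE \<omega> in M. \<forall>t. Y t \<omega> = X t \<omega>"
    "\<And>\<omega>. cadlag (\<lambda>t. Y t \<omega>)" "\<And>\<omega>. no_negative_jumps (\<lambda>t. Y t \<omega>)"
proof -
  let ?psi = "\<lambda>l. if 0 < l then Psi l else 0"
  obtain Phi where Phi: "Phi0 b c \<pi> = ereal Phi" "0 < Phi" "\<And>l. 0 < l \<Longrightarrow> l < Phi \<Longrightarrow> Psi l < 0"
    "\<And>e. 0 < e \<Longrightarrow> \<exists>l\<ge>Phi. l < Phi + e \<and> 0 < Psi l"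
    using Phi0_real[OF assms] by blast
  obtain C where C: "\<And>l. 1 \<le> l \<Longrightarrow> Psi l \<le> C * l\<^sup>2"
    using laplace_exponent_quadratic_bound[OF c_nonneg levy_measure] by blast
  have "AE \<omega> in M. X 0 \<omega> = 0 \<and> cadlag (\<lambda>t. X t \<omega>) \<and> no_negative_jumps (\<lambda>t. X t \<omega>)"
    using X_0 cadlag_paths no_negative_jumps by eventually_elim auto
  from AE_E[OF this] obtain N where N: "{\<omega>\<in>space M. \<not> (X 0 \<omega> = 0 \<and> cadlag (\<lambda>t. X t \<omega>) \<and> no_negative_jumps (\<lambda>t. X t \<omega>))} \<subseteq> N" "N \<in> null_sets M"
    by (metis (no_types, lifting) null_setsI)
  define G where "G = space M - N"
  have G: "G \<in> events" using N by (auto simp: G_def)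
  have good: "X 0 \<omega> = 0" "cadlag (\<lambda>t. X t \<omega>)" "no_negative_jumps (\<lambda>t. X t \<omega>)" if "\<omega> \<in> G" for \<omega>
    using N that by (auto simp: G_def)
  \<comment> \<open>On the exceptional null set the path is replaced by the zero path, which is
    cadlag, starts at 0 and has no jumps.\<close>
  define Y where "Y t \<omega> = (if \<omega> \<in> G then X t \<omega> else 0)" for t \<omega>
  have mY: "Y t \<in> borel_measurable M" if "0 \<le> t" for t
    unfolding Y_def using that G random_variable_X[OF that] by measurable
  have "AE \<omega> in M. \<omega> \<in> G" using N(2) by (auto simp: G_def dest: AE_not_in)
  then have ae: "AE \<omega> in M. \<forall>t. Y t \<omega> = X t \<omega>" by eventually_elim (auto simp: Y_def)
  have cad: "cadlag (\<lambda>t. Y t \<omega>)" for \<omega>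
    using good[of \<omega>] by (cases "\<omega> \<in> G") (auto simp: Y_def cadlag_def)
  have jumps: "no_negative_jumps (\<lambda>t. Y t \<omega>)" for \<omega>
  proof (cases "\<omega> \<in> G")
    case False
    have "l \<le> 0" if "((\<lambda>_. 0 :: real) \<longlongrightarrow> l) (at_left t)" for l t :: real
      using tendsto_unique[OF _ that tendsto_const] by simp
    with False show ?thesis by (auto simp: Y_def no_negative_jumps_def)
  qed (use good in \<open>simp add: Y_def\<close>)
  have "regular_levy M Y ?psi Phi C"
  proof (intro regular_levy.intro regular_levy_axioms.intro prob_space_axioms)
    show "Y 0 \<omega> = 0" for \<omega> using good by (simp add: Y_def)
    show "continuous (at_right t) (\<lambda>t. Y t \<omega>)" if "0 \<le> t" for t \<omega> using cad[of \<omega>] that by (simp add: cadlag_def)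
    show "Y t \<in> borel_measurable M" if "0 \<le> t" for t using mY[OF that] .
    show "0 < Phi" by fact
    show "?psi l < 0" if "0 < l" "l < Phi" for l using Phi(3)[OF that] that by simp
    show "\<exists>l\<ge>Phi. l < Phi + e \<and> 0 < ?psi l" if "0 < e" for e using Phi(4)[OF that] Phi(2) by force
    show "?psi l \<le> C * l\<^sup>2" if "1 \<le> l" for l using C[OF that] that by simp
    show "?psi \<in> borel_measurable borel" by (rule Psi_measurable)
  next
    fix n :: nat and t :: "nat \<Rightarrow> real"
    assume t: "0 \<le> t 0" "\<And>i. i < n \<Longrightarrow> t i \<le> t (Suc i)"
    have nonneg: "i \<le> n \<Longrightarrow> 0 \<le> t i" for i
      by (induction i) (use t in \<open>auto intro: order_trans\<close>)
    show "indep_vars (\<lambda>_. borel) (\<lambda>i \<omega>. Y (t (Suc i)) \<omega> - Y (t i) \<omega>) {..<n}"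
    proof (rule indep_vars_cong_AE[OF independent_increments[OF t]])
      fix i assume "i \<in> {..<n}"
      then show "random_variable borel (\<lambda>\<omega>. Y (t (Suc i)) \<omega> - Y (t i) \<omega>)"
        by (intro borel_measurable_diff mY nonneg) auto
      show "AE \<omega> in M. X (t (Suc i)) \<omega> - X (t i) \<omega> = Y (t (Suc i)) \<omega> - Y (t i) \<omega>"
        using ae by eventually_elim simp
    qed
  next
    fix l s t :: real assume l: "0 \<le> l" and st: "0 \<le> s" "0 \<le> t"
    have [measurable]: "X t \<in> borel_measurable M" "X s \<in> borel_measurable M" "X (s + t) \<in> borel_measurable M"
      "Y s \<in> borel_measurable M" "Y (s + t) \<in> borel_measurable M"
      using st by (auto intro: random_variable_X mY)
    have psi: "?psi l = Psi l" using l Psi_0 by auto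
    have "has_bochner_integral M (\<lambda>\<omega>. exp (- l * X t \<omega>)) (exp (Psi l * t))"
      using l st by (intro laplace_transform)
    then have "has_bochner_integral (distr M borel (X t)) (\<lambda>x. exp (- l * x)) (exp (Psi l * t))"
      by (subst has_bochner_integral_iff, subst integrable_distr_eq, simp, simp, subst integral_distr) (auto simp: has_bochner_integral_iff)
    then have "has_bochner_integral (distr M borel (\<lambda>\<omega>. X (s + t) \<omega> - X s \<omega>)) (\<lambda>x. exp (- l * x)) (exp (Psi l * t))"
      using stationary_increments[OF st] by simp
    then have "has_bochner_integral M (\<lambda>\<omega>. exp (- l * (X (s + t) \<omega> - X s \<omega>))) (exp (Psi l * t))"
      by (subst (asm) has_bochner_integral_iff, subst (asm) integrable_distr_eq, simp, simp, subst (asm) integral_distr) (auto simp: has_bochner_integral_iff)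
    then show "has_bochner_integral M (\<lambda>\<omega>. exp (- l * (Y (s + t) \<omega> - Y s \<omega>))) (exp (?psi l * t))"
      unfolding psi by (rule has_bochner_integral_cong_AE[THEN iffD1, rotated 3]) (measurable, use ae in \<open>eventually_elim, simp\<close>)
  qed
  with that Phi(1) ae cad jumps show ?thesis by blast
qed

end

section \<open>Laplace transforms as integrands\<close>

lemma zeta_infinityI: "(\<And>t. 0 \<le> t \<Longrightarrow> 0 < z t) \<Longrightarrow> zeta z = \<infinity>"
proof -
  assume *: "\<And>t. 0 \<le> t \<Longrightarrow> 0 < z t"
  have "z t \<noteq> 0" if "0 < t" for t using *[of t] that by simp
  then have "{t. t > 0 \<and> z t = 0} = {}" by auto
  then have "zeta z = Inf (ereal ` {})" unfolding zeta_def by (simp only:)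
  then show ?thesis by (simp add: top_ereal_def)
qed

lemma tau_minus_infinityI: "(\<And>t. 0 \<le> t \<Longrightarrow> y < z t) \<Longrightarrow> tau_minus y z = \<infinity>"
proof -
  assume *: "\<And>t. 0 \<le> t \<Longrightarrow> y < z t"
  have "\<not> z t \<le> y" if "0 \<le> t" for t using *[OF that] by simp
  then have "{t. t \<ge> 0 \<and> z t \<le> y} = {}" by auto
  then have "tau_minus y z = Inf (ereal ` {})" unfolding tau_minus_def by (simp only:)
  then show ?thesis by (simp add: top_ereal_def)
qed

locale laplace_functional = regular_levy M X psi Phi C
  for M :: "'a measure" and X psi Phi C +
  fixes f g :: "real \<Rightarrow> real"
  assumes cadlag_X: "\<And>\<omega>. cadlag (\<lambda>t. X t \<omega>)"
    and no_negative_jumps_X: "\<And>\<omega>. no_negative_jumps (\<lambda>t. X t \<omega>)"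
    and g_measurable: "g \<in> borel_measurable (restrict_space borel {0<..})"
    and g_nonneg: "\<And>z. z > 0 \<Longrightarrow> g z \<ge> 0"
    and g_integrable: "\<And>x. x > 0 \<Longrightarrow> set_integrable lborel {0<..} (\<lambda>z. exp (- x * z) * g z)"
    and f_eq: "\<And>x. x > 0 \<Longrightarrow> f x = (LINT z:{0<..}|lborel. exp (- x * z) * g z)"
begin

text \<open>Dyadic values are strictly above \<open>- y\<close>, but the limit from the right
  retains only the weak inequality. Strict bounds come from a level with a gap, as in
  \<open>not_reach_pos\<close>.\<close>

lemma not_reach_lower:
  assumes "\<omega> \<in> space M" "\<omega> \<notin> reach y" "0 \<le> t"
  shows "- y \<le> X t \<omega>"
proof (rule LIMSEQ_le_const[OF right_continuous_dyad_limit[OF right_continuous]])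
  show "\<exists>N. \<forall>n\<ge>N. - y \<le> X (dyad n t) \<omega>"
  proof (intro exI allI impI)
    fix n
    have "\<forall>n k. - y < X (real k / 2 ^ n) \<omega>" using assms(1,2) by (auto simp: reach_def not_le)
    then show "- y \<le> X (dyad n t) \<omega>" unfolding dyad_def by (blast intro: less_imp_le)
  qed
qed (use assms in auto)

text \<open>By \<open>cadlag_hits_zero\<close> a nonpositive value would force a zero no later than
  \<open>t\<close>.\<close>

lemma zeta_infinity_pos:
  assumes "zeta (\<lambda>t. x + X t \<omega>) = \<infinity>" "0 < x" "0 \<le> t"
  shows "0 < x + X t \<omega>"
proof (rule ccontr)
  assume *: "\<not> 0 < x + X t \<omega>"
  have "\<exists>s>0. s \<le> t \<and> x + X s \<omega> = 0"
  proof (rule cadlag_hits_zero)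
    show "cadlag (\<lambda>t. x + X t \<omega>)" unfolding cadlag_def
    proof (intro conjI allI impI)
      fix t :: real assume "0 \<le> t"
      then show "continuous (at_right t) (\<lambda>t. x + X t \<omega>)" by (intro continuous_intros right_continuous)
    next
      fix t :: real assume "0 < t"
      then obtain l where "((\<lambda>t. X t \<omega>) \<longlongrightarrow> l) (at_left t)" using cadlag_X[of \<omega>] by (auto simp: cadlag_def)
      then have "((\<lambda>t. x + X t \<omega>) \<longlongrightarrow> x + l) (at_left t)" by (intro tendsto_intros)
      then show "\<exists>l. ((\<lambda>t. x + X t \<omega>) \<longlongrightarrow> l) (at_left t)" by blast
    qed
    show "no_negative_jumps (\<lambda>t. x + X t \<omega>)" unfolding no_negative_jumps_def
    proof (intro allI impI)
      fix t l :: real assume t: "0 < t" and "((\<lambda>t. x + X t \<omega>) \<longlongrightarrow> l) (at_left t)"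
      then have "((\<lambda>t. (x + X t \<omega>) - x) \<longlongrightarrow> l - x) (at_left t)" by (intro tendsto_intros)
      then have "l - x \<le> X t \<omega>" using no_negative_jumps_X t by (auto simp: no_negative_jumps_def)
      then show "l \<le> x + X t \<omega>" by simp
    qed
  qed (use * assms in \<open>auto simp: X_zero\<close>)
  then obtain s where "0 < s" "x + X s \<omega> = 0" by blast
  then have "zeta (\<lambda>t. x + X t \<omega>) \<le> ereal s" unfolding zeta_def by (intro Inf_lower) auto
  with assms(1) show False by simp
qed

lemma not_reach_pos:
  assumes "\<omega> \<in> space M" "\<omega> \<notin> reach y" "y < x" "0 \<le> t"
  shows "0 < x + X t \<omega>"
  using not_reach_lower[OF assms(1,2,4)] assms(3) by simp

text \<open>That \<open>\<zeta> = \<infinity>\<close> excludes \<open>reach x\<close> holds path by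
  path. The converse can fail for a path that touches 0 only at a nondyadic time; the gap from
  \<open>AE_reach\<close> excludes this almost surely.\<close>

lemma AE_zeta_reach:
  assumes "0 < x"
  shows "AE \<omega> in M. zeta (\<lambda>t. x + X t \<omega>) = \<infinity> \<longleftrightarrow> \<omega> \<notin> reach x"
  using AE_reach[OF assms] AE_space
proof eventually_elim
  fix \<omega> assume *: "(\<forall>y<x. \<omega> \<in> reach y) \<longrightarrow> \<omega> \<in> reach x" and \<omega>: "\<omega> \<in> space M"
  show "zeta (\<lambda>t. x + X t \<omega>) = \<infinity> \<longleftrightarrow> \<omega> \<notin> reach x"
  proof
    assume z: "zeta (\<lambda>t. x + X t \<omega>) = \<infinity>"
    have "0 < x + X (real k / 2 ^ n) \<omega>" for k n by (rule zeta_infinity_pos[OF z assms]) simp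
    then have "- x < X (real k / 2 ^ n) \<omega>" for k n by (smt (verit))
    then show "\<omega> \<notin> reach x" by (auto simp: reach_def not_le)
  next
    assume "\<omega> \<notin> reach x"
    with * obtain y where "y < x" "\<omega> \<notin> reach y" by blast
    then show "zeta (\<lambda>t. x + X t \<omega>) = \<infinity>"
      using not_reach_pos[OF \<omega>] by (intro zeta_infinityI) auto
  qed
qed

section \<open>Low frequencies of \<open>g\<close> as an exponent measure\<close>

definition g0 :: "real \<Rightarrow> real" where
  "g0 l = indicator {0<..} l * g l"

lemma measurable_g0 [measurable]: "g0 \<in> borel_measurable borel"
proof -
  have "(\<lambda>l. indicator {0<..} l *\<^sub>R g l) \<in> borel_measurable borel"
    using g_measurable by (subst (asm) borel_measurable_restrict_space_iff) auto
  then show ?thesis by (simp add: g0_def[abs_def])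
qed

lemma g0_nonneg: "0 \<le> g0 l"
  using g_nonneg by (auto simp: g0_def indicator_def)

lemma f_nn_integral:
  assumes "0 < x"
  shows "ennreal (f x) = (\<integral>\<^sup>+l. ennreal (g0 l) * ennreal (exp (- l * x)) \<partial>lborel)"
proof -
  have eq: "indicator {0<..} z *\<^sub>R (exp (- x * z) * g z) = g0 z * exp (- z * x)" for z
    by (auto simp: g0_def indicator_def mult.commute)
  have "integrable lborel (\<lambda>z. g0 z * exp (- z * x))"
    using g_integrable[OF assms] unfolding set_integrable_def eq .
  then have "(\<integral>\<^sup>+z. ennreal (g0 z * exp (- z * x)) \<partial>lborel) = ennreal (\<integral>z. g0 z * exp (- z * x) \<partial>lborel)"
    by (intro nn_integral_eq_integral) (auto simp: g0_nonneg)
  also have "(\<integral>z. g0 z * exp (- z * x) \<partial>lborel) = f x"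
    unfolding f_eq[OF assms] set_lebesgue_integral_def eq ..
  finally show ?thesis by (simp add: ennreal_mult g0_nonneg)
qed

definition gmeas :: "real \<Rightarrow> real measure" where
  "gmeas d = density lborel (\<lambda>l. ennreal (g0 l) * indicator {..<d} l)"

lemma nn_integral_gmeas:
  assumes [measurable]: "h \<in> borel_measurable borel"
  shows "(\<integral>\<^sup>+l. h l \<partial>gmeas d) = (\<integral>\<^sup>+l. ennreal (g0 l) * indicator {..<d} l * h l \<partial>lborel)"
  unfolding gmeas_def by (rule nn_integral_density) measurable

lemma lap_gmeas: "lap (gmeas d) z = (\<integral>\<^sup>+l. ennreal (g0 l) * indicator {..<d} l * ennreal (exp (- l * z)) \<partial>lborel)"
  unfolding lap_def by (rule nn_integral_gmeas) measurable

lemma lap_gmeas_le_f: "0 < z \<Longrightarrow> lap (gmeas d) z \<le> ennreal (f z)"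
  unfolding lap_gmeas f_nn_integral by (intro nn_integral_mono) (auto simp: indicator_def)

text \<open>Below \<open>d\<close> the weight \<open>exp d * exp (- l)\<close> is at least 1, so the
  total mass is at most \<open>exp d * f 1\<close>.\<close>

lemma exponent_measure_gmeas:
  assumes "0 < d"
  shows "exponent_measure M X psi Phi C (gmeas d)"
proof (intro exponent_measure.intro regular_levy_axioms exponent_measure_axioms.intro)
  show "sets (gmeas d) = sets borel" by (simp add: gmeas_def)
  show "finite_measure (gmeas d)"
  proof (rule finite_measureI)
    have "emeasure (gmeas d) (space (gmeas d)) = (\<integral>\<^sup>+l. ennreal (g0 l) * indicator {..<d} l \<partial>lborel)"
      unfolding gmeas_def by (subst emeasure_density) (auto intro!: nn_integral_cong)
    also have "\<dots> \<le> (\<integral>\<^sup>+l. ennreal (exp d) * (ennreal (g0 l) * ennreal (exp (- l * 1))) \<partial>lborel)"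
    proof (rule nn_integral_mono)
      fix l :: real
      show "ennreal (g0 l) * indicator {..<d} l \<le> ennreal (exp d) * (ennreal (g0 l) * ennreal (exp (- l * 1)))"
      proof (cases "l < d")
        case True
        then have "g0 l * 1 \<le> g0 l * (exp d * exp (- l))"
          by (intro mult_left_mono g0_nonneg) (simp add: exp_add[symmetric])
        then show ?thesis using True by (simp add: ennreal_mult[symmetric] g0_nonneg ennreal_leI mult_ac)
      qed simp
    qed
    also have "\<dots> = ennreal (exp d) * ennreal (f 1)" by (simp add: nn_integral_cmult f_nn_integral)
    also have "\<dots> < \<infinity>" by (simp add: ennreal_mult_less_top)
    finally show "emeasure (gmeas d) (space (gmeas d)) \<noteq> \<infinity>" by simp
  qed
qed

lemma AE_gmeas: "AE l in gmeas d. 0 < l \<and> l < d"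
  unfolding gmeas_def by (subst AE_density, measurable) (auto simp: g0_def indicator_def)

text \<open>On \<open>(0, d)\<close> the exponent is negative, so \<open>g / psi\<close> has
  constant sign and its integrability is the finiteness of one nonnegative integral, the form in
  which (iv) meets the moment formulas.\<close>

lemma set_integrable_iff_gmeas:
  assumes "0 < d" "d < Phi"
  shows "set_integrable lborel {0<..<d} (\<lambda>l. g l / psi l) \<longleftrightarrow> (\<integral>\<^sup>+l. ennreal (1 / - psi l) \<partial>gmeas d) < \<infinity>"
proof -
  have eq: "indicator {0<..<d} l *\<^sub>R (g l / psi l) = indicator {..<d} l * (g0 l / psi l)" for l
    by (auto simp: g0_def indicator_def)
  have norm: "ennreal (norm (indicator {..<d} l * (g0 l / psi l))) = ennreal (g0 l) * indicator {..<d} l * ennreal (1 / - psi l)" for l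
  proof (cases "0 < l \<and> l < d")
    case True
    then have "psi l < 0" using psi_neg assms by auto
    then have "ennreal (\<bar>g0 l / psi l\<bar>) = ennreal (g0 l * (1 / - psi l))" by (simp add: abs_divide g0_nonneg)
    also have "\<dots> = ennreal (g0 l) * ennreal (1 / - psi l)"
      using \<open>psi l < 0\<close> by (intro ennreal_mult g0_nonneg) simp
    finally show ?thesis using True by (simp add: abs_divide)
  qed (auto simp: g0_def indicator_def)
  show ?thesis
    unfolding set_integrable_def eq integrable_iff_bounded norm
    by (subst nn_integral_gmeas) auto
qed

text \<open>For \<open>l \<ge> d\<close> and \<open>z > y\<close>, \<open>exp (- l * z)\<close> is
  at most \<open>exp (- l * y) * exp (- d * (z - y))\<close>; integration against \<open>g\<close>
  bounds the high frequencies through \<open>f y\<close>.\<close>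

lemma functional_split:
  assumes "0 < d" "d < Phi" "0 < y" "y < z"
  shows "ennreal (f z) \<le> lap (gmeas d) z + ennreal (exp (d * y)) * ennreal (f y) * ennreal (exp (- d * z))"
proof -
  have "ennreal (f z) \<le> (\<integral>\<^sup>+l. ennreal (g0 l) * indicator {..<d} l * ennreal (exp (- l * z)) +
      ennreal (exp (d * y) * exp (- d * z)) * (ennreal (g0 l) * ennreal (exp (- l * y))) \<partial>lborel)"
    unfolding f_nn_integral[OF less_trans[OF assms(3,4)]]
  proof (rule nn_integral_mono)
    fix l :: real
    show "ennreal (g0 l) * ennreal (exp (- l * z)) \<le> ennreal (g0 l) * indicator {..<d} l * ennreal (exp (- l * z)) +
      ennreal (exp (d * y) * exp (- d * z)) * (ennreal (g0 l) * ennreal (exp (- l * y)))"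
    proof (cases "l < d")
      case False
      then have "(l - d) * y \<le> (l - d) * z" using assms by (intro mult_left_mono) auto
      then have "exp (- l * z) \<le> exp (d * y) * exp (- d * z) * exp (- l * y)"
        by (simp add: exp_add[symmetric] algebra_simps)
      then have "g0 l * exp (- l * z) \<le> exp (d * y) * exp (- d * z) * (g0 l * exp (- l * y))"
        using mult_left_mono[OF _ g0_nonneg[of l]] by (fastforce simp: mult_ac)
      then show ?thesis using False
        by (simp add: ennreal_mult[symmetric] g0_nonneg ennreal_leI)
    qed (simp add: add_increasing2)
  qed
  also have "\<dots> = lap (gmeas d) z + ennreal (exp (d * y) * exp (- d * z)) * ennreal (f y)"
    unfolding lap_gmeas f_nn_integral[OF assms(3)]
    by (subst nn_integral_add) (auto simp: nn_integral_cmult)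
  finally show ?thesis by (simp add: ennreal_mult mult_ac)
qed

text \<open>Time above \<open>y\<close> is collected along the whole path rather than up to first
  passage. One quantity then dominates the functional up to \<open>tau_minus\<close> and equals the
  full functional on paths that stay above \<open>y\<close>.\<close>

definition occ :: "real \<Rightarrow> real \<Rightarrow> 'a \<Rightarrow> ennreal" where
  "occ x y \<omega> = (\<integral>\<^sup>+s. ennreal (f (x + X s \<omega>)) * indicator {s. 0 \<le> s \<and> y < x + X s \<omega>} s \<partial>lborel)"

lemma occ_bound:
  assumes d: "0 < d" "d < Phi" and int: "(\<integral>\<^sup>+l. ennreal (1 / - psi l) \<partial>gmeas d) < \<infinity>"
    and xy: "0 < y" "0 < x"
  obtains B where "B \<in> borel_measurable M" "(\<integral>\<^sup>+\<omega>. B \<omega> \<partial>M) < \<infinity>" "\<And>\<omega>. \<omega> \<in> space M \<Longrightarrow> occ x y \<omega> \<le> B \<omega>"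
proof
  interpret G: exponent_measure M X psi Phi C "gmeas d" by (rule exponent_measure_gmeas[OF d(1)])
  let ?K = "ennreal (exp (d * y)) * ennreal (f y)"
  let ?B = "\<lambda>\<omega>. pot (lap (gmeas d)) \<omega> + ?K * pot (\<lambda>z. ennreal (exp (- d * z))) \<omega>"
  show "?B \<in> borel_measurable M" by measurable
  have ae: "AE l in gmeas d. 0 < l \<and> l < Phi" using AE_gmeas[of d] by eventually_elim (use d in auto)
  have "(\<integral>\<^sup>+\<omega>. ?B \<omega> \<partial>M) = (\<integral>\<^sup>+l. ennreal (1 / - psi l) \<partial>gmeas d) + ?K * ennreal (1 / - psi d)"
    unfolding G.expectation_pot_lap[OF ae, symmetric] expectation_pot_exp[OF d, symmetric]
    by (simp add: nn_integral_add nn_integral_cmult)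
  also have "\<dots> < \<infinity>" using int by (simp add: ennreal_mult_less_top)
  finally show "(\<integral>\<^sup>+\<omega>. ?B \<omega> \<partial>M) < \<infinity>" .
  fix \<omega> assume \<omega>[measurable]: "\<omega> \<in> space M"
  have "occ x y \<omega> \<le> (\<integral>\<^sup>+s. lap (gmeas d) (X (max 0 s) \<omega>) * indicator {0..} s +
      ?K * (ennreal (exp (- d * X (max 0 s) \<omega>)) * indicator {0..} s) \<partial>lborel)"
    unfolding occ_def
  proof (rule nn_integral_mono)
    fix s :: real
    show "ennreal (f (x + X s \<omega>)) * indicator {s. 0 \<le> s \<and> y < x + X s \<omega>} s \<le>
      lap (gmeas d) (X (max 0 s) \<omega>) * indicator {0..} s + ?K * (ennreal (exp (- d * X (max 0 s) \<omega>)) * indicator {0..} s)"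
    proof (cases "0 \<le> s \<and> y < x + X s \<omega>")
      case True
      have "ennreal (f (x + X s \<omega>)) \<le> lap (gmeas d) (x + X s \<omega>) + ?K * ennreal (exp (- d * (x + X s \<omega>)))"
        using functional_split[OF d xy(1), of "x + X s \<omega>"] True by simp
      \<comment> \<open>Dropping \<open>x > 0\<close> can only raise these decreasing functions, so
        the same majorant serves every positive starting point.\<close>
      also have "\<dots> \<le> lap (gmeas d) (X s \<omega>) + ?K * ennreal (exp (- d * X s \<omega>))"
      proof (intro add_mono mult_left_mono ennreal_leI)
        show "lap (gmeas d) (x + X s \<omega>) \<le> lap (gmeas d) (X s \<omega>)"
          unfolding lap_def
        proof (rule nn_integral_mono_AE, use AE_gmeas[of d] in eventually_elim)
          fix l :: real assume "0 < l \<and> l < d"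
          then have "- l * (x + X s \<omega>) \<le> - l * X s \<omega>" using xy by simp
          then show "ennreal (exp (- l * (x + X s \<omega>))) \<le> ennreal (exp (- l * X s \<omega>))" by (simp add: ennreal_leI)
        qed
        show "exp (- d * (x + X s \<omega>)) \<le> exp (- d * X s \<omega>)" using d xy by simp
      qed simp
      finally show ?thesis using True by simp
    qed simp
  qed
  also have "\<dots> = ?B \<omega>"
    unfolding pot_def by (simp add: nn_integral_add nn_integral_cmult)
  finally show "occ x y \<omega> \<le> ?B \<omega>" .
qed

text \<open>Strictly before the passage time the path is above \<open>y\<close>; only the passage
  time itself may fail, and one point has Lebesgue measure 0.\<close>

lemma additive_functional_tau_le:
  "additive_functional f (\<lambda>t. x + X t \<omega>) (tau_minus y (\<lambda>t. x + X t \<omega>)) \<le> occ x y \<omega>"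
  unfolding additive_functional_def occ_def
proof (rule nn_integral_mono_AE)
  let ?T = "tau_minus y (\<lambda>t. x + X t \<omega>)"
  show "AE s in lborel. ennreal (f (x + X s \<omega>)) * indicator {s. 0 \<le> s \<and> ereal s \<le> ?T} s \<le>
      ennreal (f (x + X s \<omega>)) * indicator {s. 0 \<le> s \<and> y < x + X s \<omega>} s"
    \<comment> \<open>For an infinite passage time \<open>real_of_ereal\<close> gives 0, and
      excluding that point is harmless.\<close>
    using AE_lborel_singleton[of "real_of_ereal ?T"]
  proof eventually_elim
    fix s :: real assume s: "s \<noteq> real_of_ereal ?T"
    show "ennreal (f (x + X s \<omega>)) * indicator {s. 0 \<le> s \<and> ereal s \<le> ?T} s \<le>
      ennreal (f (x + X s \<omega>)) * indicator {s. 0 \<le> s \<and> y < x + X s \<omega>} s"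
    proof (cases "0 \<le> s \<and> ereal s \<le> ?T")
      case True
      have "y < x + X s \<omega>"
      proof (rule ccontr)
        assume "\<not> y < x + X s \<omega>"
        then have "?T \<le> ereal s" unfolding tau_minus_def using True by (intro Inf_lower) auto
        with True have "?T = ereal s" by simp
        with s show False by simp
      qed
      then show ?thesis using True by simp
    qed simp
  qed
qed

lemma expectation_functional_finite:
  assumes d: "0 < d" "d < Phi" and int: "(\<integral>\<^sup>+l. ennreal (1 / - psi l) \<partial>gmeas d) < \<infinity>"
    and xy: "0 < y" "0 < x"
  shows "(\<integral>\<^sup>+\<omega>. additive_functional f (\<lambda>t. x + X t \<omega>) (tau_minus y (\<lambda>t. x + X t \<omega>)) \<partial>M) < \<infinity>"
proof -
  obtain B where B: "(\<integral>\<^sup>+\<omega>. B \<omega> \<partial>M) < \<infinity>" "\<And>\<omega>. \<omega> \<in> space M \<Longrightarrow> occ x y \<omega> \<le> B \<omega>"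
    using occ_bound[OF assms] by blast
  have "(\<integral>\<^sup>+\<omega>. additive_functional f (\<lambda>t. x + X t \<omega>) (tau_minus y (\<lambda>t. x + X t \<omega>)) \<partial>M) \<le> (\<integral>\<^sup>+\<omega>. B \<omega> \<partial>M)"
    by (intro nn_integral_mono order_trans[OF additive_functional_tau_le] B)
  then show ?thesis using B(1) by (rule le_less_trans)
qed

text \<open>Countably many levels tending to 0 are treated off one null set. If
  \<open>\<zeta> = \<infinity>\<close>, \<open>AE_reach\<close> keeps the path above some positive
  level, so the full functional equals the occupation integral above one of these levels.\<close>

lemma AE_functional_finite:
  assumes d: "0 < d" "d < Phi" and int: "(\<integral>\<^sup>+l. ennreal (1 / - psi l) \<partial>gmeas d) < \<infinity>"
    and x: "0 < x"
  shows "AE \<omega> in M. zeta (\<lambda>t. x + X t \<omega>) = \<infinity> \<longrightarrow> additive_functional f (\<lambda>t. x + X t \<omega>) \<infinity> < \<infinity>"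
proof -
  have "AE \<omega> in M. occ x (x / real (n + 2)) \<omega> < \<infinity>" for n
  proof -
    obtain B where B: "B \<in> borel_measurable M" "(\<integral>\<^sup>+\<omega>. B \<omega> \<partial>M) < \<infinity>"
      "\<And>\<omega>. \<omega> \<in> space M \<Longrightarrow> occ x (x / real (n + 2)) \<omega> \<le> B \<omega>"
      using occ_bound[OF d int _ x, of "x / real (n + 2)"] x by auto
    have "AE \<omega> in M. B \<omega> \<noteq> \<infinity>" using B(1,2) by (intro nn_integral_noteq_infinite) auto
    then show ?thesis using AE_space
    proof eventually_elim
      fix \<omega> assume "B \<omega> \<noteq> \<infinity>" "\<omega> \<in> space M"
      then have "occ x (x / real (n + 2)) \<omega> \<le> B \<omega>" "B \<omega> < \<infinity>" using B(3) by (auto simp: less_top)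
      then show "occ x (x / real (n + 2)) \<omega> < \<infinity>" by (rule le_less_trans)
    qed
  qed
  then have "AE \<omega> in M. \<forall>n. occ x (x / real (n + 2)) \<omega> < \<infinity>" by (subst AE_all_countable) blast
  then show ?thesis using AE_zeta_reach[OF x] AE_reach[OF x] AE_space
  proof eventually_elim
    fix \<omega> assume occ: "\<forall>n. occ x (x / real (n + 2)) \<omega> < \<infinity>" and z: "zeta (\<lambda>t. x + X t \<omega>) = \<infinity> \<longleftrightarrow> \<omega> \<notin> reach x"
      and r: "(\<forall>y<x. \<omega> \<in> reach y) \<longrightarrow> \<omega> \<in> reach x" and \<omega>: "\<omega> \<in> space M"
    show "zeta (\<lambda>t. x + X t \<omega>) = \<infinity> \<longrightarrow> additive_functional f (\<lambda>t. x + X t \<omega>) \<infinity> < \<infinity>"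
    proof
      assume "zeta (\<lambda>t. x + X t \<omega>) = \<infinity>"
      with z r obtain y where y: "y < x" "\<omega> \<notin> reach y" by blast
      have "(\<lambda>n. x / real (n + 2)) \<longlonglongrightarrow> 0" by real_asymp
      then have "\<forall>\<^sub>F n in sequentially. x / real (n + 2) < x - y" using y by (intro order_tendstoD) auto
      then obtain n where n: "x / real (n + 2) < x - y" by (auto simp: eventually_sequentially)
      have "additive_functional f (\<lambda>t. x + X t \<omega>) \<infinity> = occ x (x / real (n + 2)) \<omega>"
        unfolding additive_functional_def occ_def
      proof (intro nn_integral_cong arg_cong2[where f="(*)"] refl)
        fix s :: real
        show "indicator {s. 0 \<le> s \<and> ereal s \<le> \<infinity>} s = (indicator {s. 0 \<le> s \<and> x / real (n + 2) < x + X s \<omega>} s :: ennreal)"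
          using not_reach_lower[OF \<omega> y(2), of s] n by (auto simp: indicator_def)
      qed
      with occ show "additive_functional f (\<lambda>t. x + X t \<omega>) \<infinity> < \<infinity>" by simp
    qed
  qed
qed

text \<open>Divergence is known for the path started at 0; \<open>lap_shift\<close> moves it to
  \<open>x\<close> at the cost of a finite factor, and on \<open>\<zeta> = \<infinity>\<close> the
  path is positive, where \<open>f\<close> dominates its low-frequency part.\<close>

lemma AE_functional_infinite:
  assumes inf: "(\<integral>\<^sup>+l. ennreal (1 / - psi l) \<partial>gmeas (Phi / 3)) = \<infinity>" and x: "0 < x"
  shows "AE \<omega> in M. zeta (\<lambda>t. x + X t \<omega>) = \<infinity> \<longrightarrow> additive_functional f (\<lambda>t. x + X t \<omega>) \<infinity> = \<infinity>"
proof -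
  let ?d = "Phi / 3"
  interpret G: exponent_measure M X psi Phi C "gmeas ?d"
    by (rule exponent_measure_gmeas) (use Phi_pos in simp)
  show ?thesis
    using G.AE_pot_lap_top[OF AE_gmeas inf] AE_space
  proof (eventually_elim, intro impI)
    fix \<omega> assume top: "pot (lap (gmeas ?d)) \<omega> = \<infinity>" and z: "zeta (\<lambda>t. x + X t \<omega>) = \<infinity>" and \<omega>[measurable]: "\<omega> \<in> space M"
    have "pot (lap (gmeas ?d)) \<omega> \<le>
      (\<integral>\<^sup>+s. ennreal (exp (?d * \<bar>- x\<bar>)) * (lap (gmeas ?d) (x + X (max 0 s) \<omega>) * indicator {0..} s) \<partial>lborel)"
      unfolding pot_def
    proof (rule nn_integral_mono)
      fix s :: real
      show "lap (gmeas ?d) (X (max 0 s) \<omega>) * indicator {0..} s \<le>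
          ennreal (exp (?d * \<bar>- x\<bar>)) * (lap (gmeas ?d) (x + X (max 0 s) \<omega>) * indicator {0..} s)"
        using G.lap_shift[OF AE_gmeas, of "x + X (max 0 s) \<omega>" "- x"] by (cases "0 \<le> s") (simp_all add: max_def)
    qed
    also have "\<dots> = ennreal (exp (?d * \<bar>- x\<bar>)) * (\<integral>\<^sup>+s. lap (gmeas ?d) (x + X (max 0 s) \<omega>) * indicator {0..} s \<partial>lborel)"
      by (rule nn_integral_cmult) measurable
    also have "\<dots> \<le> ennreal (exp (?d * \<bar>- x\<bar>)) * additive_functional f (\<lambda>t. x + X t \<omega>) \<infinity>"
      unfolding additive_functional_def
    proof (intro mult_left_mono nn_integral_mono)
      fix s :: real
      show "lap (gmeas ?d) (x + X (max 0 s) \<omega>) * indicator {0..} s \<le> ennreal (f (x + X s \<omega>)) * indicator {s. 0 \<le> s \<and> ereal s \<le> \<infinity>} s"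
        using lap_gmeas_le_f[OF zeta_infinity_pos[OF z x, of s]] by (auto simp: indicator_def)
    qed simp
    finally show "additive_functional f (\<lambda>t. x + X t \<omega>) \<infinity> = \<infinity>"
      using top by (auto simp: top_unique ennreal_mult_eq_top_iff)
  qed
qed

end

section \<open>Equivalence of the four statements\<close>

theorem corollary2p3:
  fixes M :: "'a measure" and X :: "real \<Rightarrow> 'a \<Rightarrow> real"
    and b c :: real and \<pi> :: "real measure" and f g :: "real \<Rightarrow> real"
  assumes "spectrally_positive_levy_process M X b c \<pi>"
    and "\<not> subordinator M X"
    and "Phi0 b c \<pi> > 0"
    and "f \<in> borel_measurable (restrict_space borel {0<..})"
    and "g \<in> borel_measurable (restrict_space borel {0<..})"
    and "\<And>z. z > 0 \<Longrightarrow> g z \<ge> 0"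
    and "\<And>x. x > 0 \<Longrightarrow> set_integrable lborel {0<..} (\<lambda>z. exp (- x * z) * g z)"
    and "\<And>x. x > 0 \<Longrightarrow> f x = (LINT z:{0<..}|lborel. exp (- x * z) * g z)"
  defines "Z \<equiv> \<lambda>x \<omega> t. x + X t \<omega>"
  defines "S1 \<equiv> \<forall>x>0. cond_prob (completion M)
                    (\<lambda>\<omega>. additive_functional f (Z x \<omega>) \<infinity> < \<infinity>) (\<lambda>\<omega>. zeta (Z x \<omega>) = \<infinity>) > 0"
    and "S2 \<equiv> \<forall>x>0. cond_prob (completion M)
                    (\<lambda>\<omega>. additive_functional f (Z x \<omega>) \<infinity> < \<infinity>) (\<lambda>\<omega>. zeta (Z x \<omega>) = \<infinity>) = 1"
    and "S3 \<equiv> \<forall>x>0. \<forall>y\<in>{0<..<x}.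
                    (\<integral>\<^sup>+ \<omega>. additive_functional f (Z x \<omega>) (tau_minus y (Z x \<omega>)) \<partial>completion M) < \<infinity>"
    and "S4 \<equiv> \<exists>\<delta>>0. ereal \<delta> < Phi0 b c \<pi> \<and>
                    set_integrable lborel {0<..<\<delta>} (\<lambda>l. g l / laplace_exponent b c \<pi> l)"
  shows "(S1 \<longleftrightarrow> S2) \<and> (S2 \<longleftrightarrow> S3) \<and> (S3 \<longleftrightarrow> S4)"
proof -
  interpret L: spectrally_positive_levy_process M X b c \<pi> by fact
  let ?psi = "\<lambda>l. if 0 < l then laplace_exponent b c \<pi> l else 0"
  obtain Y Phi C where reg: "regular_levy M Y ?psi Phi C" and Phi0: "Phi0 b c \<pi> = ereal Phi"
    and YX: "AE \<omega> in M. \<forall>t. Y t \<omega> = X t \<omega>"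
    and Y: "\<And>\<omega>. cadlag (\<lambda>t. Y t \<omega>)" "\<And>\<omega>. no_negative_jumps (\<lambda>t. Y t \<omega>)"
    using L.regular_version[OF assms(2,3)] by blast
  interpret R: laplace_functional M Y ?psi Phi C f g
    using assms(5-8) by (intro laplace_functional.intro reg laplace_functional_axioms.intro Y) auto
  have ZY: "AE \<omega> in M. \<forall>x. Z x \<omega> = (\<lambda>t. x + Y t \<omega>)"
    using YX by eventually_elim (auto simp: Z_def)
  have zeta_reach: "AE \<omega> in M. zeta (Z x \<omega>) = \<infinity> \<longleftrightarrow> \<omega> \<notin> R.reach x" if "0 < x" for x
    using R.AE_zeta_reach[OF that] ZY by eventually_elim simp
  have S4_iff: "S4 \<longleftrightarrow> (\<exists>d>0. d < Phi \<and> (\<integral>\<^sup>+l. ennreal (1 / - ?psi l) \<partial>R.gmeas d) < \<infinity>)"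
  proof -
    have "set_integrable lborel {0<..<d} (\<lambda>l. g l / laplace_exponent b c \<pi> l) \<longleftrightarrow> set_integrable lborel {0<..<d} (\<lambda>l. g l / ?psi l)" for d
      by (intro set_integrable_cong) auto
    then show ?thesis unfolding S4_def Phi0 using R.set_integrable_iff_gmeas by (auto simp del: if_split)
  qed
  \<comment> \<open>The equivalences are assembled from (ii) to (i), from (i) or (iii) to (iv), and
    from (iv) to both (iii) and (ii).\<close>
  have "S2 \<Longrightarrow> S1" by (simp add: S1_def S2_def)
  moreover have "S4" if "S1 \<or> S3"
  proof (rule ccontr)
    assume "\<not> S4"
    \<comment> \<open>The failure of (iv) is used at the cut \<open>Phi / 3\<close>, which the
      second moment bound admits.\<close>
    then have inf: "(\<integral>\<^sup>+l. ennreal (1 / - ?psi l) \<partial>R.gmeas (Phi / 3)) = \<infinity>"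
      unfolding S4_iff using R.Phi_pos by (auto simp: less_top[symmetric] dest!: spec[of _ "Phi / 3"])
    have infinite: "AE \<omega> in M. zeta (Z x \<omega>) = \<infinity> \<longrightarrow> additive_functional f (Z x \<omega>) \<infinity> = \<infinity>" if "0 < x" for x
      using R.AE_functional_infinite[OF inf that] ZY by eventually_elim simp
    from that show False
    proof
      assume S1
      have "AE \<omega> in completion M. \<not> (additive_functional f (Z 1 \<omega>) \<infinity> < \<infinity> \<and> zeta (Z 1 \<omega>) = \<infinity>)"
        by (rule AE_completion, use infinite[OF zero_less_one] in eventually_elim) auto
      from emeasure_eq_0_AE[OF this]
      have "cond_prob (completion M) (\<lambda>\<omega>. additive_functional f (Z 1 \<omega>) \<infinity> < \<infinity>) (\<lambda>\<omega>. zeta (Z 1 \<omega>) = \<infinity>) = 0"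
        by (simp add: cond_prob_def measure_def)
      with \<open>S1\<close> show False unfolding S1_def by (metis less_irrefl zero_less_one)
    next
      assume S3
      \<comment> \<open>A path started at 2 with \<open>Y\<close> outside
        \<open>reach (1 / 2)\<close> never falls below \<open>3 / 2\<close>, so
        \<open>tau_minus 1\<close> and \<open>\<zeta>\<close> are both infinite; such paths have
        positive probability.\<close>
      let ?A = "\<lambda>\<omega>. additive_functional f (Z 2 \<omega>) (tau_minus 1 (Z 2 \<omega>))"
      have m: "space M - R.reach (1 / 2) \<in> L.events" by (auto intro: R.sets_reach)
      have "L.prob (space M - R.reach (1 / 2)) = 1 - exp (- Phi * (1 / 2))"
        using L.prob_compl[OF R.sets_reach] R.prob_reach[of "1 / 2"] by simp
      then have pos: "0 < L.prob (space M - R.reach (1 / 2))" using R.Phi_pos by simp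
      have "AE \<omega> in M. \<infinity> * indicator (space M - R.reach (1 / 2)) \<omega> \<le> ?A \<omega>"
        using infinite[of 2, OF zero_less_numeral] ZY AE_space
      proof eventually_elim
        fix \<omega> assume inf: "zeta (Z 2 \<omega>) = \<infinity> \<longrightarrow> additive_functional f (Z 2 \<omega>) \<infinity> = \<infinity>"
          and z: "\<forall>x. Z x \<omega> = (\<lambda>t. x + Y t \<omega>)" and \<omega>: "\<omega> \<in> space M"
        show "\<infinity> * indicator (space M - R.reach (1 / 2)) \<omega> \<le> ?A \<omega>"
        proof (cases "\<omega> \<in> R.reach (1 / 2)")
          case False
          have low: "1 < Z 2 \<omega> t" if "0 \<le> t" for t using R.not_reach_lower[OF \<omega> False that] z by simp
          have "tau_minus 1 (Z 2 \<omega>) = \<infinity>" using low by (rule tau_minus_infinityI)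
          moreover have "zeta (Z 2 \<omega>) = \<infinity>" using low by (intro zeta_infinityI) (force intro: less_trans[OF zero_less_one])
          ultimately show ?thesis using inf by simp
        qed simp
      qed
      then have "(\<integral>\<^sup>+\<omega>. \<infinity> * indicator (space M - R.reach (1 / 2)) \<omega> \<partial>M) \<le> (\<integral>\<^sup>+\<omega>. ?A \<omega> \<partial>M)"
        by (rule nn_integral_mono_AE)
      moreover have "(\<integral>\<^sup>+\<omega>. \<infinity> * indicator (space M - R.reach (1 / 2)) \<omega> \<partial>M) = \<infinity>"
        by (subst nn_integral_cmult_indicator[OF m]) (use pos in \<open>simp add: L.emeasure_eq_measure ennreal_top_mult\<close>)
      moreover have "(\<integral>\<^sup>+\<omega>. ?A \<omega> \<partial>M) < \<infinity>"
        using \<open>S3\<close> unfolding S3_def nn_integral_completion by (auto dest!: spec[of _ "2::real"] bspec[of _ _ 1])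
      ultimately show False by simp
    qed
  qed
  moreover have "S3" if "S4"
    unfolding S3_def nn_integral_completion
  proof (intro allI impI ballI)
    fix x y :: real assume xy: "0 < x" "y \<in> {0<..<x}"
    obtain d where d: "0 < d" "d < Phi" "(\<integral>\<^sup>+l. ennreal (1 / - ?psi l) \<partial>R.gmeas d) < \<infinity>"
      using \<open>S4\<close> unfolding S4_iff by blast
    have "(\<integral>\<^sup>+\<omega>. additive_functional f (Z x \<omega>) (tau_minus y (Z x \<omega>)) \<partial>M) =
        (\<integral>\<^sup>+\<omega>. additive_functional f (\<lambda>t. x + Y t \<omega>) (tau_minus y (\<lambda>t. x + Y t \<omega>)) \<partial>M)"
      by (rule nn_integral_cong_AE, use ZY in eventually_elim) simp
    also have "\<dots> < \<infinity>" using xy by (intro R.expectation_functional_finite[OF d]) auto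
    finally show "(\<integral>\<^sup>+\<omega>. additive_functional f (Z x \<omega>) (tau_minus y (Z x \<omega>)) \<partial>M) < \<infinity>" .
  qed
  moreover have "S2" if "S4"
    unfolding S2_def
  proof (intro allI impI)
    fix x :: real assume x: "0 < x"
    obtain d where d: "0 < d" "d < Phi" "(\<integral>\<^sup>+l. ennreal (1 / - ?psi l) \<partial>R.gmeas d) < \<infinity>"
      using \<open>S4\<close> unfolding S4_iff by blast
    define A where "A = space M - R.reach x"
    define B where "B = {\<omega>\<in>space (completion M). zeta (Z x \<omega>) = \<infinity>}"
    define D where "D = {\<omega>\<in>space (completion M). additive_functional f (Z x \<omega>) \<infinity> < \<infinity> \<and> zeta (Z x \<omega>) = \<infinity>}"
    have A: "A \<in> sets M" by (auto simp: A_def intro: R.sets_reach)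
    have AB: "AE \<omega> in M. \<omega> \<in> A \<longleftrightarrow> \<omega> \<in> B"
      using zeta_reach[OF x] AE_space by eventually_elim (auto simp: A_def B_def)
    have "AE \<omega> in M. zeta (Z x \<omega>) = \<infinity> \<longrightarrow> additive_functional f (Z x \<omega>) \<infinity> < \<infinity>"
      using R.AE_functional_finite[OF d x] ZY by eventually_elim simp
    with AB have AD: "AE \<omega> in M. \<omega> \<in> A \<longleftrightarrow> \<omega> \<in> D"
      by eventually_elim (auto simp: B_def D_def)
    \<comment> \<open>\<open>S\<close> is measurable for the completion because it agrees almost
      everywhere with the event \<open>A\<close> of \<open>M\<close>.\<close>
    have eq: "measure (completion M) S = L.prob A" if "S \<subseteq> space M" "AE \<omega> in M. \<omega> \<in> A \<longleftrightarrow> \<omega> \<in> S" for S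
    proof -
      have A': "A \<in> sets (completion M)" using A by simp
      have ae: "AE \<omega> in completion M. \<omega> \<in> A \<longleftrightarrow> \<omega> \<in> S" using that(2) by (rule AE_completion)
      have "S \<in> sets (completion M)" using that(1) by (intro completion.in_sets_AE[OF ae A']) simp
      then have "emeasure (completion M) A = emeasure (completion M) S" using ae A' by (intro emeasure_eq_AE)
      then show ?thesis using A by (simp add: measure_def)
    qed
    have "L.prob A = 1 - exp (- Phi * x)"
      unfolding A_def using L.prob_compl[OF R.sets_reach] R.prob_reach[OF x] by simp
    \<comment> \<open>Division by zero would give 0, so the quotient is 1 only because
      \<open>A\<close> has positive probability; this rests on \<open>Phi > 0\<close>.\<close>
    then have "L.prob A \<noteq> 0" using R.Phi_pos x by simp
    moreover have "measure (completion M) B = L.prob A" "measure (completion M) D = L.prob A"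
      using AB AD by (auto intro!: eq simp: B_def D_def)
    ultimately show "cond_prob (completion M) (\<lambda>\<omega>. additive_functional f (Z x \<omega>) \<infinity> < \<infinity>) (\<lambda>\<omega>. zeta (Z x \<omega>) = \<infinity>) = 1"
      by (simp add: cond_prob_def B_def D_def)
  qed
  ultimately show ?thesis by blast
qed

end
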